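(* Let $\mathbb{F}_8=\mathbb{F}_2(a)$ be the field with eight elements, where $a^3+a^2+1=0$, and let $A=\mathcal{M}_2(\mathbb{F}_8)$ be the ring of $2\times 2$ matrices over $\mathbb{F}_8$. Let $\sigma:A\to A$ be the $\mathbb{F}_2$-algebra automorphism that squares each matrix entry, i.e. $\sigma\begin{pmatrix} x_0 & x_1 \\ x_2 & x_3 \end{pmatrix}=\begin{pmatrix} x_0^2 & x_1^2 \\ x_2^2 & x_3^2 \end{pmatrix}$, and let $\delta:A\to A$ be the inner $\sigma$-derivation $\delta(X)=MX-\sigma(X)M$ with $M=\begin{pmatrix} 0 & 0 \\ 0 & a \end{pmatrix}$. Then the ring extension $\mathbb{F}_2[x]\subseteq A[x;\sigma,\delta]$ is biseparable but not Frobenius. In particular, biseparable extensions are not necessarily Frobenius.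
   Context: All rings are associative and unital. The Ore extension $A[x;\sigma,\delta]$ is the ring of polynomials in $x$ with coefficients in $A$ written on the left, with multiplication determined by $xb=\sigma(b)x+\delta(b)$ for $b\in A$; $\mathbb{F}_2[x]$ is the commutative polynomial ring, regarded as the subring of polynomials with coefficients in $\mathbb{F}_2=\mathbb{F}_2 1_A$. Let $C\subseteq B$ be a unital ring extension. - It is separable if there exists $p\in B\otimes_C B$ with $bp=pb$ for all $b\in B$ and $\mu(p)=1$, where $\mu:B\otimes_C B\to B$, $b_1\otimes b_2\mapsto b_1b_2$. - It is split if there exists a $C$-bimodule morphism $\xi:B\to C$ with $\xi(1)=1$. - It is biseparable if it is split, separable, and $B$ is finitely generated projective both as a left $C$-module and as a right $C$-module. - It is Frobenius if $B$ is a finitely generated projective right $C$-module and there is an isomorphism $B\cong B^*=\operatorname{Hom}(B_C,C_C)$ of $C$-$B$-bimodules, where $B^*$ is the set of right $C$-module morphisms $B\to C$ with $(c\chi b)(u)=c\,\chi(bu)$ for $\chi\in B^*$, $c\in C$, $b,u\in B$. *)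

theory Defs
  imports
    "HOL-Computational_Algebra.Polynomial"
    "Jordan_Normal_Form.Matrix"
    "HOL-Library.Z2"
    "HOL-Algebra.UnivPoly"
    "HOL-Algebra.Subrings"
    "HOL-Algebra.Free_Abelian_Groups"
begin

section \<open>Modules over noncommutative rings\<close>

text \<open>
  The locale \<open>module\<close> of HOL-Algebra requires a commutative base ring, so only its record of
  operations and the locale \<open>submodule\<close>, which make sense over every ring, are used.
  All notions are stated for left modules; a right \<open>R\<close>-module is a left module over the
  opposite ring of \<open>R\<close>, i.e. \<open>r \<odot> m\<close> then stands for the product of \<open>m\<close> by \<open>r\<close> on the right.
\<close>

definition opposite_ring :: "('a, 'm) ring_scheme \<Rightarrow> ('a, 'm) ring_scheme" where
  "opposite_ring R = R\<lparr>monoid.mult := \<lambda>x y. y \<otimes>\<^bsub>R\<^esub> x\<rparr>"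

definition left_hom ::
  "('r, 'm) ring_scheme \<Rightarrow> ('r, 'a, 'k) module_scheme \<Rightarrow> ('r, 'b, 'l) module_scheme \<Rightarrow> ('a \<Rightarrow> 'b) set"
where
  "left_hom R M N =
    {f. f \<in> carrier M \<rightarrow> carrier N \<and>
        (\<forall>u\<in>carrier M. \<forall>v\<in>carrier M. f (u \<oplus>\<^bsub>M\<^esub> v) = f u \<oplus>\<^bsub>N\<^esub> f v) \<and>
        (\<forall>r\<in>carrier R. \<forall>u\<in>carrier M. f (r \<odot>\<^bsub>M\<^esub> u) = r \<odot>\<^bsub>N\<^esub> f u)}"

text \<open>The free left module on the basis \<open>I\<close>: finitely supported families indexed by \<open>I\<close>
  (extended by zero outside \<open>I\<close>). The \<open>mult\<close> and \<open>one\<close> fields of the record are irrelevant.\<close>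

definition free_left_module :: "('r, 'm) ring_scheme \<Rightarrow> 'i set \<Rightarrow> ('r, 'i \<Rightarrow> 'r) module" where
  "free_left_module R I =
    \<lparr>carrier = {f. f \<in> UNIV \<rightarrow> carrier R \<and> {i. f i \<noteq> \<zero>\<^bsub>R\<^esub>} \<subseteq> I \<and> finite {i. f i \<noteq> \<zero>\<^bsub>R\<^esub>}},
     monoid.mult = \<lambda>f g. undefined, one = undefined,
     ring.zero = \<lambda>i. \<zero>\<^bsub>R\<^esub>, add = \<lambda>f g i. f i \<oplus>\<^bsub>R\<^esub> g i,
     smult = \<lambda>r f i. r \<otimes>\<^bsub>R\<^esub> f i\<rparr>"

definition direct_summand ::
  "('r, 'm) ring_scheme \<Rightarrow> ('r, 'a, 'k) module_scheme \<Rightarrow> 'a set \<Rightarrow> bool"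
where
  "direct_summand R F N \<longleftrightarrow>
    submodule N R F \<and>
    (\<exists>N'. submodule N' R F \<and> N \<inter> N' = {\<zero>\<^bsub>F\<^esub>} \<and> N <+>\<^bsub>F\<^esub> N' = carrier F)"

text \<open>Projective: isomorphic to a direct summand of a free module. It is no restriction to take
  the basis from the type of elements of \<open>M\<close>, as the elements of \<open>M\<close> themselves generate \<open>M\<close>.\<close>

definition projective_left :: "('r, 'm) ring_scheme \<Rightarrow> ('r, 'a, 'k) module_scheme \<Rightarrow> bool" where
  "projective_left R M \<longleftrightarrow>
    (\<exists>(I :: 'a set) N f. direct_summand R (free_left_module R I) N \<and>
       f \<in> left_hom R M ((free_left_module R I)\<lparr>carrier := N\<rparr>) \<and> bij_betw f (carrier M) N)"

definition finitely_generated_left ::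
  "('r, 'm) ring_scheme \<Rightarrow> ('r, 'a, 'k) module_scheme \<Rightarrow> bool"
where
  "finitely_generated_left R M \<longleftrightarrow>
    (\<exists>S. finite S \<and> S \<subseteq> carrier M \<and>
       (\<forall>u\<in>carrier M. \<exists>c \<in> S \<rightarrow> carrier R. u = (\<Oplus>\<^bsub>M\<^esub>s\<in>S. c s \<odot>\<^bsub>M\<^esub> s)))"

section \<open>Ring extensions\<close>

definition ring_extension :: "'b set \<Rightarrow> ('b, 'm) ring_scheme \<Rightarrow> bool" where
  "ring_extension C B \<longleftrightarrow> ring B \<and> subring C B"

definition ext_left_module :: "('b, 'm) ring_scheme \<Rightarrow> ('b, 'b) module" where
  "ext_left_module B =
    \<lparr>carrier = carrier B, monoid.mult = monoid.mult B, one = \<one>\<^bsub>B\<^esub>, ring.zero = \<zero>\<^bsub>B\<^esub>, add = add B,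
     smult = \<lambda>c b. c \<otimes>\<^bsub>B\<^esub> b\<rparr>"

definition ext_right_module :: "('b, 'm) ring_scheme \<Rightarrow> ('b, 'b) module" where
  "ext_right_module B =
    \<lparr>carrier = carrier B, monoid.mult = monoid.mult B, one = \<one>\<^bsub>B\<^esub>, ring.zero = \<zero>\<^bsub>B\<^esub>, add = add B,
     smult = \<lambda>c b. b \<otimes>\<^bsub>B\<^esub> c\<rparr>"

definition fg_projective_left_ext :: "'b set \<Rightarrow> ('b, 'm) ring_scheme \<Rightarrow> bool" where
  "fg_projective_left_ext C B \<longleftrightarrow>
    finitely_generated_left (B\<lparr>carrier := C\<rparr>) (ext_left_module B) \<and>
    projective_left (B\<lparr>carrier := C\<rparr>) (ext_left_module B)"

definition fg_projective_right_ext :: "'b set \<Rightarrow> ('b, 'm) ring_scheme \<Rightarrow> bool" where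
  "fg_projective_right_ext C B \<longleftrightarrow>
    finitely_generated_left (opposite_ring (B\<lparr>carrier := C\<rparr>)) (ext_right_module B) \<and>
    projective_left (opposite_ring (B\<lparr>carrier := C\<rparr>)) (ext_right_module B)"

subsection \<open>The tensor square \<open>B \<otimes>\<^sub>C B\<close>\<close>

text \<open>The free abelian group on pairs of elements of \<open>B\<close>, modulo the subgroup generated by the
  usual relations (biadditivity and \<open>C\<close>-balancedness). Its elements are cosets.\<close>

definition tensor_gen :: "'b \<Rightarrow> 'b \<Rightarrow> ('b \<times> 'b) \<Rightarrow>\<^sub>0 int" where
  "tensor_gen u v = frag_of (u, v)"

definition tensor_free :: "('b, 'm) ring_scheme \<Rightarrow> (('b \<times> 'b) \<Rightarrow>\<^sub>0 int) monoid" where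
  "tensor_free B = free_Abelian_group (carrier B \<times> carrier B)"

definition tensor_relations ::
  "'b set \<Rightarrow> ('b, 'm) ring_scheme \<Rightarrow> (('b \<times> 'b) \<Rightarrow>\<^sub>0 int) set"
where
  "tensor_relations C B = generate (tensor_free B)
    ({tensor_gen (u \<oplus>\<^bsub>B\<^esub> u') v - tensor_gen u v - tensor_gen u' v | u u' v.
        u \<in> carrier B \<and> u' \<in> carrier B \<and> v \<in> carrier B} \<union>
     {tensor_gen u (v \<oplus>\<^bsub>B\<^esub> v') - tensor_gen u v - tensor_gen u v' | u v v'.
        u \<in> carrier B \<and> v \<in> carrier B \<and> v' \<in> carrier B} \<union>
     {tensor_gen (u \<otimes>\<^bsub>B\<^esub> c) v - tensor_gen u (c \<otimes>\<^bsub>B\<^esub> v) | u c v.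
        u \<in> carrier B \<and> c \<in> C \<and> v \<in> carrier B})"

definition tensor_square ::
  "'b set \<Rightarrow> ('b, 'm) ring_scheme \<Rightarrow> (('b \<times> 'b) \<Rightarrow>\<^sub>0 int) set monoid"
where
  "tensor_square C B = tensor_free B Mod tensor_relations C B"

text \<open>The \<open>B\<close>-bimodule structure induced by \<open>b (u \<otimes> v) = (b u) \<otimes> v\<close> and
  \<open>(u \<otimes> v) b = u \<otimes> (v b)\<close>, and the multiplication map \<open>\<mu>\<close>. All three are given on representatives
  and do not depend on their choice, so each union below is a single coset and the image taken
  in \<open>tensor_mu\<close> is a singleton.\<close>

definition tensor_lmult ::
  "'b set \<Rightarrow> ('b, 'm) ring_scheme \<Rightarrow> 'b \<Rightarrow> (('b \<times> 'b) \<Rightarrow>\<^sub>0 int) set \<Rightarrow> (('b \<times> 'b) \<Rightarrow>\<^sub>0 int) set"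
where
  "tensor_lmult C B b P =
    (\<Union>f\<in>P. tensor_relations C B #>\<^bsub>tensor_free B\<^esub>
              frag_extend (\<lambda>(u, v). tensor_gen (b \<otimes>\<^bsub>B\<^esub> u) v) f)"

definition tensor_rmult ::
  "'b set \<Rightarrow> ('b, 'm) ring_scheme \<Rightarrow> (('b \<times> 'b) \<Rightarrow>\<^sub>0 int) set \<Rightarrow> 'b \<Rightarrow> (('b \<times> 'b) \<Rightarrow>\<^sub>0 int) set"
where
  "tensor_rmult C B P b =
    (\<Union>f\<in>P. tensor_relations C B #>\<^bsub>tensor_free B\<^esub>
              frag_extend (\<lambda>(u, v). tensor_gen u (v \<otimes>\<^bsub>B\<^esub> b)) f)"

definition tensor_mu :: "('b, 'm) ring_scheme \<Rightarrow> (('b \<times> 'b) \<Rightarrow>\<^sub>0 int) set \<Rightarrow> 'b" where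
  "tensor_mu B P = the_elem
    ((\<lambda>f. finsum B (\<lambda>(u, v). [Poly_Mapping.lookup f (u, v)] \<cdot>\<^bsub>B\<^esub> (u \<otimes>\<^bsub>B\<^esub> v)) (Poly_Mapping.keys f)) ` P)"

subsection \<open>Separable, split, biseparable and Frobenius extensions\<close>

definition separable_extension :: "'b set \<Rightarrow> ('b, 'm) ring_scheme \<Rightarrow> bool" where
  "separable_extension C B \<longleftrightarrow>
    (\<exists>p\<in>carrier (tensor_square C B).
       (\<forall>b\<in>carrier B. tensor_lmult C B b p = tensor_rmult C B p b) \<and> tensor_mu B p = \<one>\<^bsub>B\<^esub>)"

definition split_extension :: "'b set \<Rightarrow> ('b, 'm) ring_scheme \<Rightarrow> bool" where
  "split_extension C B \<longleftrightarrow>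
    (\<exists>\<xi>. \<xi> \<in> carrier B \<rightarrow> C \<and>
       (\<forall>u\<in>carrier B. \<forall>v\<in>carrier B. \<xi> (u \<oplus>\<^bsub>B\<^esub> v) = \<xi> u \<oplus>\<^bsub>B\<^esub> \<xi> v) \<and>
       (\<forall>c\<in>C. \<forall>u\<in>carrier B. \<xi> (c \<otimes>\<^bsub>B\<^esub> u) = c \<otimes>\<^bsub>B\<^esub> \<xi> u \<and> \<xi> (u \<otimes>\<^bsub>B\<^esub> c) = \<xi> u \<otimes>\<^bsub>B\<^esub> c) \<and>
       \<xi> \<one>\<^bsub>B\<^esub> = \<one>\<^bsub>B\<^esub>)"

definition biseparable_extension :: "'b set \<Rightarrow> ('b, 'm) ring_scheme \<Rightarrow> bool" where
  "biseparable_extension C B \<longleftrightarrow>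
    split_extension C B \<and> separable_extension C B \<and>
    fg_projective_left_ext C B \<and> fg_projective_right_ext C B"

text \<open>The elements of the dual are taken \<open>extensional\<close>, so that equality of functionals
  on \<open>B\<close> is equality in HOL.\<close>

definition right_dual :: "'b set \<Rightarrow> ('b, 'm) ring_scheme \<Rightarrow> ('b \<Rightarrow> 'b) set" where
  "right_dual C B =
    {\<chi>. \<chi> \<in> carrier B \<rightarrow>\<^sub>E C \<and>
        (\<forall>u\<in>carrier B. \<forall>v\<in>carrier B. \<chi> (u \<oplus>\<^bsub>B\<^esub> v) = \<chi> u \<oplus>\<^bsub>B\<^esub> \<chi> v) \<and>
        (\<forall>u\<in>carrier B. \<forall>c\<in>C. \<chi> (u \<otimes>\<^bsub>B\<^esub> c) = \<chi> u \<otimes>\<^bsub>B\<^esub> c)}"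

definition dual_add :: "('b, 'm) ring_scheme \<Rightarrow> ('b \<Rightarrow> 'b) \<Rightarrow> ('b \<Rightarrow> 'b) \<Rightarrow> 'b \<Rightarrow> 'b" where
  "dual_add B \<chi> \<psi> = (\<lambda>u\<in>carrier B. \<chi> u \<oplus>\<^bsub>B\<^esub> \<psi> u)"

definition dual_act :: "('b, 'm) ring_scheme \<Rightarrow> 'b \<Rightarrow> ('b \<Rightarrow> 'b) \<Rightarrow> 'b \<Rightarrow> 'b \<Rightarrow> 'b" where
  "dual_act B c \<chi> b = (\<lambda>u\<in>carrier B. c \<otimes>\<^bsub>B\<^esub> \<chi> (b \<otimes>\<^bsub>B\<^esub> u))"

definition frobenius_extension :: "'b set \<Rightarrow> ('b, 'm) ring_scheme \<Rightarrow> bool" where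
  "frobenius_extension C B \<longleftrightarrow>
    fg_projective_right_ext C B \<and>
    (\<exists>\<Phi>. bij_betw \<Phi> (carrier B) (right_dual C B) \<and>
       (\<forall>u\<in>carrier B. \<forall>v\<in>carrier B. \<Phi> (u \<oplus>\<^bsub>B\<^esub> v) = dual_add B (\<Phi> u) (\<Phi> v)) \<and>
       (\<forall>c\<in>C. \<forall>u\<in>carrier B. \<forall>b\<in>carrier B.
          \<Phi> (c \<otimes>\<^bsub>B\<^esub> u \<otimes>\<^bsub>B\<^esub> b) = dual_act B c (\<Phi> u) b))"

section \<open>Ore extensions\<close>

text \<open>Left multiplication by \<open>x\<close>, from \<open>x (b x\<^sup>n) = \<sigma>(b) x\<^sup>n\<^sup>+\<^sup>1 + \<delta>(b) x\<^sup>n\<close>.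
  Polynomials are coefficient sequences of finite support.\<close>

definition ore_x_mult ::
  "('a, 'm) ring_scheme \<Rightarrow> ('a \<Rightarrow> 'a) \<Rightarrow> ('a \<Rightarrow> 'a) \<Rightarrow> (nat \<Rightarrow> 'a) \<Rightarrow> nat \<Rightarrow> 'a"
where
  "ore_x_mult A \<sigma> \<delta> q =
    (\<lambda>k. (case k of 0 \<Rightarrow> \<zero>\<^bsub>A\<^esub> | Suc j \<Rightarrow> \<sigma> (q j)) \<oplus>\<^bsub>A\<^esub> \<delta> (q k))"

definition ore_extension ::
  "('a, 'm) ring_scheme \<Rightarrow> ('a \<Rightarrow> 'a) \<Rightarrow> ('a \<Rightarrow> 'a) \<Rightarrow> (nat \<Rightarrow> 'a) ring"
where
  "ore_extension A \<sigma> \<delta> =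
    \<lparr>carrier = up A,
     monoid.mult = \<lambda>p q k. \<Oplus>\<^bsub>A\<^esub>n\<in>{n. p n \<noteq> \<zero>\<^bsub>A\<^esub>}. p n \<otimes>\<^bsub>A\<^esub> ((ore_x_mult A \<sigma> \<delta> ^^ n) q) k,
     one = \<lambda>k. if k = 0 then \<one>\<^bsub>A\<^esub> else \<zero>\<^bsub>A\<^esub>,
     ring.zero = \<lambda>k. \<zero>\<^bsub>A\<^esub>,
     add = \<lambda>p q k. p k \<oplus>\<^bsub>A\<^esub> q k\<rparr>"

definition polys_with_coeffs_in :: "'a set \<Rightarrow> ('a, 'm) ring_scheme \<Rightarrow> (nat \<Rightarrow> 'a) set" where
  "polys_with_coeffs_in K A = {p \<in> up A. range p \<subseteq> K}"

section \<open>The field with eight elements\<close>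

text \<open>\<open>\<F>\<^sub>2[t] / (t\<^sup>3 + t\<^sup>2 + 1)\<close>, each class being represented by its element of degree below 3.\<close>

definition f8_modulus :: "bit poly" where
  "f8_modulus = [:1, 0, 1, 1:]"

lemma degree_f8_modulus [simp]: "degree f8_modulus = 3"
  by (simp add: f8_modulus_def)

lemma f8_modulus_nonzero [simp]: "f8_modulus \<noteq> 0"
  by (simp add: f8_modulus_def)

typedef f8 = "{p :: bit poly. degree p < 3}"
  by (rule exI[of _ 0]) simp

lemma degree_mod_f8_modulus: "degree (p mod f8_modulus) < 3"
  using degree_mod_less'[of f8_modulus p] by (cases "p mod f8_modulus = 0") auto

lemma Rep_f8_mod [simp]: "Rep_f8 x mod f8_modulus = Rep_f8 x"
  using Rep_f8[of x] by (simp add: mod_poly_less)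

definition f8_of_poly :: "bit poly \<Rightarrow> f8" where
  "f8_of_poly p = Abs_f8 (p mod f8_modulus)"

lemma Rep_f8_of_poly [simp]: "Rep_f8 (f8_of_poly p) = p mod f8_modulus"
  by (simp add: f8_of_poly_def Abs_f8_inverse degree_mod_f8_modulus)

instantiation f8 :: comm_ring_1
begin

definition "0 = f8_of_poly 0"
definition "1 = f8_of_poly 1"
definition "x + y = f8_of_poly (Rep_f8 x + Rep_f8 y)"
definition "- x = f8_of_poly (- Rep_f8 x)"
definition "x - y = f8_of_poly (Rep_f8 x - Rep_f8 y)"
definition "x * y = f8_of_poly (Rep_f8 x * Rep_f8 y)"

instance
proof
  have [simp]: "1 mod f8_modulus = 1"
    by (simp add: mod_poly_less)
  note defs = zero_f8_def one_f8_def plus_f8_def uminus_f8_def minus_f8_def times_f8_def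
    Rep_f8_inject[symmetric]
  fix x y z :: f8
  show "x * y * z = x * (y * z)"
    by (simp add: defs mod_mult_left_eq mod_mult_right_eq mult.assoc)
  show "x * y = y * x"
    by (simp add: defs mult.commute)
  show "1 * x = x"
    by (simp add: defs)
  show "x + y + z = x + (y + z)"
    by (simp add: defs mod_add_left_eq mod_add_right_eq add.assoc)
  show "x + y = y + x"
    by (simp add: defs add.commute)
  show "0 + x = x"
    by (simp add: defs)
  show "- x + x = 0"
    by (simp add: defs mod_add_left_eq)
  show "x - y = x + - y"
    by (simp add: defs mod_add_right_eq)
  show "(x + y) * z = x * z + y * z"
    by (simp add: defs mod_mult_left_eq mod_add_eq distrib_right)
  show "(0::f8) \<noteq> 1"
    by (simp add: defs)
qed

end

definition f8_gen :: f8 where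
  "f8_gen = f8_of_poly [:0, 1:]"

lemma f8_of_poly_ring:
  "f8_of_poly p * f8_of_poly q = f8_of_poly (p * q)"
  "f8_of_poly p + f8_of_poly q = f8_of_poly (p + q)"
  by (simp_all add: times_f8_def plus_f8_def Rep_f8_inject[symmetric] mod_simps)

lemma f8_gen_root: "f8_gen ^ 3 + f8_gen ^ 2 + 1 = 0"
proof -
  have "f8_gen ^ 3 + f8_gen ^ 2 + 1 = f8_of_poly ([:0, 1:] * ([:0, 1:] * [:0, 1:]) + [:0, 1:] * [:0, 1:] + 1)"
    by (simp only: f8_gen_def power2_eq_square power3_eq_cube mult.assoc one_f8_def f8_of_poly_ring)
  also have "[:0, 1:] * ([:0, 1:] * [:0, 1:]) + [:0, 1:] * [:0, 1:] + 1 = f8_modulus"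
    by (simp add: f8_modulus_def one_pCons)
  finally show ?thesis
    by (simp add: zero_f8_def Rep_f8_inject[symmetric])
qed

lemma f8_cases:
  obtains u v w where "x = f8_of_poly [:u, v, w:]"
proof
  have "Rep_f8 x = [:poly.coeff (Rep_f8 x) 0, poly.coeff (Rep_f8 x) 1, poly.coeff (Rep_f8 x) 2:]"
    using Rep_f8[of x]
    by (intro poly_eqI) (auto simp: coeff_pCons numeral_2_eq_2 split: nat.splits intro!: coeff_eq_0)
  then show "x = f8_of_poly [:poly.coeff (Rep_f8 x) 0, poly.coeff (Rep_f8 x) 1, poly.coeff (Rep_f8 x) 2:]"
    by (metis Rep_f8_inverse Rep_f8_mod f8_of_poly_def)
qed

lemma f8_of_poly_inject: "f8_of_poly [:u, v, w:] = f8_of_poly [:u', v', w':] \<longleftrightarrow> u = u' \<and> v = v' \<and> w = w'"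
proof -
  have "[:u, v, w:] mod f8_modulus = [:u, v, w:]" for u v w :: bit
    by (simp add: mod_poly_less)
  then show ?thesis
    by (simp add: Rep_f8_inject[symmetric])
qed

lemma card_bit: "card (UNIV :: bit set) = 2"
proof -
  have "(UNIV :: bit set) = {0, 1}"
    using bit_not_zero_iff by blast
  then show ?thesis
    by (metis card_2_iff zero_neq_one)
qed

lemma card_f8: "card (UNIV :: f8 set) = 8"
proof -
  have "bij (\<lambda>(u, v, w). f8_of_poly [:u, v, w:])"
    unfolding bij_def
    by (auto simp: inj_def f8_of_poly_inject surj_def) (metis f8_cases)
  then have "card (UNIV :: f8 set) = card (UNIV :: (bit \<times> bit \<times> bit) set)"
    by (metis bij_betw_same_card)
  also have "\<dots> = 8"
    by (simp add: card_cartesian_product card_bit flip: UNIV_Times_UNIV)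
  finally show ?thesis .
qed

lemma f8_eq_comb: "f8_of_poly [:u, v, w:] =
   f8_of_poly [:u:] + f8_of_poly [:v:] * f8_gen + f8_of_poly [:w:] * f8_gen ^ 2"
  by (simp add: f8_gen_def f8_of_poly_ring power2_eq_square)

lemma f8_add_self: "(x::f8) + x = 0"
proof -
  have "p + p = 0" for p :: "bit poly"
    by (intro poly_eqI) (metis Polynomial.coeff_add coeff_0 bit_2_eq_0 mult_2 mult_zero_left)
  then show ?thesis
    by (simp only: plus_f8_def zero_f8_def)
qed

lemma f8_gen_powers:
  "f8_gen ^ 3 = 1 + f8_gen ^ 2"
  "f8_gen ^ 4 = 1 + f8_gen + f8_gen ^ 2"
  "f8_gen ^ 5 = 1 + f8_gen"
  "f8_gen ^ 6 = f8_gen + f8_gen ^ 2"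
  "f8_gen ^ 7 = 1"
proof -
  have neg: "- x = x" for x :: f8
    using f8_add_self[of x] by (simp add: minus_unique)
  show 3: "f8_gen ^ 3 = 1 + f8_gen ^ 2"
    using f8_gen_root neg by (metis add.commute add.left_commute eq_neg_iff_add_eq_0)
  show 4: "f8_gen ^ 4 = 1 + f8_gen + f8_gen ^ 2"
    using arg_cong[OF 3, of "(*) f8_gen"] 3
    by (simp add: algebra_simps flip: power_Suc power_add)
       (simp add: power2_eq_square power3_eq_cube power4_eq_xxxx algebra_simps)
  show 5: "f8_gen ^ 5 = 1 + f8_gen"
  proof -
    have "f8_gen ^ 5 = f8_gen * f8_gen ^ 4"
      by (simp flip: power_Suc)
    also have "\<dots> = f8_gen + f8_gen ^ 2 + f8_gen ^ 3"
      unfolding 4 by (simp add: power2_eq_square power3_eq_cube algebra_simps)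
    also have "\<dots> = 1 + f8_gen + (f8_gen ^ 2 + f8_gen ^ 2)"
      unfolding 3 by (simp only: ac_simps)
    finally show ?thesis
      by (simp add: f8_add_self)
  qed
  show 6: "f8_gen ^ 6 = f8_gen + f8_gen ^ 2"
  proof -
    have "f8_gen ^ 6 = f8_gen * f8_gen ^ 5"
      by (simp flip: power_Suc)
    then show ?thesis
      unfolding 5 by (simp add: power2_eq_square algebra_simps)
  qed
  show "f8_gen ^ 7 = 1"
  proof -
    have "f8_gen ^ 7 = f8_gen * f8_gen ^ 6"
      by (simp flip: power_Suc)
    also have "\<dots> = f8_gen ^ 2 + f8_gen ^ 3"
      unfolding 6 by (simp add: power2_eq_square power3_eq_cube algebra_simps)
    also have "\<dots> = 1 + (f8_gen ^ 2 + f8_gen ^ 2)"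
      unfolding 3 by (simp only: ac_simps)
    finally show ?thesis
      by (simp add: f8_add_self)
  qed
qed

lemma f8_power7:
  assumes "x \<noteq> (0::f8)"
  shows "x ^ 7 = 1"
proof -
  obtain u v w where x: "x = f8_of_poly [:u, v, w:]"
    by (rule f8_cases)
  have const: "f8_of_poly [:c:] = (if c = 0 then 0 else 1)" for c :: bit
    by (cases c) (simp_all add: zero_f8_def one_f8_def flip: one_pCons)
  have "\<exists>k. x = f8_gen ^ k"
    using assms unfolding x f8_eq_comb const
    by (cases u; cases v; cases w)
       (use f8_gen_powers in \<open>auto intro: exI[of _ 0] exI[of _ 1] exI[of _ 2] exI[of _ 3]
          exI[of _ 4] exI[of _ 5] exI[of _ 6]\<close>)
  then obtain k where k: "x = f8_gen ^ k"
    by blast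
  have "x ^ 7 = (f8_gen ^ 7) ^ k"
    unfolding k by (simp only: power_mult [symmetric] mult.commute)
  then show ?thesis
    by (simp add: f8_gen_powers)
qed

instantiation f8 :: field
begin

definition "inverse x = (x :: f8) ^ 6"
definition "x div y = x * inverse (y :: f8)"

instance
proof
  fix x y :: f8
  show "inverse x * x = 1" if "x \<noteq> 0"
    using f8_power7[OF that] by (simp add: inverse_f8_def flip: power_Suc2)
qed (simp_all add: divide_f8_def inverse_f8_def)

end

section \<open>The example\<close>

text \<open>Entrywise squaring is an automorphism of \<open>M\<^sub>2(\<F>\<^sub>8)\<close> and \<open>X \<mapsto> M X - \<sigma>(X) M\<close> is a
  \<open>\<sigma>\<close>-derivation (lemmas \<open>frob_sigma_iso\<close> and \<open>inner_delta_derivation\<close>).\<close>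

definition M2_F8 :: "f8 mat ring" where
  "M2_F8 = ring_mat TYPE(f8) 2 ()"

definition frob_sigma :: "f8 mat \<Rightarrow> f8 mat" where
  "frob_sigma = map_mat (\<lambda>y. y ^ 2)"

definition delta_M :: "f8 mat" where
  "delta_M = mat_of_rows_list 2 [[0, 0], [0, f8_gen]]"

definition inner_delta :: "f8 mat \<Rightarrow> f8 mat" where
  "inner_delta X = delta_M * X - frob_sigma X * delta_M"

definition ore_M2_F8 :: "(nat \<Rightarrow> f8 mat) ring" where
  "ore_M2_F8 = ore_extension M2_F8 frob_sigma inner_delta"

text \<open>The subring \<open>\<F>\<^sub>2 1\<close> of \<open>M\<^sub>2(\<F>\<^sub>8)\<close> is \<open>{0, 1}\<close>.\<close>

definition poly_F2 :: "(nat \<Rightarrow> f8 mat) set" where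
  "poly_F2 = polys_with_coeffs_in {\<zero>\<^bsub>M2_F8\<^esub>, \<one>\<^bsub>M2_F8\<^esub>} M2_F8"

lemma f8_square_add: "(x + y) ^ 2 = x ^ 2 + (y :: f8) ^ 2"
proof -
  have "(x + y) ^ 2 = x ^ 2 + y ^ 2 + (x * y + x * y)"
    by (simp add: power2_eq_square algebra_simps)
  then show ?thesis
    by (simp only: f8_add_self add_0_right)
qed

lemma f8_power8: "(x :: f8) ^ 8 = x"
  using f8_power7[of x] by (cases "x = 0") (simp_all add: numeral_eq_Suc)

lemma sum_upto_2: "sum f {0..<2::nat} = f 0 + (f 1 :: 'a :: comm_monoid_add)"
  by (simp add: numeral_2_eq_2)

lemma frob_sigma_mult:
  assumes "X \<in> carrier_mat 2 2" "Y \<in> carrier_mat 2 2"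
  shows "frob_sigma (X * Y) = frob_sigma X * frob_sigma Y"
  using assms
  by (intro eq_matI)
     (auto simp: frob_sigma_def scalar_prod_def sum_upto_2 f8_square_add power_mult_distrib)

lemma frob_sigma_add:
  assumes "X \<in> carrier_mat 2 2" "Y \<in> carrier_mat 2 2"
  shows "frob_sigma (X + Y) = frob_sigma X + frob_sigma Y"
  using assms by (intro eq_matI) (auto simp: frob_sigma_def f8_square_add)

lemma frob_sigma_iso: "frob_sigma \<in> ring_iso M2_F8 M2_F8"
proof (rule ring_iso_memI)
  have s: "frob_sigma X \<in> carrier_mat 2 2" if "X \<in> carrier_mat 2 2" for X
    using that by (simp add: frob_sigma_def)
  have "frob_sigma (frob_sigma (frob_sigma X)) = X" for X
    by (intro eq_matI) (simp_all add: frob_sigma_def f8_power8 flip: power_mult)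
  then show "bij_betw frob_sigma (carrier M2_F8) (carrier M2_F8)"
    by (intro bij_betwI[where g = "\<lambda>X. frob_sigma (frob_sigma X)"])
       (auto simp: M2_F8_def ring_mat_simps s)
next
  fix X Y
  assume "X \<in> carrier M2_F8" "Y \<in> carrier M2_F8"
  then have X: "X \<in> carrier_mat 2 2" and Y: "Y \<in> carrier_mat 2 2"
    by (simp_all add: M2_F8_def ring_mat_simps)
  show "frob_sigma X \<in> carrier M2_F8"
    using X by (simp add: M2_F8_def ring_mat_simps frob_sigma_def)
  show "frob_sigma (X \<otimes>\<^bsub>M2_F8\<^esub> Y) = frob_sigma X \<otimes>\<^bsub>M2_F8\<^esub> frob_sigma Y"
    using X Y by (simp add: M2_F8_def ring_mat_simps frob_sigma_mult)
  show "frob_sigma (X \<oplus>\<^bsub>M2_F8\<^esub> Y) = frob_sigma X \<oplus>\<^bsub>M2_F8\<^esub> frob_sigma Y"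
    using frob_sigma_add[OF X Y] by (simp add: M2_F8_def ring_mat_simps)
next
  have "frob_sigma (1\<^sub>m 2) = 1\<^sub>m 2"
    by (intro eq_matI) (simp_all add: frob_sigma_def)
  then show "frob_sigma \<one>\<^bsub>M2_F8\<^esub> = \<one>\<^bsub>M2_F8\<^esub>"
    by (simp add: M2_F8_def ring_mat_simps)
qed

lemma inner_delta_derivation:
  assumes X: "X \<in> carrier_mat 2 2" and Y: "Y \<in> carrier_mat 2 2"
  shows "inner_delta (X * Y) = frob_sigma X * inner_delta Y + inner_delta X * Y"
    and "inner_delta (X + Y) = inner_delta X + inner_delta Y"
proof -
  have M: "delta_M \<in> carrier_mat 2 2"
    by (rule carrier_matI) (simp_all add: delta_M_def mat_of_rows_list_def)
  have s: "frob_sigma Z \<in> carrier_mat 2 2" if "Z \<in> carrier_mat 2 2" for Z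
    using that by (simp add: frob_sigma_def)
  note carriers = X Y M s[OF X] s[OF Y]
  note c = mult_carrier_mat[of _ 2 2 _ 2]
  have telescope: "(P - Q) + (R - P) = R - Q"
    if "P \<in> carrier_mat 2 2" "Q \<in> carrier_mat 2 2" "R \<in> carrier_mat 2 2" for P Q R :: "f8 mat"
    using that by (intro eq_matI) auto
  have interchange: "(P + Q) - (R + S) = (P - R) + (Q - S)"
    if "P \<in> carrier_mat 2 2" "Q \<in> carrier_mat 2 2" "R \<in> carrier_mat 2 2" "S \<in> carrier_mat 2 2"
    for P Q R S :: "f8 mat"
    using that by (intro eq_matI) auto
  have "frob_sigma X * inner_delta Y =
      frob_sigma X * (delta_M * Y) - frob_sigma X * (frob_sigma Y * delta_M)"
    unfolding inner_delta_def
    by (intro mult_minus_distrib_mat[of _ 2 2 _ 2] c carriers)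
  moreover have "inner_delta X * Y = delta_M * X * Y - frob_sigma X * delta_M * Y"
    unfolding inner_delta_def
    by (intro minus_mult_distrib_mat[of _ 2 2 _ _ 2] c carriers)
  moreover have "frob_sigma X * (delta_M * Y) = frob_sigma X * delta_M * Y"
    and "frob_sigma X * (frob_sigma Y * delta_M) = frob_sigma X * frob_sigma Y * delta_M"
    and "delta_M * X * Y = delta_M * (X * Y)"
    by (intro assoc_mult_mat[of _ 2 2 _ 2 _ 2, symmetric] assoc_mult_mat[of _ 2 2 _ 2 _ 2] carriers)+
  ultimately have "frob_sigma X * inner_delta Y + inner_delta X * Y =
      delta_M * (X * Y) - frob_sigma X * frob_sigma Y * delta_M"
    using telescope[of "frob_sigma X * delta_M * Y" "frob_sigma X * frob_sigma Y * delta_M"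
        "delta_M * (X * Y)"] c carriers
    by metis
  then show "inner_delta (X * Y) = frob_sigma X * inner_delta Y + inner_delta X * Y"
    by (simp only: inner_delta_def frob_sigma_mult[OF X Y])
  have "delta_M * (X + Y) = delta_M * X + delta_M * Y"
    by (intro mult_add_distrib_mat[of _ 2 2 _ 2] carriers)
  moreover have "(frob_sigma X + frob_sigma Y) * delta_M =
      frob_sigma X * delta_M + frob_sigma Y * delta_M"
    by (intro add_mult_distrib_mat[of _ 2 2 _ _ 2] carriers)
  ultimately show "inner_delta (X + Y) = inner_delta X + inner_delta Y"
    unfolding inner_delta_def frob_sigma_add[OF X Y]
    by (simp only:) (intro interchange c carriers)
qed

end

theory Submission
  imports Defs
begin

text \<open>
  Every element of \<open>B = A[x;\<sigma>,\<delta>]\<close> has unique expansions \<open>\<Sum>a\<^sub>n x\<^sup>n\<close> and \<open>\<Sum>x\<^sup>n b\<^sub>n\<close>, so \<open>B\<close> is free over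
  \<open>C = \<F>\<^sub>2[x]\<close> on both sides. The elements \<open>a, a\<^sup>2, a\<^sup>4\<close> form a self-dual normal basis of \<open>\<F>\<^sub>8\<close> over
  \<open>\<F>\<^sub>2\<close>; writing them as \<open>\<beta>\<^sub>k\<close>, the separability element is \<open>\<Sum> \<beta>\<^sub>k E\<^sub>i\<^sub>1 \<otimes> \<beta>\<^sub>k E\<^sub>1\<^sub>i\<close>, which is invariant under
  \<open>\<sigma> \<otimes> \<sigma>\<close>, and the splitting takes the trace of the \<open>(1, 1)\<close> entry of each coefficient: the first row and
  column of \<open>M\<close> vanish, so \<open>\<delta>\<close> does not interfere.

  A Frobenius isomorphism would give a bimodule morphism \<open>\<chi> : B \<rightarrow> C\<close> such that every right linear map
  \<open>B \<rightarrow> C\<close> is \<open>u \<mapsto> \<chi> (b u)\<close> for some \<open>b\<close>. Evaluating \<open>\<chi> (x u) = x \<chi> u\<close> at \<open>x = a\<^sup>2\<close> for \<open>u = z E\<^sub>2\<^sub>2\<close> and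
  \<open>u = z E\<^sub>1\<^sub>2\<close> forces \<open>\<chi> (b z E\<^sub>2\<^sub>2)\<close> to take the value \<open>\<kappa> z\<^sup>2\<close> there, with \<open>\<kappa>\<close> depending on \<open>b\<close> only. But the
  trace of the \<open>(2, 2)\<close> entry defines a right linear map whose value is \<open>z + z\<^sup>2 + z\<^sup>4\<close>.
\<close>

section \<open>Ore extensions\<close>

text \<open>Origin of the evaluation point: an additive map on F_8 has the form f(z) = c0 z + c1 z^2
  + c2 z^4. If f(z) is the value at x = t of a bimodule morphism on z E22, then x z E22 = z^2 E22 x
  + a (z + z^2) E22 gives, coefficient by coefficient, (t + a) c0 = (t + a^2) c1 = (t + a^4) c2. At
  t = a^2 all three products vanish and only c1 z^2 survives; the conjugate roots a and a^4 would
  leave c0 z and c2 z^4. In the corner E11 there is no \<delta>-term, and the same comparison gives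
  c0 = c1 = c2 for nonzero t: a multiple of the trace, which is a nondegenerate form. This is the
  point of M = diag(0, a): splitting and separability need a single good corner, while a Frobenius
  form has to be nondegenerate on both.\<close>

context ring
begin

lemma up_carrier: "q \<in> up R \<Longrightarrow> q k \<in> carrier R"
  by auto

text \<open>The product of \<open>ore_extension\<close> sums over the exact support of the left
  factor, which changes with that factor. Sums up to a common bound can be compared; the extra terms
  vanish because each \<open>F n\<close> kills zero.\<close>

lemma finsum_support:
  assumes p: "p \<in> up R" "bound \<zero> N p"
    and F: "\<And>n a. a \<in> carrier R \<Longrightarrow> F n a \<in> carrier R" "\<And>n. F n \<zero> = \<zero>"
  shows "(\<Oplus>n\<in>{n. p n \<noteq> \<zero>}. F n (p n)) = (\<Oplus>n\<in>{..N}. F n (p n))"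
proof (rule add.finprod_mono_neutral_cong_left)
  show "{n. p n \<noteq> \<zero>} \<subseteq> {..N}"
    using p(2) by (auto dest: bound_below)
qed (use p F in auto)

text \<open>Cancellation may shrink the support of a sum, hence the detour over a common bound.
  Additivity of the product in its left factor and additivity of \<open>right_coeffs\<close> are
  instances.\<close>

lemma finsum_support_add:
  assumes p: "p \<in> up R" and q: "q \<in> up R"
    and F: "\<And>n a. a \<in> carrier R \<Longrightarrow> F n a \<in> carrier R"
      "\<And>n a b. a \<in> carrier R \<Longrightarrow> b \<in> carrier R \<Longrightarrow> F n (a \<oplus> b) = F n a \<oplus> F n b"
  shows "(\<Oplus>n\<in>{n. p n \<oplus> q n \<noteq> \<zero>}. F n (p n \<oplus> q n)) =
    (\<Oplus>n\<in>{n. p n \<noteq> \<zero>}. F n (p n)) \<oplus> (\<Oplus>n\<in>{n. q n \<noteq> \<zero>}. F n (q n))"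
proof -
  have F0: "F n \<zero> = \<zero>" for n
    using F(2)[of \<zero> \<zero> n] F(1)[of \<zero> n] by (simp add: add.l_cancel_one)
  obtain N M where "bound \<zero> N p" "bound \<zero> M q"
    using p q by (auto simp: up_def)
  then have b: "bound \<zero> (max N M) p" "bound \<zero> (max N M) q"
    by (auto simp: bound_def)
  have pq: "(\<lambda>n. p n \<oplus> q n) \<in> up R" "bound \<zero> (max N M) (\<lambda>n. p n \<oplus> q n)"
    using p q b by (auto intro: up_add_closed simp: bound_def)
  show ?thesis
    using p q finsum_support[where F = F, OF p b(1) F(1) F0] finsum_support[where F = F, OF q b(2) F(1) F0]
      finsum_support[where F = F, OF pq F(1) F0]
    by (simp add: F up_carrier Pi_def finsum_addf)
qed

end

section \<open>Coefficient arithmetic and the rules for x\<close>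

definition ore_const :: "('a, 'm) ring_scheme \<Rightarrow> 'a \<Rightarrow> nat \<Rightarrow> 'a" where
  "ore_const R a = (\<lambda>k. if k = 0 then a else \<zero>\<^bsub>R\<^esub>)"

text \<open>This is right multiplication by the variable (\<open>mult_var\<close>): coefficients
  stand on the left, so no commutation is involved.\<close>

definition ore_shift :: "('a, 'm) ring_scheme \<Rightarrow> (nat \<Rightarrow> 'a) \<Rightarrow> nat \<Rightarrow> 'a" where
  "ore_shift R q = (\<lambda>k. case k of 0 \<Rightarrow> \<zero>\<^bsub>R\<^esub> | Suc j \<Rightarrow> q j)"

definition ore_var :: "('a, 'm) ring_scheme \<Rightarrow> nat \<Rightarrow> 'a" where
  "ore_var R = ore_shift R (ore_const R \<one>\<^bsub>R\<^esub>)"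

locale ore_setting = ring R for R (structure) +
  fixes \<sigma> \<delta> :: "'a \<Rightarrow> 'a"
  assumes \<sigma>_hom: "\<sigma> \<in> ring_hom R R"
    and \<delta>_closed [simp, intro]: "a \<in> carrier R \<Longrightarrow> \<delta> a \<in> carrier R"
    and \<delta>_add: "a \<in> carrier R \<Longrightarrow> b \<in> carrier R \<Longrightarrow> \<delta> (a \<oplus> b) = \<delta> a \<oplus> \<delta> b"
    and \<delta>_mult: "a \<in> carrier R \<Longrightarrow> b \<in> carrier R \<Longrightarrow> \<delta> (a \<otimes> b) = \<sigma> a \<otimes> \<delta> b \<oplus> \<delta> a \<otimes> b"
begin

abbreviation X where "X \<equiv> ore_x_mult R \<sigma> \<delta>"
abbreviation B where "B \<equiv> ore_extension R \<sigma> \<delta>"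
abbreviation cst where "cst \<equiv> ore_const R"
abbreviation shift where "shift \<equiv> ore_shift R"
abbreviation x where "x \<equiv> ore_var R"

lemma \<sigma>_closed [simp, intro]: "a \<in> carrier R \<Longrightarrow> \<sigma> a \<in> carrier R"
  using \<sigma>_hom by (rule ring_hom_closed)

lemma \<sigma>_one [simp]: "\<sigma> \<one> = \<one>"
  using \<sigma>_hom by (rule ring_hom_one)

lemma \<sigma>_add: "a \<in> carrier R \<Longrightarrow> b \<in> carrier R \<Longrightarrow> \<sigma> (a \<oplus> b) = \<sigma> a \<oplus> \<sigma> b"
  using \<sigma>_hom by (rule ring_hom_add)

lemma \<sigma>_mult: "a \<in> carrier R \<Longrightarrow> b \<in> carrier R \<Longrightarrow> \<sigma> (a \<otimes> b) = \<sigma> a \<otimes> \<sigma> b"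
  using \<sigma>_hom by (rule ring_hom_mult)

lemma \<sigma>_zero [simp]: "\<sigma> \<zero> = \<zero>"
  using \<sigma>_add[of \<zero> \<zero>] by (simp add: add.l_cancel_one)

lemma \<delta>_zero [simp]: "\<delta> \<zero> = \<zero>"
  using \<delta>_add[of \<zero> \<zero>] by (simp add: add.l_cancel_one)

lemma \<delta>_one [simp]: "\<delta> \<one> = \<zero>"
  using \<delta>_mult[of \<one> \<one>] by (simp add: add.l_cancel_one)

lemma ore_simps:
  "carrier B = up R"
  "\<zero>\<^bsub>B\<^esub> = (\<lambda>k. \<zero>)"
  "\<one>\<^bsub>B\<^esub> = cst \<one>"
  "p \<oplus>\<^bsub>B\<^esub> q = (\<lambda>k. p k \<oplus> q k)"
  by (simp_all add: ore_extension_def ore_const_def)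

lemma zero_up [simp]: "(\<lambda>k. \<zero>) \<in> up R"
  by auto

lemma const_up [simp, intro]: "a \<in> carrier R \<Longrightarrow> cst a \<in> up R"
  by (auto simp: ore_const_def bound_def intro!: mem_upI exI[of _ 0])

lemma shift_up [simp, intro]: "q \<in> up R \<Longrightarrow> shift q \<in> up R"
proof
  assume q: "q \<in> up R"
  then show "shift q n \<in> carrier R" for n
    by (auto simp: ore_shift_def split: nat.splits)
  obtain n where "bound \<zero> n q"
    using q by blast
  then have "bound \<zero> (Suc n) (shift q)"
    by (auto simp: bound_def ore_shift_def split: nat.splits)
  then show "\<exists>n. bound \<zero> n (shift q)" ..
qed

lemma map_up:
  assumes "q \<in> up R" "\<And>a. a \<in> carrier R \<Longrightarrow> h a \<in> carrier R" "h \<zero> = \<zero>"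
  shows "(\<lambda>k. h (q k)) \<in> up R"
proof
  show "h (q n) \<in> carrier R" for n
    using assms by auto
  obtain n where "bound \<zero> n q"
    using assms by blast
  then have "bound \<zero> n (\<lambda>k. h (q k))"
    using assms by (auto simp: bound_def)
  then show "\<exists>n. bound \<zero> n (\<lambda>k. h (q k))" ..
qed

lemma x_mult_eq: "X q = (\<lambda>k. shift (\<lambda>k. \<sigma> (q k)) k \<oplus> \<delta> (q k))"
  by (auto simp: ore_x_mult_def ore_shift_def split: nat.splits)

lemma x_mult_up [simp, intro]: "q \<in> up R \<Longrightarrow> X q \<in> up R"
  unfolding x_mult_eq
  using up_add_closed[OF shift_up[OF map_up[of q \<sigma>]] map_up[of q \<delta>]] by simp

lemma var_up [simp, intro]: "x \<in> up R"
  by (simp add: ore_var_def)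

lemma x_mult_add:
  assumes "p \<in> up R" "q \<in> up R"
  shows "X (\<lambda>k. p k \<oplus> q k) = (\<lambda>k. X p k \<oplus> X q k)"
proof
  fix k
  show "X (\<lambda>k. p k \<oplus> q k) k = X p k \<oplus> X q k"
    using assms by (cases k) (simp_all add: ore_x_mult_def \<sigma>_add \<delta>_add up_carrier a_ac)
qed

lemma x_mult_const: "a \<in> carrier R \<Longrightarrow> X (cst a) = (\<lambda>k. shift (cst (\<sigma> a)) k \<oplus> cst (\<delta> a) k)"
  by (auto simp: ore_x_mult_def ore_const_def ore_shift_def split: nat.splits)

text \<open>The twisted Leibniz rule of \<delta> enters associativity through this identity, x (a q)
  = \<sigma>(a) (x q) + \<delta>(a) q.\<close>

lemma x_mult_smult:
  assumes "a \<in> carrier R" "q \<in> up R"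
  shows "X (\<lambda>k. a \<otimes> q k) = (\<lambda>k. \<sigma> a \<otimes> X q k \<oplus> \<delta> a \<otimes> q k)"
proof
  fix k
  show "X (\<lambda>k. a \<otimes> q k) k = \<sigma> a \<otimes> X q k \<oplus> \<delta> a \<otimes> q k"
    using assms
    by (cases k) (simp_all add: ore_x_mult_def \<sigma>_mult \<delta>_mult up_carrier r_distr a_ac)
qed

lemma x_mult_zero [simp]: "X (\<lambda>k. \<zero>) = (\<lambda>k. \<zero>)"
  by (auto simp: ore_x_mult_def split: nat.splits)

lemma x_mult_pow_up [simp, intro]: "q \<in> up R \<Longrightarrow> (X ^^ n) q \<in> up R"
  by (induction n) auto

lemma x_mult_pow_zero [simp]: "(X ^^ n) (\<lambda>k. \<zero>) = (\<lambda>k. \<zero>)"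
  by (induction n) auto

lemma x_mult_pow_add:
  "p \<in> up R \<Longrightarrow> q \<in> up R \<Longrightarrow> (X ^^ n) (\<lambda>k. p k \<oplus> q k) = (\<lambda>k. (X ^^ n) p k \<oplus> (X ^^ n) q k)"
  by (induction n) (simp_all add: x_mult_add)

lemma x_mult_pow_carrier [simp]: "q \<in> up R \<Longrightarrow> (X ^^ n) q k \<in> carrier R"
  by (rule up_carrier) auto

lemma mult_eq:
  "p \<otimes>\<^bsub>B\<^esub> q = (\<lambda>k. \<Oplus>n\<in>{n. p n \<noteq> \<zero>}. p n \<otimes> (X ^^ n) q k)"
  by (simp add: ore_extension_def)

lemma mult_bound:
  assumes "p \<in> up R" "q \<in> up R" "bound \<zero> N p"
  shows "p \<otimes>\<^bsub>B\<^esub> q = (\<lambda>k. \<Oplus>n\<in>{..N}. p n \<otimes> (X ^^ n) q k)"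
  unfolding mult_eq
  using finsum_support[OF assms(1,3), of "\<lambda>n a. a \<otimes> (X ^^ n) q k" for k] assms(2)
  by auto

lemma up_finsum:
  assumes "finite I" "\<And>i. i \<in> I \<Longrightarrow> f i \<in> up R"
  shows "(\<lambda>k. \<Oplus>i\<in>I. f i k) \<in> up R"
  using assms
proof (induction I)
  case (insert i I)
  then have "(\<lambda>k. \<Oplus>i\<in>insert i I. f i k) = (\<lambda>k. f i k \<oplus> (\<Oplus>i\<in>I. f i k))"
    by (auto simp: Pi_def up_carrier)
  then show ?case
    using insert by (simp add: up_add_closed)
qed simp

lemma mult_up:
  assumes "p \<in> up R" "q \<in> up R"
  shows "p \<otimes>\<^bsub>B\<^esub> q \<in> up R"
proof -
  obtain N where "bound \<zero> N p"
    using assms by blast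
  then show ?thesis
    using assms by (simp add: mult_bound) (intro up_finsum; simp add: up_smult_closed up_carrier)
qed

lemma mult_add_left:
  assumes "p \<in> up R" "p' \<in> up R" "q \<in> up R"
  shows "(\<lambda>k. p k \<oplus> p' k) \<otimes>\<^bsub>B\<^esub> q = (\<lambda>k. (p \<otimes>\<^bsub>B\<^esub> q) k \<oplus> (p' \<otimes>\<^bsub>B\<^esub> q) k)"
  unfolding mult_eq
  using finsum_support_add[OF assms(1,2), of "\<lambda>n a. a \<otimes> (X ^^ n) q k" for k] assms(3)
  by (auto simp: l_distr)

lemma mult_add_right:
  assumes "p \<in> up R" "q \<in> up R" "q' \<in> up R"
  shows "p \<otimes>\<^bsub>B\<^esub> (\<lambda>k. q k \<oplus> q' k) = (\<lambda>k. (p \<otimes>\<^bsub>B\<^esub> q) k \<oplus> (p \<otimes>\<^bsub>B\<^esub> q') k)"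
proof -
  obtain N where "bound \<zero> N p"
    using assms by blast
  then show ?thesis
    using assms by (simp add: mult_bound up_add_closed x_mult_pow_add r_distr up_carrier finsum_addf Pi_def)
qed

lemma mult_smult_left:
  assumes "a \<in> carrier R" "p \<in> up R" "q \<in> up R"
  shows "(\<lambda>k. a \<otimes> p k) \<otimes>\<^bsub>B\<^esub> q = (\<lambda>k. a \<otimes> (p \<otimes>\<^bsub>B\<^esub> q) k)"
proof -
  obtain N where N: "bound \<zero> N p"
    using assms by blast
  then have "bound \<zero> N (\<lambda>k. a \<otimes> p k)"
    using assms by (auto simp: bound_def)
  then show ?thesis
    using assms N by (simp add: mult_bound up_smult_closed up_carrier m_assoc finsum_rdistr Pi_def)
qed

lemma const_mult:
  assumes "a \<in> carrier R" "q \<in> up R"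
  shows "cst a \<otimes>\<^bsub>B\<^esub> q = (\<lambda>k. a \<otimes> q k)"
proof -
  have "bound \<zero> 0 (cst a)"
    by (simp add: bound_def ore_const_def)
  then have "cst a \<otimes>\<^bsub>B\<^esub> q = (\<lambda>k. \<Oplus>n\<in>{..0}. cst a n \<otimes> (X ^^ n) q k)"
    using assms by (intro mult_bound) auto
  then show ?thesis
    using assms by (simp add: up_carrier) (simp add: ore_const_def)
qed

lemma one_mult: "q \<in> up R \<Longrightarrow> cst \<one> \<otimes>\<^bsub>B\<^esub> q = q"
  by (simp add: const_mult up_carrier)

lemma x_mult_finsum:
  assumes "finite I" "\<And>i. i \<in> I \<Longrightarrow> f i \<in> up R"
  shows "X (\<lambda>k. \<Oplus>i\<in>I. f i k) = (\<lambda>k. \<Oplus>i\<in>I. X (f i) k)"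
  using assms
proof (induction I)
  case (insert i I)
  then have "(\<lambda>k. \<Oplus>i\<in>insert i I. f i k) = (\<lambda>k. f i k \<oplus> (\<Oplus>i\<in>I. f i k))"
    by (auto simp: Pi_def up_carrier)
  then have "X (\<lambda>k. \<Oplus>i\<in>insert i I. f i k) = (\<lambda>k. X (f i) k \<oplus> X (\<lambda>k. \<Oplus>i\<in>I. f i k) k)"
    using insert by (simp add: x_mult_add up_finsum)
  also have "\<dots> = (\<lambda>k. \<Oplus>i\<in>insert i I. X (f i) k)"
    using insert by (auto simp: Pi_def up_carrier)
  finally show ?case .
qed simp

text \<open>Associativity with x in the middle, (p x) q = p (x q): the factor x raises every
  exponent by one, and reindexing n to n + 1 absorbs it into q.\<close>

lemma shift_mult:
  assumes "p \<in> up R" "q \<in> up R"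
  shows "shift p \<otimes>\<^bsub>B\<^esub> q = p \<otimes>\<^bsub>B\<^esub> X q"
proof
  fix k
  obtain N where N: "bound \<zero> N p"
    using assms by blast
  then have "bound \<zero> (Suc N) (shift p)"
    by (auto simp: bound_def ore_shift_def split: nat.splits)
  then have "(shift p \<otimes>\<^bsub>B\<^esub> q) k = (\<Oplus>n\<in>{..Suc N}. shift p n \<otimes> (X ^^ n) q k)"
    using assms by (simp add: mult_bound)
  also have "\<dots> = (\<Oplus>n\<in>{..N}. p n \<otimes> (X ^^ n) (X q) k)"
    using assms
    by (subst finsum_Suc2)
      (auto simp: Pi_def up_carrier ore_shift_def funpow_swap1 finsum_closed split: nat.splits)
  finally show "(shift p \<otimes>\<^bsub>B\<^esub> q) k = (p \<otimes>\<^bsub>B\<^esub> X q) k"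
    using assms N by (simp add: mult_bound)
qed

lemma var_mult: "q \<in> up R \<Longrightarrow> x \<otimes>\<^bsub>B\<^esub> q = X q"
  by (simp add: ore_var_def shift_mult one_mult)

text \<open>Each summand x (p_n x^n q) is opened with \<open>x_mult_smult\<close>. The
  \<sigma>-parts reassemble to (\<sigma>(p) x) q by \<open>shift_mult\<close>, the \<delta>-parts to
  \<delta>(p) q.\<close>

lemma x_mult_mult:
  assumes "p \<in> up R" "q \<in> up R"
  shows "X p \<otimes>\<^bsub>B\<^esub> q = X (p \<otimes>\<^bsub>B\<^esub> q)"
proof -
  obtain N where N: "bound \<zero> N p"
    using assms by blast
  have \<sigma>p: "(\<lambda>k. \<sigma> (p k)) \<in> up R" "bound \<zero> N (\<lambda>k. \<sigma> (p k))"
    and \<delta>p: "(\<lambda>k. \<delta> (p k)) \<in> up R" "bound \<zero> N (\<lambda>k. \<delta> (p k))"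
    using assms N map_up[of p \<sigma>] map_up[of p \<delta>] by (auto simp: bound_def)
  have *: "(\<lambda>k. p n \<otimes> (X ^^ n) q k) \<in> up R" for n
    using assms by (simp add: up_smult_closed up_carrier)
  have "X (p \<otimes>\<^bsub>B\<^esub> q) = (\<lambda>k. \<Oplus>n\<in>{..N}. X (\<lambda>k. p n \<otimes> (X ^^ n) q k) k)"
    using assms N * by (simp add: mult_bound x_mult_finsum)
  also have "\<dots> = (\<lambda>k. \<Oplus>n\<in>{..N}. \<sigma> (p n) \<otimes> (X ^^ n) (X q) k \<oplus> \<delta> (p n) \<otimes> (X ^^ n) q k)"
    using assms by (simp add: x_mult_smult up_carrier funpow_swap1)
  also have "\<dots> = (\<lambda>k. ((\<lambda>k. \<sigma> (p k)) \<otimes>\<^bsub>B\<^esub> X q) k \<oplus> ((\<lambda>k. \<delta> (p k)) \<otimes>\<^bsub>B\<^esub> q) k)"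
    using assms \<sigma>p \<delta>p by (simp add: mult_bound up_carrier finsum_addf Pi_def)
  also have "\<dots> = X p \<otimes>\<^bsub>B\<^esub> q"
    unfolding x_mult_eq[of p] using assms \<sigma>p \<delta>p by (simp add: mult_add_left shift_mult)
  finally show ?thesis ..
qed

lemma x_mult_pow_one: "(X ^^ n) (cst \<one>) = (\<lambda>k. if k = n then \<one> else \<zero>)"
proof (induction n)
  case (Suc n)
  have "X (\<lambda>k. if k = n then \<one> else \<zero>) k = (if k = Suc n then \<one> else \<zero>)" for k
    by (cases k) (simp_all add: ore_x_mult_def)
  with Suc show ?case
    by simp
qed (auto simp: ore_const_def)

section \<open>Induction principles and the ring axioms\<close>

lemma bound_induct [consumes 1, case_names zero add monom]:
  assumes "p \<in> up R" and 0: "P (\<lambda>k. \<zero>)"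
    and add: "\<And>p q. p \<in> up R \<Longrightarrow> q \<in> up R \<Longrightarrow> P p \<Longrightarrow> P q \<Longrightarrow> P (\<lambda>k. p k \<oplus> q k)"
    and monom: "\<And>a n. a \<in> carrier R \<Longrightarrow> P (\<lambda>k. if k = n then a else \<zero>)"
  shows "P p"
proof -
  have "P p" if "p \<in> up R" "\<forall>n\<ge>N. p n = \<zero>" for N
    using that
  proof (induction N arbitrary: p)
    case 0
    then have "p = (\<lambda>k. \<zero>)"
      by auto
    then show ?case
      using assms(2) by simp
  next
    case (Suc N)
    let ?q = "\<lambda>k. if k = N then \<zero> else p k"
    let ?r = "\<lambda>k. if k = N then p N else \<zero>"
    have q: "?q \<in> up R" "\<forall>n\<ge>N. ?q n = \<zero>"
      using Suc.prems by (auto simp: bound_def Suc_le_eq intro!: mem_upI exI[of _ N])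
    have r: "?r \<in> up R"
      using Suc.prems by (auto simp: bound_def intro!: mem_upI exI[of _ N])
    have "p = (\<lambda>k. ?q k \<oplus> ?r k)"
      using Suc.prems by (auto simp: up_carrier)
    moreover have "P (\<lambda>k. ?q k \<oplus> ?r k)"
      by (rule add[OF q(1) r Suc.IH[OF q]]) (use Suc.prems monom in \<open>auto simp: up_carrier\<close>)
    ultimately show ?case
      by metis
  qed
  moreover obtain N where "bound \<zero> N p"
    using assms by blast
  then have "\<forall>n\<ge>Suc N. p n = \<zero>"
    by (auto simp: bound_def)
  ultimately show ?thesis
    using assms(1) by blast
qed

text \<open>Every monomial a x^n arises from 1 by n left multiplications by x and one by a. Laws
  with a variable left factor thus reduce to \<open>mult_add_left\<close>,
  \<open>x_mult_mult\<close> and \<open>mult_smult_left\<close>.\<close>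

lemma ore_induct [consumes 1, case_names one add x_mult smult]:
  assumes "p \<in> up R" and one: "P (cst \<one>)"
    and add: "\<And>p q. p \<in> up R \<Longrightarrow> q \<in> up R \<Longrightarrow> P p \<Longrightarrow> P q \<Longrightarrow> P (\<lambda>k. p k \<oplus> q k)"
    and X: "\<And>p. p \<in> up R \<Longrightarrow> P p \<Longrightarrow> P (X p)"
    and smult: "\<And>a p. a \<in> carrier R \<Longrightarrow> p \<in> up R \<Longrightarrow> P p \<Longrightarrow> P (\<lambda>k. a \<otimes> p k)"
  shows "P p"
  using assms(1)
proof (induction rule: bound_induct)
  case zero
  show ?case
    using smult[of \<zero> "cst \<one>"] one by (simp add: up_carrier)
next
  case (monom a n)
  have "P ((X ^^ n) (cst \<one>))"
    by (induction n) (auto simp: one intro: X)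
  then have "P (\<lambda>k. a \<otimes> (X ^^ n) (cst \<one>) k)"
    using monom by (intro smult) auto
  also have "(\<lambda>k. a \<otimes> (X ^^ n) (cst \<one>) k) = (\<lambda>k. if k = n then a else \<zero>)"
    using monom by (auto simp: x_mult_pow_one)
  finally show ?case .
qed (auto intro: add)

text \<open>Left multiplication by x commutes with the shift, because \<sigma> and \<delta> act on
  each coefficient separately.\<close>

lemma mult_var: "p \<in> up R \<Longrightarrow> p \<otimes>\<^bsub>B\<^esub> x = shift p"
proof (induction rule: ore_induct)
  case (add p q)
  then show ?case
    by (auto simp: mult_add_left ore_shift_def split: nat.splits)
next
  case (x_mult p)
  have "X (shift p) = shift (X p)"
    using x_mult.hyps by (auto simp: ore_shift_def ore_x_mult_def up_carrier split: nat.splits)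
  with x_mult show ?case
    by (simp add: x_mult_mult)
next
  case (smult a p)
  then show ?case
    by (auto simp: mult_smult_left ore_shift_def split: nat.splits)
qed (simp add: one_mult ore_var_def)

lemma mult_assoc:
  assumes "p \<in> up R" "q \<in> up R" "r \<in> up R"
  shows "(p \<otimes>\<^bsub>B\<^esub> q) \<otimes>\<^bsub>B\<^esub> r = p \<otimes>\<^bsub>B\<^esub> (q \<otimes>\<^bsub>B\<^esub> r)"
  using assms(1)
proof (induction rule: ore_induct)
  case one
  then show ?case
    using assms by (simp add: one_mult mult_up)
next
  case (add p q)
  then show ?case
    using assms by (simp add: mult_add_left mult_up)
next
  case (x_mult p)
  then show ?case
    using assms by (simp add: x_mult_mult mult_up)
next
  case (smult a p)
  then show ?case
    using assms by (simp add: mult_smult_left mult_up)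
qed

lemma mult_one: "p \<in> up R \<Longrightarrow> p \<otimes>\<^bsub>B\<^esub> cst \<one> = p"
proof (induction rule: ore_induct)
  case (smult a p)
  then show ?case
    by (simp add: mult_smult_left)
qed (simp_all add: one_mult mult_add_left x_mult_mult)

lemma ring_ore_extension: "ring B"
proof (rule ringI)
  show "abelian_group B"
  proof (rule abelian_groupI)
    show "\<exists>y\<in>carrier B. y \<oplus>\<^bsub>B\<^esub> p = \<zero>\<^bsub>B\<^esub>" if "p \<in> carrier B" for p
      using that up_a_inv_closed[of p]
      by (intro bexI[of _ "\<lambda>k. \<ominus> p k"]) (auto simp: ore_simps l_neg up_carrier)
  qed (auto simp: ore_simps up_carrier a_ac intro: up_add_closed)
  show "Group.monoid B"
    by (rule monoidI) (auto simp: ore_simps one_mult mult_one mult_assoc intro: mult_up)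
qed (auto simp: ore_simps mult_add_left mult_add_right)

lemma var_const:
  assumes "a \<in> carrier R"
  shows "x \<otimes>\<^bsub>B\<^esub> cst a = (cst (\<sigma> a) \<otimes>\<^bsub>B\<^esub> x) \<oplus>\<^bsub>B\<^esub> cst (\<delta> a)"
  using assms by (simp add: var_mult mult_var x_mult_const ore_simps)

text \<open>When \<open>\<sigma>\<close> is onto, coefficients can be moved to the right of \<open>x\<close>.\<close>

lemma ore_induct_left [consumes 2, case_names const add var]:
  assumes p: "p \<in> up R" and surj: "\<sigma> ` carrier R = carrier R"
    and const: "\<And>a. a \<in> carrier R \<Longrightarrow> P (cst a)"
    and add: "\<And>p q. p \<in> up R \<Longrightarrow> q \<in> up R \<Longrightarrow> P p \<Longrightarrow> P q \<Longrightarrow> P (p \<oplus>\<^bsub>B\<^esub> q)"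
    and var: "\<And>p. p \<in> up R \<Longrightarrow> P p \<Longrightarrow> P (x \<otimes>\<^bsub>B\<^esub> p)"
  shows "P p"
  using p
proof (induction rule: bound_induct)
  case zero
  then show ?case
    using const[of \<zero>] by (simp add: ore_const_def)
next
  case (add p q)
  then show ?case
    using assms(4) by (simp add: ore_simps)
next
  case (monom a n)
  then show ?case
  proof (induction n arbitrary: a)
    case 0
    then show ?case
      using const[of a] by (simp add: ore_const_def)
  next
    case (Suc n)
    \<comment> \<open>With a = \<sigma>(b) one has a x^(n+1) = x (b x^n) - \<delta>(b) x^n, where
      only n-th powers remain. The induction leaves \<open>a\<close> arbitrary because b and
      \<delta>(b) take its place.\<close>
    then obtain b where b: "b \<in> carrier R" "a = \<sigma> b"
      using surj by blast
    let ?m = "\<lambda>n a k. if k = n then a else \<zero>"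
    have up: "?m n c \<in> up R" if "c \<in> carrier R" for n c
      using that by (auto simp: bound_def intro!: mem_upI exI[of _ n])
    have X: "X (?m n b) = (\<lambda>k. ?m (Suc n) a k \<oplus> ?m n (\<delta> b) k)"
      using b by (auto simp: ore_x_mult_def split: nat.splits)
    have "P (x \<otimes>\<^bsub>B\<^esub> ?m n b)" "P (?m n (\<ominus> \<delta> b))"
      using Suc b up by (auto intro: var)
    then have "P ((x \<otimes>\<^bsub>B\<^esub> ?m n b) \<oplus>\<^bsub>B\<^esub> ?m n (\<ominus> \<delta> b))"
      using b up by (auto intro: add simp: var_mult)
    also have "(x \<otimes>\<^bsub>B\<^esub> ?m n b) \<oplus>\<^bsub>B\<^esub> ?m n (\<ominus> \<delta> b) = ?m (Suc n) a"
      using b up Suc.prems by (auto simp: var_mult X ore_simps r_neg)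
    finally show ?case .
  qed
qed

text \<open>Splitting off the constant term, p = p_0 + q x, lowers the degree bound and keeps all
  coefficients in \<open>K\<close>. With \<open>K\<close> = {0, 1} this becomes induction on F_2[x];
  with \<open>K\<close> = \<open>UNIV\<close> it serves \<open>right_expansion\<close>.\<close>

lemma horner_induct [consumes 2, case_names zero step]:
  assumes p: "p \<in> up R" "range p \<subseteq> K" and zero: "P \<zero>\<^bsub>B\<^esub>"
    and step: "\<And>a q. \<lbrakk>a \<in> K; a \<in> carrier R; q \<in> up R; range q \<subseteq> K; P q\<rbrakk> \<Longrightarrow> P (cst a \<oplus>\<^bsub>B\<^esub> shift q)"
  shows "P p"
proof -
  have "P p" if "p \<in> up R" "range p \<subseteq> K" "\<forall>n\<ge>N. p n = \<zero>" for N
    using that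
  proof (induction N arbitrary: p)
    case 0
    then have "p = \<zero>\<^bsub>B\<^esub>"
      by (auto simp: ore_simps)
    then show ?case
      using zero by simp
  next
    case (Suc N)
    let ?q = "\<lambda>k. p (Suc k)"
    have q: "?q \<in> up R" "range ?q \<subseteq> K" "\<forall>n\<ge>N. ?q n = \<zero>"
      using Suc.prems by (auto simp: bound_def up_carrier intro!: mem_upI exI[of _ N])
    have "p = cst (p 0) \<oplus>\<^bsub>B\<^esub> shift ?q"
      using Suc.prems
      by (auto simp: ore_simps ore_const_def ore_shift_def up_carrier split: nat.splits)
    then show ?case
      using step[OF _ _ q(1,2) Suc.IH[OF q], of "p 0"] Suc.prems by (auto simp: up_carrier)
  qed
  moreover obtain N where "bound \<zero> N p"
    using p by blast
  then have "\<forall>n\<ge>Suc N. p n = \<zero>"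
    by (auto simp: bound_def)
  ultimately show ?thesis
    using p by blast
qed

lemma const_add: "cst a \<oplus>\<^bsub>B\<^esub> cst b = cst (a \<oplus> b)" if "a \<in> carrier R" "b \<in> carrier R"
  using that by (auto simp: ore_simps ore_const_def)

lemma const_mult_const: "cst a \<otimes>\<^bsub>B\<^esub> cst b = cst (a \<otimes> b)" if "a \<in> carrier R" "b \<in> carrier R"
  using that by (simp add: const_mult) (auto simp: ore_const_def)

lemma const_zero: "cst \<zero> = \<zero>\<^bsub>B\<^esub>"
  by (simp add: ore_const_def ore_simps)

lemma const_finsum:
  assumes "finite I" "f \<in> I \<rightarrow> carrier R"
  shows "(\<Oplus>\<^bsub>B\<^esub>i\<in>I. cst (f i)) = cst (\<Oplus>i\<in>I. f i)"
proof -
  interpret B: ring B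
    by (rule ring_ore_extension)
  show ?thesis
    using assms
    by (induction I) (simp_all add: const_zero const_add ore_simps(1) Pi_def)
qed

lemma shift_add: "p \<in> up R \<Longrightarrow> q \<in> up R \<Longrightarrow> shift (p \<oplus>\<^bsub>B\<^esub> q) = shift p \<oplus>\<^bsub>B\<^esub> shift q"
  by (auto simp: ore_simps ore_shift_def split: nat.splits)

end

text \<open>Rewriting a left polynomial \<open>\<Sum>a\<^sub>n x\<^sup>n\<close> as \<open>\<Sum>x\<^sup>n b\<^sub>n\<close>, using
  \<open>a x = x \<tau>(a) - \<delta>(\<tau>(a))\<close> for the inverse \<open>\<tau>\<close> of \<open>\<sigma>\<close>.\<close>

locale ore_setting_inverse = ore_setting +
  fixes \<tau> :: "'a \<Rightarrow> 'a"
  assumes \<tau>_closed [simp, intro]: "a \<in> carrier R \<Longrightarrow> \<tau> a \<in> carrier R"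
    and \<tau>_add: "a \<in> carrier R \<Longrightarrow> b \<in> carrier R \<Longrightarrow> \<tau> (a \<oplus> b) = \<tau> a \<oplus> \<tau> b"
    and \<tau>_\<sigma>: "a \<in> carrier R \<Longrightarrow> \<tau> (\<sigma> a) = a"
begin

text \<open>The intended meaning is a x^n = sum of x^k b_k, where b_k is the entry at k. In this
  right-hand notation \<open>shift\<close> stands for left multiplication by x, so for \<tau>
  inverse to \<sigma> the recursion reads a x^(n+1) = x (\<tau>(a) x^n) - \<delta>(\<tau>(a))
  x^n.\<close>

fun right_monom :: "nat \<Rightarrow> 'a \<Rightarrow> nat \<Rightarrow> 'a" where
  "right_monom 0 a = cst a"
| "right_monom (Suc n) a = shift (right_monom n (\<tau> a)) \<ominus>\<^bsub>B\<^esub> right_monom n (\<delta> (\<tau> a))"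

definition right_coeffs :: "(nat \<Rightarrow> 'a) \<Rightarrow> nat \<Rightarrow> 'a" where
  "right_coeffs p = (\<lambda>k. \<Oplus>n\<in>{n. p n \<noteq> \<zero>}. right_monom n (p n) k)"

interpretation B: ring B
  by (rule ring_ore_extension)

lemma right_monom_up: "a \<in> carrier R \<Longrightarrow> right_monom n a \<in> up R"
proof (induction n arbitrary: a)
  case (Suc n)
  then have "right_monom n (\<tau> a) \<in> up R" "right_monom n (\<delta> (\<tau> a)) \<in> carrier B"
    by (auto simp: ore_simps)
  then show ?case
    using B.minus_closed[of "shift (right_monom n (\<tau> a))" "right_monom n (\<delta> (\<tau> a))"]
    by (simp add: ore_simps shift_up)
qed auto

lemma right_monom_add:
  "\<lbrakk>a \<in> carrier R; b \<in> carrier R\<rbrakk> \<Longrightarrow>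
    right_monom n (a \<oplus> b) = right_monom n a \<oplus>\<^bsub>B\<^esub> right_monom n b"
proof (induction n arbitrary: a b)
  case (Suc n)
  have "right_monom n c \<in> carrier B" "shift (right_monom n c) \<in> carrier B" if "c \<in> carrier R" for c
    using that by (auto simp: ore_simps(1) right_monom_up)
  then show ?case
    using Suc
    by (simp add: \<tau>_add \<delta>_add shift_add right_monom_up a_minus_def B.minus_add B.a_ac)
qed (simp add: const_add)

lemma right_coeffs_up:
  assumes "p \<in> up R"
  shows "right_coeffs p \<in> up R"
proof -
  have "{n. p n \<noteq> \<zero>} \<subseteq> {..N}" if "bound \<zero> N p" for N
    using that by (auto dest: bound_below)
  then have "finite {n. p n \<noteq> \<zero>}"
    using assms finite_subset by blast
  then show ?thesis
    unfolding right_coeffs_def using assms by (intro up_finsum) (simp_all add: right_monom_up up_carrier)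
qed

lemma right_coeffs_add:
  assumes "p \<in> up R" "q \<in> up R"
  shows "right_coeffs (p \<oplus>\<^bsub>B\<^esub> q) = right_coeffs p \<oplus>\<^bsub>B\<^esub> right_coeffs q"
  unfolding right_coeffs_def
  using finsum_support_add[OF assms, of "\<lambda>n a. right_monom n a k" for k]
  by (auto simp: ore_simps right_monom_add up_carrier right_monom_up)

lemma right_coeffs_monom:
  assumes "a \<in> carrier R"
  shows "right_coeffs (\<lambda>k. if k = n then a else \<zero>) = right_monom n a"
proof (cases "a = \<zero>")
  case True
  have "right_monom n \<zero> \<in> carrier B"
    by (simp add: ore_simps right_monom_up)
  then have "right_monom n \<zero> = \<zero>\<^bsub>B\<^esub>"
    using right_monom_add[of \<zero> \<zero> n] by (simp add: B.add.l_cancel_one)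
  then show ?thesis
    using True by (simp add: right_coeffs_def ore_simps)
next
  case False
  then show ?thesis
    using assms by (simp add: right_coeffs_def up_carrier right_monom_up)
qed

lemma right_coeffs_const: "a \<in> carrier R \<Longrightarrow> right_coeffs (cst a) = cst a"
  using right_coeffs_monom[of a 0] by (simp add: ore_const_def)

text \<open>In right-hand notation x acts from the left by a mere shift, free of \<sigma> and
  \<delta>. This is what makes coordinates of right coefficients linear over F_2[x] from the
  left.\<close>

lemma right_coeffs_var_mult: "p \<in> up R \<Longrightarrow> right_coeffs (x \<otimes>\<^bsub>B\<^esub> p) = shift (right_coeffs p)"
proof (induction rule: bound_induct)
  case zero
  then show ?case
    by (auto simp: var_mult right_coeffs_def ore_shift_def split: nat.splits)
next
  case (add p q)
  then have "p \<in> carrier B" "q \<in> carrier B" "x \<in> carrier B"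
    by (simp_all add: ore_simps(1))
  then have "right_coeffs (x \<otimes>\<^bsub>B\<^esub> (p \<oplus>\<^bsub>B\<^esub> q)) = shift (right_coeffs (p \<oplus>\<^bsub>B\<^esub> q))"
    using add by (simp add: B.r_distr mult_up right_coeffs_add shift_add right_coeffs_up)
  then show ?case
    by (simp add: ore_simps)
next
  case (monom a n)
  let ?m = "\<lambda>n a k. if k = n then a else \<zero>"
  have up: "?m n c \<in> up R" if "c \<in> carrier R" for n c
    using that by (auto simp: bound_def intro!: mem_upI exI[of _ n])
  have "x \<otimes>\<^bsub>B\<^esub> ?m n a = ?m (Suc n) (\<sigma> a) \<oplus>\<^bsub>B\<^esub> ?m n (\<delta> a)"
    using monom up by (auto simp: var_mult ore_simps ore_x_mult_def split: nat.splits)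
  then have "right_coeffs (x \<otimes>\<^bsub>B\<^esub> ?m n a) = right_monom (Suc n) (\<sigma> a) \<oplus>\<^bsub>B\<^esub> right_monom n (\<delta> a)"
    using monom up by (simp add: right_coeffs_add right_coeffs_monom del: right_monom.simps)
  \<comment> \<open>Since \<tau>(\<sigma>(a)) = a, the recursion for the exponent n + 1 subtracts
    exactly the term that \<delta>(a) contributes.\<close>
  also have "\<dots> = shift (right_monom n a)"
  proof -
    have "right_monom n (\<delta> a) \<in> carrier B" "shift (right_monom n a) \<in> carrier B"
      using monom by (simp_all add: ore_simps(1) right_monom_up shift_up)
    then show ?thesis
      using monom by (simp add: \<tau>_\<sigma> a_minus_def B.a_assoc B.l_neg)
  qed
  finally show ?case
    using monom by (simp add: right_coeffs_monom)
qed

end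

section \<open>Modules with a finite basis\<close>

lemma ring_opposite_ring:
  fixes R (structure)
  assumes "ring R"
  shows "ring (opposite_ring R)"
proof -
  interpret ring R by fact
  show ?thesis
    unfolding opposite_ring_def
  proof (rule ringI)
    show "abelian_group (R\<lparr>monoid.mult := \<lambda>x y. y \<otimes> x\<rparr>)"
    proof (rule abelian_groupI)
      show "\<exists>y\<in>carrier (R\<lparr>monoid.mult := \<lambda>x y. y \<otimes> x\<rparr>).
          y \<oplus>\<^bsub>R\<lparr>monoid.mult := \<lambda>x y. y \<otimes> x\<rparr>\<^esub> x = \<zero>\<^bsub>R\<lparr>monoid.mult := \<lambda>x y. y \<otimes> x\<rparr>\<^esub>"
        if "x \<in> carrier (R\<lparr>monoid.mult := \<lambda>x y. y \<otimes> x\<rparr>)" for x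
        using that by (intro bexI[of _ "\<ominus> x"]) (auto simp: l_neg)
    qed (auto simp: a_ac)
    show "Group.monoid (R\<lparr>monoid.mult := \<lambda>x y. y \<otimes> x\<rparr>)"
      by (rule monoidI) (auto simp: m_assoc)
  qed (auto simp: l_distr r_distr)
qed

lemma finsum_additive:
  assumes "abelian_monoid M" "abelian_monoid N"
    and h: "h \<in> carrier M \<rightarrow> carrier N" "h \<zero>\<^bsub>M\<^esub> = \<zero>\<^bsub>N\<^esub>"
      "\<And>u v. u \<in> carrier M \<Longrightarrow> v \<in> carrier M \<Longrightarrow> h (u \<oplus>\<^bsub>M\<^esub> v) = h u \<oplus>\<^bsub>N\<^esub> h v"
    and "finite S" "f \<in> S \<rightarrow> carrier M"
  shows "h (\<Oplus>\<^bsub>M\<^esub>s\<in>S. f s) = (\<Oplus>\<^bsub>N\<^esub>s\<in>S. h (f s))"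
proof -
  interpret M: abelian_monoid M by fact
  interpret N: abelian_monoid N by fact
  show ?thesis
    using assms(6,7)
  proof (induction S)
    case (insert s S)
    then have "f s \<in> carrier M" "f \<in> S \<rightarrow> carrier M"
      by auto
    moreover from this have "h (f s) \<in> carrier N" "(\<lambda>s. h (f s)) \<in> S \<rightarrow> carrier N"
      using h(1) by auto
    ultimately show ?case
      using insert h(3) by (simp add: M.finsum_insert N.finsum_insert M.finsum_closed)
  qed (use h in simp)
qed

context
  fixes R :: "('r, 'm) ring_scheme" and I :: "'i set"
  assumes R: "ring R"
begin

interpretation ring R by (rule R)

abbreviation "FM \<equiv> free_left_module R I"

lemma free_left_module_simps:
  "f \<in> carrier FM \<longleftrightarrow> (\<forall>i. f i \<in> carrier R) \<and> {i. f i \<noteq> \<zero>\<^bsub>R\<^esub>} \<subseteq> I \<and> finite {i. f i \<noteq> \<zero>\<^bsub>R\<^esub>}"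
  "\<zero>\<^bsub>FM\<^esub> = (\<lambda>i. \<zero>\<^bsub>R\<^esub>)"
  "f \<oplus>\<^bsub>FM\<^esub> g = (\<lambda>i. f i \<oplus>\<^bsub>R\<^esub> g i)"
  "r \<odot>\<^bsub>FM\<^esub> f = (\<lambda>i. r \<otimes>\<^bsub>R\<^esub> f i)"
  by (auto simp: free_left_module_def)

lemma abelian_group_free_left_module: "abelian_group FM"
proof (rule abelian_groupI)
  fix f g
  assume fg: "f \<in> carrier FM" "g \<in> carrier FM"
  have "{i. f i \<oplus>\<^bsub>R\<^esub> g i \<noteq> \<zero>\<^bsub>R\<^esub>} \<subseteq> {i. f i \<noteq> \<zero>\<^bsub>R\<^esub>} \<union> {i. g i \<noteq> \<zero>\<^bsub>R\<^esub>}"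
    by auto
  moreover have "finite ({i. f i \<noteq> \<zero>\<^bsub>R\<^esub>} \<union> {i. g i \<noteq> \<zero>\<^bsub>R\<^esub>})"
    "{i. f i \<noteq> \<zero>\<^bsub>R\<^esub>} \<union> {i. g i \<noteq> \<zero>\<^bsub>R\<^esub>} \<subseteq> I"
    using fg by (auto simp: free_left_module_simps)
  ultimately show "f \<oplus>\<^bsub>FM\<^esub> g \<in> carrier FM"
    using fg by (auto simp: free_left_module_simps intro: finite_subset)
next
  fix f
  assume f: "f \<in> carrier FM"
  then have "{i. \<ominus>\<^bsub>R\<^esub> f i \<noteq> \<zero>\<^bsub>R\<^esub>} \<subseteq> {i. f i \<noteq> \<zero>\<^bsub>R\<^esub>}"
    by auto
  with f have "(\<lambda>i. \<ominus>\<^bsub>R\<^esub> f i) \<in> carrier FM"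
    by (auto simp: free_left_module_simps intro: finite_subset)
  then show "\<exists>g\<in>carrier FM. g \<oplus>\<^bsub>FM\<^esub> f = \<zero>\<^bsub>FM\<^esub>"
    using f by (intro bexI[of _ "\<lambda>i. \<ominus>\<^bsub>R\<^esub> f i"]) (auto simp: free_left_module_simps l_neg)
qed (auto simp: free_left_module_simps a_ac)

lemma direct_summand_free_left_module: "direct_summand R FM (carrier FM)"
proof -
  interpret F: abelian_group FM
    by (rule abelian_group_free_left_module)
  have "r \<odot>\<^bsub>FM\<^esub> f \<in> carrier FM" if "r \<in> carrier R" "f \<in> carrier FM" for r f
  proof -
    have "{i. r \<otimes>\<^bsub>R\<^esub> f i \<noteq> \<zero>\<^bsub>R\<^esub>} \<subseteq> {i. f i \<noteq> \<zero>\<^bsub>R\<^esub>}"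
      using that by auto
    then show ?thesis
      using that by (auto simp: free_left_module_simps intro: finite_subset)
  qed
  then have "submodule (carrier FM) R FM"
    using F.add.subgroup_self by (simp add: submodule_def submodule_axioms_def)
  moreover have "subgroup {\<zero>\<^bsub>FM\<^esub>} (add_monoid FM)"
    using group.triv_subgroup[OF F.a_group] by simp
  then have "submodule {\<zero>\<^bsub>FM\<^esub>} R FM"
    by (auto simp: submodule_def submodule_axioms_def free_left_module_simps)
  moreover have "carrier FM <+>\<^bsub>FM\<^esub> {\<zero>\<^bsub>FM\<^esub>} = carrier FM"
    by (auto simp: set_add_def' )
  ultimately show ?thesis
    unfolding direct_summand_def by auto
qed

end

text \<open>Functionals biorthogonal to a finite spanning family identify M with a free module,
  which is a direct summand of itself. The basis is indexed by the vectors themselves because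
  \<open>projective_left\<close> takes index sets inside M; they are distinct by biorthogonality and
  1 \<noteq> 0.\<close>

lemma finite_basis_imp_fg_projective:
  fixes R :: "('r, 'm) ring_scheme" and M :: "('r, 'a, 'k) module_scheme" and J :: "'j set"
    and e :: "'j \<Rightarrow> 'a" and coord :: "'j \<Rightarrow> 'a \<Rightarrow> 'r"
  assumes R: "ring R" and M: "abelian_group M"
    and smult: "\<And>r u. r \<in> carrier R \<Longrightarrow> u \<in> carrier M \<Longrightarrow> r \<odot>\<^bsub>M\<^esub> u \<in> carrier M"
    and J: "finite J" "\<And>j. j \<in> J \<Longrightarrow> e j \<in> carrier M"
    and coord: "\<And>j u. u \<in> carrier M \<Longrightarrow> coord j u \<in> carrier R"
      "\<And>j u v. u \<in> carrier M \<Longrightarrow> v \<in> carrier M \<Longrightarrow> coord j (u \<oplus>\<^bsub>M\<^esub> v) = coord j u \<oplus>\<^bsub>R\<^esub> coord j v"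
      "\<And>j r u. r \<in> carrier R \<Longrightarrow> u \<in> carrier M \<Longrightarrow> coord j (r \<odot>\<^bsub>M\<^esub> u) = r \<otimes>\<^bsub>R\<^esub> coord j u"
    and delta: "\<And>i j. i \<in> J \<Longrightarrow> j \<in> J \<Longrightarrow> coord i (e j) = (if i = j then \<one>\<^bsub>R\<^esub> else \<zero>\<^bsub>R\<^esub>)"
    and one: "\<one>\<^bsub>R\<^esub> \<noteq> \<zero>\<^bsub>R\<^esub>"
    and span: "\<And>u. u \<in> carrier M \<Longrightarrow> u = (\<Oplus>\<^bsub>M\<^esub>j\<in>J. coord j u \<odot>\<^bsub>M\<^esub> e j)"
  shows "finitely_generated_left R M \<and> projective_left R M"
proof -
  interpret R: ring R by fact
  interpret M: abelian_group M by fact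
  let ?S = "e ` J"
  \<comment> \<open>Coordinates are relabelled by basis vectors instead of indices; the value zero
    off \<open>?S\<close> is forced by membership in the free module.\<close>
  define c where "c = (\<lambda>u s. if s \<in> ?S then coord (inv_into J e s) u else \<zero>\<^bsub>R\<^esub>)"
  have inj: "inj_on e J"
    using delta one by (metis inj_onI)
  have c_e: "c u (e j) = coord j u" if "j \<in> J" for u j
    using that inj by (simp add: c_def)
  have c_closed: "c u s \<in> carrier R" if "u \<in> carrier M" for u s
    using that coord(1) by (simp add: c_def)
  have reindex: "(\<Oplus>\<^bsub>M\<^esub>s\<in>?S. f s \<odot>\<^bsub>M\<^esub> s) = (\<Oplus>\<^bsub>M\<^esub>j\<in>J. f (e j) \<odot>\<^bsub>M\<^esub> e j)"
    if "\<And>s. f s \<in> carrier R" for f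
    using that J smult by (intro M.add.finprod_reindex inj) auto
  have span': "u = (\<Oplus>\<^bsub>M\<^esub>s\<in>?S. c u s \<odot>\<^bsub>M\<^esub> s)" if "u \<in> carrier M" for u
  proof -
    have "(\<Oplus>\<^bsub>M\<^esub>s\<in>?S. c u s \<odot>\<^bsub>M\<^esub> s) = (\<Oplus>\<^bsub>M\<^esub>j\<in>J. c u (e j) \<odot>\<^bsub>M\<^esub> e j)"
      using that by (intro reindex c_closed)
    also have "\<dots> = (\<Oplus>\<^bsub>M\<^esub>j\<in>J. coord j u \<odot>\<^bsub>M\<^esub> e j)"
      using that J smult coord(1) by (intro M.add.finprod_cong') (auto simp: c_e)
    finally show ?thesis
      using span[OF that] by simp
  qed
  have "finitely_generated_left R M"
    unfolding finitely_generated_left_def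
  proof (intro exI[of _ ?S] conjI ballI)
    fix u
    assume u: "u \<in> carrier M"
    show "\<exists>c\<in>?S \<rightarrow> carrier R. u = (\<Oplus>\<^bsub>M\<^esub>s\<in>?S. c s \<odot>\<^bsub>M\<^esub> s)"
      using span'[OF u] c_closed[OF u] by (intro bexI[of _ "c u"]) auto
  qed (use J in auto)
  moreover have "projective_left R M"
    unfolding projective_left_def
  proof (intro exI conjI)
    let ?F = "free_left_module R ?S"
    show "direct_summand R ?F (carrier ?F)"
      using R by (rule direct_summand_free_left_module)
    have c_F: "c u \<in> carrier ?F" if "u \<in> carrier M" for u
    proof -
      have "{s. c u s \<noteq> \<zero>\<^bsub>R\<^esub>} \<subseteq> ?S"
        by (auto simp: c_def)
      moreover from this have "finite {s. c u s \<noteq> \<zero>\<^bsub>R\<^esub>}"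
        using J by (auto intro: finite_subset)
      ultimately show ?thesis
        using that c_closed by (simp add: free_left_module_simps[OF R])
    qed
    have "c \<in> left_hom R M ?F"
      using c_F coord by (auto simp: left_hom_def free_left_module_simps[OF R] c_def)
    then show "c \<in> left_hom R M (?F\<lparr>carrier := carrier ?F\<rparr>)"
      by simp
    show "bij_betw c (carrier M) (carrier ?F)"
    proof (rule bij_betwI[where g = "\<lambda>f. \<Oplus>\<^bsub>M\<^esub>s\<in>?S. f s \<odot>\<^bsub>M\<^esub> s"])
      fix f
      assume f: "f \<in> carrier ?F"
      then have f': "f s \<in> carrier R" for s
        by (simp add: free_left_module_simps[OF R])
      define u where "u = (\<Oplus>\<^bsub>M\<^esub>j\<in>J. f (e j) \<odot>\<^bsub>M\<^esub> e j)"
      have u: "u \<in> carrier M"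
        unfolding u_def using f' J smult by (intro M.finsum_closed) auto
      have coord_u: "coord i u = f (e i)" if i: "i \<in> J" for i
      proof -
        have z: "coord i \<zero>\<^bsub>M\<^esub> = \<zero>\<^bsub>R\<^esub>"
          using coord(1)[of "\<zero>\<^bsub>M\<^esub>" i] coord(2)[of "\<zero>\<^bsub>M\<^esub>" "\<zero>\<^bsub>M\<^esub>" i]
          by (simp add: R.add.l_cancel_one)
        have "coord i u = (\<Oplus>\<^bsub>R\<^esub>j\<in>J. coord i (f (e j) \<odot>\<^bsub>M\<^esub> e j))"
          unfolding u_def using f' J smult coord z
          by (intro finsum_additive M.abelian_monoid_axioms R.abelian_monoid_axioms) auto
        also have "\<dots> = (\<Oplus>\<^bsub>R\<^esub>j\<in>J. if i = j then f (e j) else \<zero>\<^bsub>R\<^esub>)"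
          using f' J coord i delta by (intro R.add.finprod_cong') auto
        also have "\<dots> = f (e i)"
          using i J f' by (intro R.finsum_singleton) auto
        finally show ?thesis .
      qed
      have "c u s = f s" for s
      proof (cases "s \<in> ?S")
        case True
        then show ?thesis
          using c_e coord_u by auto
      next
        case False
        have "{i. f i \<noteq> \<zero>\<^bsub>R\<^esub>} \<subseteq> ?S"
          using f by (simp add: free_left_module_simps[OF R])
        then have "f s = \<zero>\<^bsub>R\<^esub>"
          using False by blast
        then show ?thesis
          using False by (simp add: c_def)
      qed
      then show "c (\<Oplus>\<^bsub>M\<^esub>s\<in>?S. f s \<odot>\<^bsub>M\<^esub> s) = f"
        by (simp add: reindex f' ext flip: u_def)
    next
      show "(\<lambda>f. \<Oplus>\<^bsub>M\<^esub>s\<in>?S. f s \<odot>\<^bsub>M\<^esub> s) \<in> carrier ?F \<rightarrow> carrier M"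
        using J smult by (auto simp: free_left_module_simps[OF R] intro!: M.finsum_closed)
    qed (use c_F span' in auto)
  qed
  ultimately show ?thesis ..
qed

section \<open>The tensor square\<close>

locale tensor_setting = ring B for B (structure) + fixes C
  assumes C_sub: "C \<subseteq> carrier B"
begin

abbreviation S where "S \<equiv> carrier B \<times> carrier B"
abbreviation F where "F \<equiv> tensor_free B"
abbreviation T where "T \<equiv> tensor_relations C B"
abbreviation lact where "lact b \<equiv> frag_extend (\<lambda>(u, v). tensor_gen (b \<otimes> u) v)"
abbreviation ract where "ract b \<equiv> frag_extend (\<lambda>(u, v). tensor_gen u (v \<otimes> b))"

definition relation_gens where "relation_gens =
    {tensor_gen (u \<oplus> u') v - tensor_gen u v - tensor_gen u' v | u u' v.
        u \<in> carrier B \<and> u' \<in> carrier B \<and> v \<in> carrier B} \<union>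
     {tensor_gen u (v \<oplus> v') - tensor_gen u v - tensor_gen u v' | u v v'.
        u \<in> carrier B \<and> v \<in> carrier B \<and> v' \<in> carrier B} \<union>
     {tensor_gen (u \<otimes> c) v - tensor_gen u (c \<otimes> v) | u c v.
        u \<in> carrier B \<and> c \<in> C \<and> v \<in> carrier B}"

lemma T_def: "T = generate F relation_gens"
  by (simp add: tensor_relations_def relation_gens_def)

lemma relation_gensI:
  "\<lbrakk>u \<in> carrier B; u' \<in> carrier B; v \<in> carrier B\<rbrakk> \<Longrightarrow>
    tensor_gen (u \<oplus> u') v - tensor_gen u v - tensor_gen u' v \<in> relation_gens"
  "\<lbrakk>u \<in> carrier B; v \<in> carrier B; v' \<in> carrier B\<rbrakk> \<Longrightarrow>
    tensor_gen u (v \<oplus> v') - tensor_gen u v - tensor_gen u v' \<in> relation_gens"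
  "\<lbrakk>u \<in> carrier B; c \<in> C; v \<in> carrier B\<rbrakk> \<Longrightarrow>
    tensor_gen (u \<otimes> c) v - tensor_gen u (c \<otimes> v) \<in> relation_gens"
  unfolding relation_gens_def by blast+

lemma relation_gensE:
  assumes "f \<in> relation_gens"
  obtains (left) u u' v where "f = tensor_gen (u \<oplus> u') v - tensor_gen u v - tensor_gen u' v"
      "u \<in> carrier B" "u' \<in> carrier B" "v \<in> carrier B"
    | (right) u v v' where "f = tensor_gen u (v \<oplus> v') - tensor_gen u v - tensor_gen u v'"
      "u \<in> carrier B" "v \<in> carrier B" "v' \<in> carrier B"
    | (balanced) u c v where "f = tensor_gen (u \<otimes> c) v - tensor_gen u (c \<otimes> v)"
      "u \<in> carrier B" "c \<in> C" "v \<in> carrier B"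
  using assms unfolding relation_gens_def by blast

lemma keys_tensor_gen [simp]: "Poly_Mapping.keys (tensor_gen u v) = {(u, v)}"
  by (simp add: tensor_gen_def)

lemma keys_diff_subset:
  "Poly_Mapping.keys f \<subseteq> K \<Longrightarrow> Poly_Mapping.keys g \<subseteq> K \<Longrightarrow> Poly_Mapping.keys (f - g) \<subseteq> K"
  using keys_diff[of f g] by blast

lemma keys_add_subset:
  "Poly_Mapping.keys f \<subseteq> K \<Longrightarrow> Poly_Mapping.keys g \<subseteq> K \<Longrightarrow> Poly_Mapping.keys (f + g) \<subseteq> K"
  using keys_add[of f g] by blast

lemma carrier_F: "f \<in> carrier F \<longleftrightarrow> Poly_Mapping.keys f \<subseteq> S"
  unfolding tensor_free_def by (rule carrier_free_Abelian_group_iff)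

lemma relation_gens_subset: "relation_gens \<subseteq> carrier F"
proof
  fix f
  assume "f \<in> relation_gens"
  then show "f \<in> carrier F"
    unfolding carrier_F
    by (cases rule: relation_gensE) (simp_all add: keys_diff_subset subsetD[OF C_sub])
qed

lemma group_F: "group F"
  by (simp add: tensor_free_def)

lemma T_subgroup: "subgroup T F"
  unfolding T_def
  by (rule group.generate_is_subgroup[OF group_F relation_gens_subset])

lemma T_keys: "f \<in> T \<Longrightarrow> Poly_Mapping.keys f \<subseteq> S"
  using subgroup.subset[OF T_subgroup] carrier_F by blast

lemma T_zero [simp]: "0 \<in> T"
  using subgroup.one_closed[OF T_subgroup] by (simp add: tensor_free_def)

lemma T_add: "f \<in> T \<Longrightarrow> g \<in> T \<Longrightarrow> f + g \<in> T"
  using subgroup.m_closed[OF T_subgroup] by (auto simp: tensor_free_def)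

lemma T_uminus: "f \<in> T \<Longrightarrow> - f \<in> T"
  using subgroup.m_inv_closed[OF T_subgroup, of f] T_keys[of f] by (simp add: tensor_free_def)

lemma T_diff: "f \<in> T \<Longrightarrow> g \<in> T \<Longrightarrow> f - g \<in> T"
  using T_add[of f "- g"] T_uminus[of g] by simp

lemma T_gen: "f \<in> relation_gens \<Longrightarrow> f \<in> T"
  unfolding T_def by (rule generate.incl)

text \<open>Closure under differences covers both sums and inverses in the generated subgroup. The
  supports are carried along because \<open>mu_diff\<close> requires them.\<close>

lemma T_induct:
  assumes "f \<in> T" "P 0" "\<And>f g. Poly_Mapping.keys f \<subseteq> S \<Longrightarrow> Poly_Mapping.keys g \<subseteq> S \<Longrightarrow> P f \<Longrightarrow> P g \<Longrightarrow> P (f - g)"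
    and gens: "\<And>f. f \<in> relation_gens \<Longrightarrow> P f"
  shows "P f"
proof -
  have neg: "P (- f)" if "P f" "Poly_Mapping.keys f \<subseteq> S" for f
    using assms(3)[of 0 f] that assms(2) by simp
  let ?H = "{f. Poly_Mapping.keys f \<subseteq> S \<and> P f}"
  have "subgroup ?H F"
  proof
    show "f \<otimes>\<^bsub>F\<^esub> g \<in> ?H" if "f \<in> ?H" "g \<in> ?H" for f g
      using that assms(3)[of f "- g"] neg[of g] keys_add_subset[of f S g]
      by (simp add: tensor_free_def keys_minus)
    show "inv\<^bsub>F\<^esub> f \<in> ?H" if "f \<in> ?H" for f
      using that neg[of f] by (simp add: tensor_free_def keys_minus)
    show "?H \<subseteq> carrier F"
      using carrier_F by blast
    show "\<one>\<^bsub>F\<^esub> \<in> ?H"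
      using assms(2) by (simp add: tensor_free_def)
  qed
  moreover have "relation_gens \<subseteq> ?H"
    using relation_gens_subset gens carrier_F by blast
  ultimately have "T \<subseteq> ?H"
    unfolding T_def by (intro group.generate_subgroup_incl[OF group_F])
  then show ?thesis
    using assms(1) by auto
qed

text \<open>Each defining relation is sent to a defining relation of the same kind, so the action
  descends to the tensor square.\<close>

lemma lact_T:
  assumes b: "b \<in> carrier B" and "f \<in> T"
  shows "lact b f \<in> T"
  using assms(2)
proof (rule T_induct)
  fix f
  assume "f \<in> relation_gens"
  then have "lact b f \<in> relation_gens"
  proof (cases rule: relation_gensE)
    case (left u u' v)
    then have "lact b f = tensor_gen (b \<otimes> u \<oplus> b \<otimes> u') v - tensor_gen (b \<otimes> u) v - tensor_gen (b \<otimes> u') v"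
      using b by (simp add: tensor_gen_def frag_extend_diff r_distr)
    then show ?thesis
      using left b by (simp add: relation_gensI)
  next
    case (right u v v')
    then have "lact b f = tensor_gen (b \<otimes> u) (v \<oplus> v') - tensor_gen (b \<otimes> u) v - tensor_gen (b \<otimes> u) v'"
      using b by (simp add: tensor_gen_def frag_extend_diff)
    then show ?thesis
      using right b by (simp add: relation_gensI)
  next
    case (balanced u c v)
    then have "lact b f = tensor_gen ((b \<otimes> u) \<otimes> c) v - tensor_gen (b \<otimes> u) (c \<otimes> v)"
      using b C_sub by (simp add: tensor_gen_def frag_extend_diff m_assoc subset_iff)
    then show ?thesis
      using balanced b by (simp add: relation_gensI)
  qed
  then show "lact b f \<in> T"
    by (rule T_gen)
qed (simp_all add: frag_extend_diff T_diff)

lemma ract_T: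
  assumes b: "b \<in> carrier B" and "f \<in> T"
  shows "ract b f \<in> T"
  using assms(2)
proof (rule T_induct)
  fix f
  assume "f \<in> relation_gens"
  then have "ract b f \<in> relation_gens"
  proof (cases rule: relation_gensE)
    case (left u u' v)
    then have "ract b f = tensor_gen (u \<oplus> u') (v \<otimes> b) - tensor_gen u (v \<otimes> b) - tensor_gen u' (v \<otimes> b)"
      using b by (simp add: tensor_gen_def frag_extend_diff)
    then show ?thesis
      using left b by (simp add: relation_gensI)
  next
    case (right u v v')
    then have "ract b f = tensor_gen u (v \<otimes> b \<oplus> v' \<otimes> b) - tensor_gen u (v \<otimes> b) - tensor_gen u (v' \<otimes> b)"
      using b by (simp add: tensor_gen_def frag_extend_diff l_distr)
    then show ?thesis
      using right b by (simp add: relation_gensI)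
  next
    case (balanced u c v)
    then have "ract b f = tensor_gen (u \<otimes> c) (v \<otimes> b) - tensor_gen u (c \<otimes> (v \<otimes> b))"
      using b C_sub by (simp add: tensor_gen_def frag_extend_diff m_assoc subset_iff)
    then show ?thesis
      using balanced b by (simp add: relation_gensI)
  qed
  then show "ract b f \<in> T"
    by (rule T_gen)
qed (simp_all add: frag_extend_diff T_diff)

lemma coset_eq: "T #>\<^bsub>F\<^esub> f = {t + f | t. t \<in> T}"
  by (auto simp: r_coset_def tensor_free_def)

lemma coset_eqI:
  assumes "f - g \<in> T"
  shows "T #>\<^bsub>F\<^esub> f = T #>\<^bsub>F\<^esub> g"
proof -
  have "t + f = (t + (f - g)) + g" "t + g = (t - (f - g)) + f" for t
    by simp_all
  then show ?thesis
    unfolding coset_eq using T_add T_diff assms by blast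
qed

text \<open>An additive map preserving \<open>T\<close> sends all representatives of a coset into
  one coset. This gives the unions in \<open>tensor_lmult\<close> and \<open>tensor_rmult\<close>
  their intended values.\<close>

lemma Union_coset:
  assumes "\<And>t. t \<in> T \<Longrightarrow> h t \<in> T" "\<And>f g. h (f + g) = h f + h g"
  shows "(\<Union>g\<in>T #>\<^bsub>F\<^esub> f. T #>\<^bsub>F\<^esub> h g) = T #>\<^bsub>F\<^esub> h f"
proof -
  have "T #>\<^bsub>F\<^esub> h g = T #>\<^bsub>F\<^esub> h f" if "g \<in> T #>\<^bsub>F\<^esub> f" for g
    using that assms by (intro coset_eqI) (auto simp: coset_eq)
  moreover have "f \<in> T #>\<^bsub>F\<^esub> f"
    using T_zero by (force simp: coset_eq)
  ultimately show ?thesis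
    by blast
qed

lemma tensor_lmult_coset:
  "b \<in> carrier B \<Longrightarrow> tensor_lmult C B b (T #>\<^bsub>F\<^esub> f) = T #>\<^bsub>F\<^esub> lact b f"
  unfolding tensor_lmult_def by (rule Union_coset) (auto simp: lact_T frag_extend_add)

lemma tensor_rmult_coset:
  "b \<in> carrier B \<Longrightarrow> tensor_rmult C B (T #>\<^bsub>F\<^esub> f) b = T #>\<^bsub>F\<^esub> ract b f"
  unfolding tensor_rmult_def by (rule Union_coset) (auto simp: ract_T frag_extend_add)

section \<open>The multiplication map on representatives\<close>

definition mu :: "('a \<times> 'a \<Rightarrow>\<^sub>0 int) \<Rightarrow> 'a" where
  "mu f = finsum B (\<lambda>(u, v). [Poly_Mapping.lookup f (u, v)] \<cdot> (u \<otimes> v)) (Poly_Mapping.keys f)"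

lemma mu_superset:
  assumes "Poly_Mapping.keys f \<subseteq> K" "K \<subseteq> S" "finite K"
  shows "mu f = finsum B (\<lambda>(u, v). [Poly_Mapping.lookup f (u, v)] \<cdot> (u \<otimes> v)) K"
  unfolding mu_def
proof (rule add.finprod_mono_neutral_cong_left)
  show "(case i of (u, v) \<Rightarrow> [Poly_Mapping.lookup f (u, v)] \<cdot> (u \<otimes> v)) = \<zero>"
    if "i \<in> K - Poly_Mapping.keys f" for i
    using that by (cases i) (auto simp: in_keys_iff add_pow_int_ge)
qed (use assms in auto)

lemma mu_add:
  assumes "Poly_Mapping.keys f \<subseteq> S" "Poly_Mapping.keys g \<subseteq> S"
  shows "mu (f + g) = mu f \<oplus> mu g"
proof -
  let ?K = "Poly_Mapping.keys f \<union> Poly_Mapping.keys g"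
  have K: "?K \<subseteq> S" "finite ?K"
    using assms by auto
  have "mu (f + g) = finsum B (\<lambda>(u, v). [Poly_Mapping.lookup (f + g) (u, v)] \<cdot> (u \<otimes> v)) ?K"
    using keys_add[of f g] K by (intro mu_superset)
  also have "\<dots> = finsum B (\<lambda>p. (case p of (u, v) \<Rightarrow> [Poly_Mapping.lookup f (u, v)] \<cdot> (u \<otimes> v)) \<oplus>
      (case p of (u, v) \<Rightarrow> [Poly_Mapping.lookup g (u, v)] \<cdot> (u \<otimes> v))) ?K"
    using K by (intro add.finprod_cong') (auto simp: Poly_Mapping.lookup_add add.int_pow_mult)
  also have "\<dots> = mu f \<oplus> mu g"
    using K by (subst finsum_addf) (auto simp: mu_superset[of f ?K] mu_superset[of g ?K])
  finally show ?thesis .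
qed

lemma mu_closed: "Poly_Mapping.keys f \<subseteq> S \<Longrightarrow> mu f \<in> carrier B"
  unfolding mu_def by (intro finsum_closed) auto

lemma mu_zero: "mu 0 = \<zero>"
  by (simp add: mu_def)

lemma mu_gen: "u \<in> carrier B \<Longrightarrow> v \<in> carrier B \<Longrightarrow> mu (tensor_gen u v) = u \<otimes> v"
  by (simp add: mu_def tensor_gen_def add_pow_int_ge)

lemma mu_diff:
  assumes "Poly_Mapping.keys f \<subseteq> S" "Poly_Mapping.keys g \<subseteq> S"
  shows "mu (f - g) = mu f \<ominus> mu g"
proof -
  have "mu (f - g) \<oplus> mu g = mu f"
    using mu_add[of "f - g" g] assms by (simp add: keys_diff_subset)
  moreover have "mu (f - g) \<in> carrier B" "mu g \<in> carrier B"
    using assms by (simp_all add: mu_closed keys_diff_subset)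
  ultimately show ?thesis
    by (metis a_minus_def a_assoc a_inv_closed r_neg r_zero)
qed

lemma minus_minus_eq:
  "\<lbrakk>a \<in> carrier B; b \<in> carrier B; c \<in> carrier B\<rbrakk> \<Longrightarrow> a \<ominus> b \<ominus> c = a \<ominus> (b \<oplus> c)"
  by (simp add: a_minus_def a_assoc minus_add)

text \<open>Distributivity kills the two additive kinds of relations, associativity the balanced
  ones.\<close>

lemma mu_T:
  assumes "f \<in> T"
  shows "mu f = \<zero>"
  using assms
proof (rule T_induct)
  fix f
  assume "f \<in> relation_gens"
  then show "mu f = \<zero>"
  proof (cases rule: relation_gensE)
    case (left u u' v)
    then have "mu f = (u \<oplus> u') \<otimes> v \<ominus> u \<otimes> v \<ominus> u' \<otimes> v"
      by (simp add: mu_diff mu_gen keys_diff_subset)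
    with left show ?thesis
      by (simp add: l_distr minus_minus_eq r_right_minus_eq)
  next
    case (right u v v')
    then have "mu f = u \<otimes> (v \<oplus> v') \<ominus> u \<otimes> v \<ominus> u \<otimes> v'"
      by (simp add: mu_diff mu_gen keys_diff_subset)
    with right show ?thesis
      by (simp add: r_distr minus_minus_eq r_right_minus_eq)
  next
    case (balanced u c v)
    then have "c \<in> carrier B"
      using C_sub by auto
    with balanced show ?thesis
      by (simp add: mu_diff mu_gen m_assoc r_neg a_minus_def)
  qed
qed (simp_all add: mu_diff mu_zero)

lemma tensor_mu_coset:
  assumes "Poly_Mapping.keys f \<subseteq> S"
  shows "tensor_mu B (T #>\<^bsub>F\<^esub> f) = mu f"
proof -
  have "mu g = mu f" if g: "g \<in> T #>\<^bsub>F\<^esub> f" for g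
  proof -
    obtain t where "t \<in> T" "g = t + f"
      using g unfolding coset_eq by blast
    then show ?thesis
      using assms by (simp add: mu_add T_keys mu_T mu_closed)
  qed
  moreover have "f \<in> T #>\<^bsub>F\<^esub> f"
    using T_zero by (force simp: coset_eq)
  ultimately have "mu ` (T #>\<^bsub>F\<^esub> f) = {mu f}"
    by blast
  then show ?thesis
    by (simp add: tensor_mu_def mu_def[abs_def])
qed

text \<open>Replaces cosets by representatives: separability becomes a congruence modulo
  \<open>T\<close> in the free abelian group.\<close>

lemma separable_extensionI:
  assumes f: "Poly_Mapping.keys f \<subseteq> S" and "\<And>b. b \<in> carrier B \<Longrightarrow> lact b f - ract b f \<in> T" "mu f = \<one>"
  shows "separable_extension C B"
  unfolding separable_extension_def
proof (intro bexI conjI ballI)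
  show "T #>\<^bsub>F\<^esub> f \<in> carrier (tensor_square C B)"
    using f carrier_F[of f] by (auto simp: tensor_square_def FactGroup_def RCOSETS_def)
  show "tensor_lmult C B b (T #>\<^bsub>F\<^esub> f) = tensor_rmult C B (T #>\<^bsub>F\<^esub> f) b" if "b \<in> carrier B" for b
    unfolding tensor_lmult_coset[OF that] tensor_rmult_coset[OF that]
    using assms(2)[OF that] by (rule coset_eqI)
qed (use assms in \<open>simp add: tensor_mu_coset\<close>)

section \<open>Bimodule laws and elements commuting with a tensor\<close>

lemma lact_mult:
  assumes "Poly_Mapping.keys f \<subseteq> S" "b \<in> carrier B" "c \<in> carrier B"
  shows "lact (b \<otimes> c) f = lact b (lact c f)"
    and "ract (b \<otimes> c) f = ract c (ract b f)"
    and "lact b (ract c f) = ract c (lact b f)"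
  using assms(1)
  by (induction f rule: frag_induction)
    (use assms in \<open>auto simp: frag_extend_diff tensor_gen_def m_assoc\<close>)

text \<open>Unlike \<open>lact_mult\<close>, this holds only modulo \<open>T\<close>: in the free
  group the pair of (b + c) u and v is a generator of its own, unrelated to those of b u and c
  u.\<close>

lemma lact_add:
  assumes "Poly_Mapping.keys f \<subseteq> S" "b \<in> carrier B" "c \<in> carrier B"
  shows "lact (b \<oplus> c) f - (lact b f + lact c f) \<in> T"
  using assms(1)
proof (induction f rule: frag_induction)
  case (one p)
  then have "tensor_gen (b \<otimes> fst p \<oplus> c \<otimes> fst p) (snd p) - tensor_gen (b \<otimes> fst p) (snd p)
      - tensor_gen (c \<otimes> fst p) (snd p) \<in> T"
    using assms by (intro T_gen relation_gensI) auto
  with one show ?case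
    using assms by (auto simp: l_distr diff_diff_eq)
next
  case (diff f g)
  then show ?case
    using T_diff[OF diff] by (simp add: frag_extend_diff algebra_simps)
qed simp

lemma ract_add:
  assumes "Poly_Mapping.keys f \<subseteq> S" "b \<in> carrier B" "c \<in> carrier B"
  shows "ract (b \<oplus> c) f - (ract b f + ract c f) \<in> T"
  using assms(1)
proof (induction f rule: frag_induction)
  case (one p)
  then have "tensor_gen (fst p) (snd p \<otimes> b \<oplus> snd p \<otimes> c) - tensor_gen (fst p) (snd p \<otimes> b)
      - tensor_gen (fst p) (snd p \<otimes> c) \<in> T"
    using assms by (intro T_gen relation_gensI) auto
  with one show ?case
    using assms by (auto simp: r_distr diff_diff_eq)
next
  case (diff f g)
  then show ?case
    using T_diff[OF diff] by (simp add: frag_extend_diff algebra_simps)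
qed simp

lemma commutes_add:
  assumes "Poly_Mapping.keys f \<subseteq> S" "b \<in> carrier B" "c \<in> carrier B"
    and "lact b f - ract b f \<in> T" "lact c f - ract c f \<in> T"
  shows "lact (b \<oplus> c) f - ract (b \<oplus> c) f \<in> T"
  using T_add[OF T_diff[OF lact_add[OF assms(1-3)] ract_add[OF assms(1-3)]] T_add[OF assms(4,5)]]
  by (simp add: algebra_simps)

text \<open>For p the class of f, b c p - p b c = b (c p - p c) + (b p - p b) c. Together with
  \<open>commutes_add\<close> this reduces centrality of p to generators of the ring.\<close>

lemma commutes_mult:
  assumes "Poly_Mapping.keys f \<subseteq> S" "b \<in> carrier B" "c \<in> carrier B"
    and "lact b f - ract b f \<in> T" "lact c f - ract c f \<in> T"
  shows "lact (b \<otimes> c) f - ract (b \<otimes> c) f \<in> T"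
  using T_add[OF lact_T[OF assms(2,5)] ract_T[OF assms(3,4)]]
  by (simp add: lact_mult[OF assms(1-3)] frag_extend_diff)

text \<open>Equality of classes in the tensor square, as a relation on representatives that can be
  chained.\<close>

definition teq :: "('a \<times> 'a \<Rightarrow>\<^sub>0 int) \<Rightarrow> ('a \<times> 'a \<Rightarrow>\<^sub>0 int) \<Rightarrow> bool" (infix "\<doteq>" 50) where
  "f \<doteq> g \<longleftrightarrow> f - g \<in> T"

lemma teq_refl [simp]: "f \<doteq> f"
  by (simp add: teq_def)

lemma teq_sym: "f \<doteq> g \<Longrightarrow> g \<doteq> f"
  using T_uminus[of "f - g"] by (simp add: teq_def)

lemma teq_trans [trans]: "f \<doteq> g \<Longrightarrow> g \<doteq> h \<Longrightarrow> f \<doteq> h"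
  using T_add[of "f - g" "g - h"] by (simp add: teq_def)

lemma teq_add: "f \<doteq> g \<Longrightarrow> f' \<doteq> g' \<Longrightarrow> f + f' \<doteq> g + g'"
  using T_add[of "f - g" "f' - g'"] by (simp add: teq_def algebra_simps)

lemma teq_sum: "(\<And>i. i \<in> I \<Longrightarrow> f i \<doteq> g i) \<Longrightarrow> sum f I \<doteq> sum g I"
  by (induction I rule: infinite_finite_induct) (auto intro: teq_add)

lemma tensor_gen_add_left:
  "\<lbrakk>u \<in> carrier B; u' \<in> carrier B; v \<in> carrier B\<rbrakk> \<Longrightarrow>
    tensor_gen (u \<oplus> u') v \<doteq> tensor_gen u v + tensor_gen u' v"
  using T_gen[OF relation_gensI(1)] by (simp add: teq_def diff_diff_eq)

lemma tensor_gen_add_right: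
  "\<lbrakk>u \<in> carrier B; v \<in> carrier B; v' \<in> carrier B\<rbrakk> \<Longrightarrow>
    tensor_gen u (v \<oplus> v') \<doteq> tensor_gen u v + tensor_gen u v'"
  using T_gen[OF relation_gensI(2)] by (simp add: teq_def diff_diff_eq)

lemma tensor_gen_balanced:
  "\<lbrakk>u \<in> carrier B; c \<in> C; v \<in> carrier B\<rbrakk> \<Longrightarrow> tensor_gen (u \<otimes> c) v \<doteq> tensor_gen u (c \<otimes> v)"
  using T_gen[OF relation_gensI(3)] by (simp add: teq_def)

lemma tensor_gen_zero_left: "v \<in> carrier B \<Longrightarrow> tensor_gen \<zero> v \<doteq> 0"
  using teq_sym[OF tensor_gen_add_left[of \<zero> \<zero> v]] by (simp add: teq_def)

lemma tensor_gen_zero_right: "u \<in> carrier B \<Longrightarrow> tensor_gen u \<zero> \<doteq> 0"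
  using teq_sym[OF tensor_gen_add_right[of u \<zero> \<zero>]] by (simp add: teq_def)

lemma keys_sum_tensor_gen:
  "(\<And>i. i \<in> I \<Longrightarrow> u i \<in> carrier B) \<Longrightarrow> (\<And>i. i \<in> I \<Longrightarrow> v i \<in> carrier B) \<Longrightarrow>
    Poly_Mapping.keys (\<Sum>i\<in>I. tensor_gen (u i) (v i)) \<subseteq> S"
  by (induction I rule: infinite_finite_induct) (simp_all add: keys_add_subset)

lemma mu_sum:
  assumes "finite I" "\<And>i. i \<in> I \<Longrightarrow> u i \<in> carrier B" "\<And>i. i \<in> I \<Longrightarrow> v i \<in> carrier B"
  shows "mu (\<Sum>i\<in>I. tensor_gen (u i) (v i)) = (\<Oplus>i\<in>I. u i \<otimes> v i)"
  using assms
  by (induction I) (simp_all add: mu_zero mu_add mu_gen keys_sum_tensor_gen Pi_def)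

lemma lact_sum:
  assumes "finite I"
  shows "lact b (\<Sum>i\<in>I. tensor_gen (u i) (v i)) = (\<Sum>i\<in>I. tensor_gen (b \<otimes> u i) (v i))"
    and "ract b (\<Sum>i\<in>I. tensor_gen (u i) (v i)) = (\<Sum>i\<in>I. tensor_gen (u i) (v i \<otimes> b))"
  using assms by (simp_all add: frag_extend_sum tensor_gen_def)

end

section \<open>Trace and normal basis of \<open>\<F>\<^sub>8\<close>\<close>

lemma f8_two [simp]: "(2 :: f8) = 0"
  using f8_add_self[of 1] by simp

lemma f8_numeral [simp]: "(numeral (num.Bit0 n) :: f8) = 0" "(numeral (num.Bit1 n) :: f8) = 1"
  by (simp_all add: numeral.simps f8_add_self)

lemma f8_uminus [simp]: "- (x :: f8) = x"
  using f8_add_self[of x] by (simp add: minus_unique)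

lemma f8_diff [simp]: "x - y = x + (y :: f8)"
  by (simp add: diff_conv_add_uminus del: add_uminus_conv_diff)

lemma f8_add_cancel [simp]: "x + (x + y) = (y :: f8)"
  by (simp add: f8_add_self flip: add.assoc)

definition f8_trace :: "f8 \<Rightarrow> f8" where
  "f8_trace z = z + z ^ 2 + z ^ 4"

text \<open>The choice of the cubic matters: a root of t^3 + t^2 + 1 has trace 1, whereas the
  conjugates of a root of t^3 + t + 1 add up to 0 and are dependent.\<close>

definition normal_basis :: "nat \<Rightarrow> f8" where
  "normal_basis k = f8_gen ^ (2 ^ k)"

lemma f8_power4_add: "(x + y) ^ 4 = x ^ 4 + (y :: f8) ^ 4"
proof -
  have "z ^ 4 = (z ^ 2) ^ 2" for z :: f8
    by (simp flip: power_mult)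
  then show ?thesis
    by (simp only: f8_square_add)
qed

lemma f8_trace_add: "f8_trace (x + y) = f8_trace x + f8_trace y"
  by (simp add: f8_trace_def f8_power4_add f8_square_add ac_simps)

lemma f8_trace_0 [simp]: "f8_trace 0 = 0"
  by (simp add: f8_trace_def)

lemma f8_trace_1 [simp]: "f8_trace 1 = 1"
  by (simp add: f8_trace_def)

lemma f8_trace_square [simp]: "f8_trace (x ^ 2) = f8_trace x"
  using f8_power8[of x] by (simp add: f8_trace_def ac_simps flip: power_mult)

text \<open>Squaring permutes the three summands cyclically because z^8 = z, so the trace is a root
  of t^2 = t.\<close>

lemma f8_trace_bit: "f8_trace x = 0 \<or> f8_trace x = 1"
proof -
  have "(f8_trace x) ^ 2 = x ^ 2 + (x ^ 2) ^ 2 + (x ^ 4) ^ 2"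
    by (simp only: f8_trace_def f8_square_add)
  also have "\<dots> = f8_trace x"
    using f8_power8[of x] by (simp add: f8_trace_def ac_simps flip: power_mult)
  finally have "f8_trace x * f8_trace x = f8_trace x * 1"
    by (simp add: power2_eq_square)
  then show ?thesis
    by (metis mult_cancel_left)
qed

lemma f8_induct [case_names one gen gen2 add]:
  assumes "P 1" "P f8_gen" "P (f8_gen ^ 2)" "\<And>x y. P x \<Longrightarrow> P y \<Longrightarrow> P (x + y)"
  shows "P z"
proof -
  obtain u v w where z: "z = f8_of_poly [:u, v, w:]"
    by (rule f8_cases)
  have const: "f8_of_poly [:c:] = 0 \<or> f8_of_poly [:c:] = 1" for c :: bit
    by (cases c) (simp_all add: zero_f8_def one_f8_def flip: one_pCons)
  have P0: "P 0"
    using assms(1) assms(4)[of 1 1] by (simp add: f8_add_self)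
  show ?thesis
    unfolding z f8_eq_comb
    using const[of u] const[of v] const[of w] assms P0 by (intro assms(4)) auto
qed

text \<open>Additive maps are linear over F_2, so the basis 1, a, a^2 decides.\<close>

lemma f8_additive_eq:
  fixes f g :: "f8 \<Rightarrow> f8"
  assumes "\<And>x y. f (x + y) = f x + f y" "\<And>x y. g (x + y) = g x + g y"
    and "f 1 = g 1" "f f8_gen = g f8_gen" "f (f8_gen ^ 2) = g (f8_gen ^ 2)"
  shows "f z = g z"
  by (induction z rule: f8_induct) (use assms in auto)

lemma f8_gen_powers':
  "f8_gen ^ 8 = f8_gen" "f8_gen ^ 9 = f8_gen ^ 2" "f8_gen ^ 10 = 1 + f8_gen ^ 2"
  "f8_gen ^ 12 = 1 + f8_gen" "f8_gen ^ 16 = f8_gen ^ 2" "f8_gen ^ 20 = f8_gen + f8_gen ^ 2"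
proof -
  have "f8_gen ^ (7 + n) = f8_gen ^ n" for n
    by (simp only: power_add f8_gen_powers mult_1)
  from this[of 1] this[of 2] this[of 3] this[of 5] this[of 9] this[of 13] this[of 6]
  show "f8_gen ^ 8 = f8_gen" "f8_gen ^ 9 = f8_gen ^ 2" "f8_gen ^ 10 = 1 + f8_gen ^ 2"
    "f8_gen ^ 12 = 1 + f8_gen" "f8_gen ^ 16 = f8_gen ^ 2" "f8_gen ^ 20 = f8_gen + f8_gen ^ 2"
    using f8_gen_powers by simp_all
qed

lemma f8_gen_power_mult:
  "f8_gen * f8_gen = f8_gen ^ 2" "f8_gen * f8_gen ^ 2 = 1 + f8_gen ^ 2"
  "f8_gen ^ 2 * f8_gen = 1 + f8_gen ^ 2" "f8_gen ^ 2 * f8_gen ^ 2 = 1 + f8_gen + f8_gen ^ 2"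
  using f8_gen_powers(1,2)
  by (simp_all add: power2_eq_square power3_eq_cube power4_eq_xxxx ac_simps)

lemma normal_basis_eq: "normal_basis 0 = f8_gen" "normal_basis (Suc 0) = f8_gen ^ 2" "normal_basis 2 = 1 + f8_gen + f8_gen ^ 2"
  by (simp_all add: normal_basis_def f8_gen_powers)

lemma f8_gen_trace [simp]: "f8_trace f8_gen = 1" "f8_trace (f8_gen ^ 2) = 1"
  by (simp_all add: f8_trace_def f8_gen_powers f8_gen_powers' ac_simps f8_add_self flip: power_mult)

lemmas normal_basis_arith = normal_basis_eq f8_gen_power_mult f8_gen_powers(2) distrib_left distrib_right f8_trace_add f8_add_self

lemma sum_lessThan_3: "sum f {..<3::nat} = f 0 + f 1 + (f 2 :: 'a :: comm_monoid_add)"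
  by (simp add: numeral_3_eq_3 numeral_2_eq_2)

lemma less_3_cases: "k < 3 \<Longrightarrow> k = 0 \<or> k = 1 \<or> k = (2::nat)"
  by auto

lemma f8_trace_nb: "k < 3 \<Longrightarrow> l < 3 \<Longrightarrow> f8_trace (normal_basis k * normal_basis l) = (if k = l then 1 else 0)"
  by (elim less_3_cases[THEN disjE] disjE) (simp_all add: normal_basis_arith ac_simps)

text \<open>Self-duality makes tr(z \<beta>_k) the coordinate of z at \<beta>_k; all coordinate
  functionals below come from this formula.\<close>

lemma f8_nb_expansion: "(\<Sum>k<3. f8_trace (z * normal_basis k) * normal_basis k) = z"
proof (induction z rule: f8_induct)
  case (add x y)
  then show ?case
    by (simp add: distrib_right f8_trace_add sum.distrib)
qed (simp_all add: sum_lessThan_3 normal_basis_arith ac_simps)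

lemma normal_basis_square: "k < 3 \<Longrightarrow> normal_basis k ^ 2 = normal_basis (Suc k mod 3)"
  by (elim less_3_cases[THEN disjE] disjE) (simp_all add: normal_basis_def f8_gen_powers' flip: power_mult)

text \<open>The sum of squares is the square of tr(a) = 1. For this reason the separability element
  multiplies out to the identity.\<close>

lemma sum_nb_square: "(\<Sum>k<3. normal_basis k * normal_basis k) = 1"
  by (simp add: sum_lessThan_3 normal_basis_arith ac_simps)

section \<open>Matrix units\<close>

text \<open>Indices count from 0: the corner E22 of the overview is \<open>mat_unit 1 1\<close>, and
  E12 is \<open>mat_unit 0 1\<close>.\<close>

definition mat_unit :: "nat \<Rightarrow> nat \<Rightarrow> f8 \<Rightarrow> f8 mat" where
  "mat_unit i j z = mat 2 2 (\<lambda>p. if p = (i, j) then z else 0)"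

lemma mat_unit_carrier [simp, intro]: "mat_unit i j z \<in> carrier_mat 2 2"
  by (simp add: mat_unit_def)

lemma mat_unit_index [simp]: "r < 2 \<Longrightarrow> s < 2 \<Longrightarrow> mat_unit i j z $$ (r, s) = (if (r, s) = (i, j) then z else 0)"
  "dim_row (mat_unit i j z) = 2" "dim_col (mat_unit i j z) = 2"
  by (simp_all add: mat_unit_def)

lemma mat_unit_mult:
  assumes "i < 2" "j < 2" "k < 2" "l < 2"
  shows "mat_unit i j y * mat_unit k l z = (if j = k then mat_unit i l (y * z) else 0\<^sub>m 2 2)"
  using assms less_2_cases[of j] less_2_cases[of k]
  by (intro eq_matI) (auto simp: scalar_prod_def sum_upto_2)

lemma mat_unit_add: "mat_unit i j (y + z) = mat_unit i j y + mat_unit i j z"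
  by (intro eq_matI) auto

lemma mat_unit_zero [simp]: "mat_unit i j 0 = 0\<^sub>m 2 2"
  by (intro eq_matI) auto

lemma mat_unit_expansion:
  "X \<in> carrier_mat 2 2 \<Longrightarrow>
    X = mat_unit 0 0 (X $$ (0, 0)) + mat_unit 0 1 (X $$ (0, 1)) + (mat_unit 1 0 (X $$ (1, 0)) + mat_unit 1 1 (X $$ (1, 1)))"
  by (intro eq_matI) (auto simp: less_2_cases_iff)

lemma frob_sigma_mat_unit: "frob_sigma (mat_unit i j z) = mat_unit i j (z ^ 2)"
  by (intro eq_matI) (auto simp: frob_sigma_def)

definition delta_diag :: "nat \<Rightarrow> f8" where
  "delta_diag i = (if i = 1 then f8_gen else 0)"

lemma delta_M_carrier [simp]: "delta_M \<in> carrier_mat 2 2"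
  by (rule carrier_matI) (simp_all add: delta_M_def mat_of_rows_list_def)

lemma delta_M_index: "i < 2 \<Longrightarrow> j < 2 \<Longrightarrow> delta_M $$ (i, j) = (if i = j then delta_diag i else 0)"
  by (auto simp: delta_M_def mat_of_rows_list_def delta_diag_def less_2_cases_iff)

lemma frob_sigma_carrier [simp, intro]: "X \<in> carrier_mat 2 2 \<Longrightarrow> frob_sigma X \<in> carrier_mat 2 2"
  by (simp add: frob_sigma_def)

lemma frob_sigma_index: "X \<in> carrier_mat 2 2 \<Longrightarrow> i < 2 \<Longrightarrow> j < 2 \<Longrightarrow> frob_sigma X $$ (i, j) = (X $$ (i, j)) ^ 2"
  by (simp add: frob_sigma_def)

lemma inner_delta_carrier [simp, intro]: "X \<in> carrier_mat 2 2 \<Longrightarrow> inner_delta X \<in> carrier_mat 2 2"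
  unfolding inner_delta_def
  by (intro minus_carrier_mat mult_carrier_mat[of _ 2 2 _ 2]) auto

text \<open>As M is diagonal, \<delta> never mixes matrix entries; the sign disappears in
  characteristic 2.\<close>

lemma inner_delta_index:
  assumes X: "X \<in> carrier_mat 2 2" and ij: "i < 2" "j < 2"
  shows "inner_delta X $$ (i, j) = delta_diag i * X $$ (i, j) + (X $$ (i, j)) ^ 2 * delta_diag j"
proof -
  have "dim_row delta_M = 2" "dim_col delta_M = 2" "dim_row (frob_sigma X) = 2" "dim_col (frob_sigma X) = 2"
    using carrier_matD[OF delta_M_carrier] carrier_matD[OF frob_sigma_carrier[OF X]] by simp_all
  then show ?thesis
    using X ij
    by (auto simp: inner_delta_def scalar_prod_def sum_upto_2 delta_M_index frob_sigma_index less_2_cases_iff)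
qed

lemma inner_delta_mat_unit:
  assumes "i < 2" "j < 2"
  shows "inner_delta (mat_unit i j z) = mat_unit i j (delta_diag i * z + z ^ 2 * delta_diag j)"
proof (rule eq_matI)
  fix r s
  assume "r < dim_row (mat_unit i j (delta_diag i * z + z\<^sup>2 * delta_diag j))" "s < dim_col (mat_unit i j (delta_diag i * z + z\<^sup>2 * delta_diag j))"
  then show "inner_delta (mat_unit i j z) $$ (r, s) = mat_unit i j (delta_diag i * z + z\<^sup>2 * delta_diag j) $$ (r, s)"
    by (auto simp: inner_delta_index)
qed (use carrier_matD[OF inner_delta_carrier[OF mat_unit_carrier]] in simp_all)

lemma M2_F8_simps [simp]:
  "carrier M2_F8 = carrier_mat 2 2" "monoid.mult M2_F8 = (*)" "add M2_F8 = (+)"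
  "\<one>\<^bsub>M2_F8\<^esub> = 1\<^sub>m 2" "\<zero>\<^bsub>M2_F8\<^esub> = 0\<^sub>m 2 2"
  by (simp_all add: M2_F8_def ring_mat_simps)

lemma mat_f8_add_self: "X \<in> carrier_mat 2 2 \<Longrightarrow> X + X = (0\<^sub>m 2 2 :: f8 mat)"
  by (intro eq_matI) (auto simp: f8_add_self)

text \<open>The cube of \<sigma> is the identity because z^8 = z on F_8, so the square of \<sigma>
  serves as its inverse \<tau>.\<close>

interpretation A: ore_setting_inverse M2_F8 frob_sigma inner_delta "frob_sigma \<circ> frob_sigma"
  rewrites ore_fold: "ore_extension M2_F8 frob_sigma inner_delta = ore_M2_F8"
proof -
  have "ring M2_F8"
    unfolding M2_F8_def by (rule ring_mat)
  moreover have "frob_sigma (frob_sigma (frob_sigma X)) = X" if "X \<in> carrier_mat 2 2" for X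
    using that by (intro eq_matI) (simp_all add: frob_sigma_def f8_power8 flip: power_mult)
  ultimately show "ore_setting_inverse M2_F8 frob_sigma inner_delta (frob_sigma \<circ> frob_sigma)"
    using frob_sigma_iso
    by (auto simp: ore_setting_inverse_def ore_setting_def ore_setting_axioms_def
        ore_setting_inverse_axioms_def ring_iso_def frob_sigma_add inner_delta_derivation)
qed (simp add: ore_M2_F8_def)

interpretation O: ring ore_M2_F8
  using A.ring_ore_extension by (simp add: ore_fold)

abbreviation "OM \<equiv> ore_M2_F8"
abbreviation "cs \<equiv> ore_const M2_F8"
abbreviation "X \<equiv> ore_var M2_F8"
abbreviation "sh \<equiv> ore_shift M2_F8"

lemma frob_sigma_surj: "frob_sigma ` carrier M2_F8 = carrier M2_F8"
  using frob_sigma_iso by (simp add: ring_iso_def bij_betw_def)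

lemmas carrier_OM = A.ore_simps(1)

lemma cs_closed [simp, intro]: "Y \<in> carrier_mat 2 2 \<Longrightarrow> cs Y \<in> carrier OM"
  by (simp add: carrier_OM)

lemma X_closed [simp, intro]: "X \<in> carrier OM"
  by (simp add: carrier_OM)

lemma OM_carrier_index: "u \<in> carrier OM \<Longrightarrow> u n \<in> carrier_mat 2 2"
  using A.up_carrier[of u n] by (simp add: carrier_OM)

lemma OM_mult_index_simps:
  "u \<in> carrier OM \<Longrightarrow> u \<otimes>\<^bsub>OM\<^esub> X = sh u"
  "u \<in> carrier OM \<Longrightarrow> X \<otimes>\<^bsub>OM\<^esub> u = ore_x_mult M2_F8 frob_sigma inner_delta u"
  by (simp_all add: carrier_OM A.mult_var A.var_mult)

lemma sh_closed: "u \<in> carrier OM \<Longrightarrow> sh u \<in> carrier OM"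
  by (simp add: carrier_OM)

section \<open>The subring \<open>\<F>\<^sub>2[x]\<close>\<close>

abbreviation "bits \<equiv> {0\<^sub>m 2 2, 1\<^sub>m 2 :: f8 mat}"

lemma poly_F2_iff: "p \<in> poly_F2 \<longleftrightarrow> p \<in> carrier OM \<and> range p \<subseteq> bits"
  by (simp add: poly_F2_def polys_with_coeffs_in_def carrier_OM)

lemma poly_F2_closed: "p \<in> poly_F2 \<Longrightarrow> p \<in> carrier OM"
  by (simp add: poly_F2_iff)

lemma bits_carrier: "b \<in> bits \<Longrightarrow> b \<in> carrier_mat 2 2"
  by auto

lemma bits_add: "b \<in> bits \<Longrightarrow> c \<in> bits \<Longrightarrow> b + c \<in> bits"
  using mat_f8_add_self[of "1\<^sub>m 2"] by auto

lemma poly_F2_zero: "\<zero>\<^bsub>OM\<^esub> \<in> poly_F2"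
  and poly_F2_one: "\<one>\<^bsub>OM\<^esub> \<in> poly_F2"
  and poly_F2_add: "p \<in> poly_F2 \<Longrightarrow> q \<in> poly_F2 \<Longrightarrow> p \<oplus>\<^bsub>OM\<^esub> q \<in> poly_F2"
proof -
  show "\<zero>\<^bsub>OM\<^esub> \<in> poly_F2" "\<one>\<^bsub>OM\<^esub> \<in> poly_F2"
    using O.zero_closed O.one_closed by (auto simp: poly_F2_iff A.ore_simps(2,3) ore_const_def)
  assume "p \<in> poly_F2" "q \<in> poly_F2"
  then show "p \<oplus>\<^bsub>OM\<^esub> q \<in> poly_F2"
    using O.add.m_closed[of p q] bits_add by (auto simp: poly_F2_iff A.ore_simps(4) image_subset_iff)
qed

lemma poly_F2_shift: "p \<in> poly_F2 \<Longrightarrow> sh p \<in> poly_F2"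
  unfolding poly_F2_iff by (auto simp: sh_closed) (auto simp: ore_shift_def split: nat.splits)

lemma const_poly_F2: "b \<in> bits \<Longrightarrow> cs b \<in> poly_F2"
  using bits_carrier[of b] unfolding poly_F2_iff by (auto simp: cs_closed) (auto simp: ore_const_def)

lemma inner_delta_bits: "b \<in> bits \<Longrightarrow> inner_delta b = 0\<^sub>m 2 2"
  using A.\<delta>_zero A.\<delta>_one by auto

lemma frob_sigma_bits: "b \<in> bits \<Longrightarrow> frob_sigma b = b"
  using A.\<sigma>_zero A.\<sigma>_one by auto

text \<open>The matrices 0 and 1 are fixed by \<sigma> and killed by \<delta>, so x commutes with
  \<open>poly_F2\<close>. Closure of \<open>poly_F2\<close> under multiplication rests on
  this.\<close>

lemma X_mult_poly_F2:
  assumes "p \<in> poly_F2"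
  shows "X \<otimes>\<^bsub>OM\<^esub> p = sh p"
proof -
  have "p n \<in> bits" for n
    using assms by (auto simp: poly_F2_iff)
  then have "inner_delta (p n) = 0\<^sub>m 2 2" "frob_sigma (p n) = p n" "p n \<in> carrier_mat 2 2" for n
    using inner_delta_bits frob_sigma_bits bits_carrier by blast+
  then show ?thesis
    using assms
    by (auto simp: poly_F2_closed OM_mult_index_simps ore_x_mult_def ore_shift_def split: nat.splits)
qed

lemma mult_X_poly_F2: "p \<in> poly_F2 \<Longrightarrow> p \<otimes>\<^bsub>OM\<^esub> X = sh p"
  by (simp add: OM_mult_index_simps poly_F2_closed)

lemma poly_F2_induct [consumes 1, case_names zero one add X]:
  assumes "p \<in> poly_F2" and "P \<zero>\<^bsub>OM\<^esub>" "P \<one>\<^bsub>OM\<^esub>"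
    and "\<And>p q. p \<in> poly_F2 \<Longrightarrow> q \<in> poly_F2 \<Longrightarrow> P p \<Longrightarrow> P q \<Longrightarrow> P (p \<oplus>\<^bsub>OM\<^esub> q)"
    and "\<And>p. p \<in> poly_F2 \<Longrightarrow> P p \<Longrightarrow> P (X \<otimes>\<^bsub>OM\<^esub> p)"
  shows "P p"
proof -
  have "p \<in> up M2_F8" "range p \<subseteq> bits"
    using assms(1) by (simp_all add: poly_F2_iff carrier_OM)
  then show ?thesis
  proof (induction rule: A.horner_induct)
    case (step a q)
    then have q: "q \<in> poly_F2"
      by (simp add: poly_F2_iff carrier_OM)
    have "P (cs a)"
      using step(1) assms(2,3) A.const_zero by (auto simp: A.ore_simps(3))
    moreover have "P (sh q)"
      using assms(5)[OF q step.IH] by (simp add: X_mult_poly_F2 q)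
    ultimately show ?case
      using assms(4) const_poly_F2 poly_F2_shift q step(1) by simp
  qed (use assms in simp)
qed

lemma poly_F2_mult:
  assumes "p \<in> poly_F2" "q \<in> poly_F2"
  shows "p \<otimes>\<^bsub>OM\<^esub> q \<in> poly_F2"
  using assms(1)
proof (induction rule: poly_F2_induct)
  case (add p p')
  then show ?case
    using assms by (simp add: O.l_distr poly_F2_closed poly_F2_add)
next
  case (X p)
  then show ?case
    using assms by (simp add: O.m_assoc poly_F2_closed X_mult_poly_F2[of "p \<otimes>\<^bsub>OM\<^esub> q"] poly_F2_shift)
qed (use assms poly_F2_zero in \<open>simp_all add: poly_F2_closed\<close>)

lemma uminus_OM: "u \<in> carrier OM \<Longrightarrow> \<ominus>\<^bsub>OM\<^esub> u = u"
  using mat_f8_add_self OM_carrier_index[of u]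
  by (intro O.minus_equality) (simp_all add: A.ore_simps(2,4))

lemma subring_poly_F2: "subring poly_F2 OM"
  using poly_F2_closed poly_F2_one poly_F2_mult poly_F2_add
  by (intro O.subringI) (auto simp: uminus_OM)

lemma ring_poly_F2: "ring (OM\<lparr>carrier := poly_F2\<rparr>)"
  by (rule O.subring_is_ring[OF subring_poly_F2])

text \<open>Since \<open>\<F>\<^sub>2[x]\<close> is generated by \<open>x\<close>, linearity need only be checked on \<open>x\<close>.\<close>

lemma poly_F2_linear_left:
  assumes h: "h \<in> carrier OM \<rightarrow> carrier OM"
    "\<And>u v. u \<in> carrier OM \<Longrightarrow> v \<in> carrier OM \<Longrightarrow> h (u \<oplus>\<^bsub>OM\<^esub> v) = h u \<oplus>\<^bsub>OM\<^esub> h v"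
    and hX: "\<And>u. u \<in> carrier OM \<Longrightarrow> h (X \<otimes>\<^bsub>OM\<^esub> u) = X \<otimes>\<^bsub>OM\<^esub> h u"
    and "c \<in> poly_F2" "u \<in> carrier OM"
  shows "h (c \<otimes>\<^bsub>OM\<^esub> u) = c \<otimes>\<^bsub>OM\<^esub> h u"
proof -
  have h': "h v \<in> carrier OM" if "v \<in> carrier OM" for v
    using h that by auto
  show ?thesis
    using assms(4,5)
  proof (induction rule: poly_F2_induct)
    case zero
    then show ?case
      using h(2)[of "\<zero>\<^bsub>OM\<^esub>" "\<zero>\<^bsub>OM\<^esub>"] h' by (simp add: O.add.l_cancel_one)
  next
    case (X p)
    then have "h ((X \<otimes>\<^bsub>OM\<^esub> p) \<otimes>\<^bsub>OM\<^esub> u) = h (X \<otimes>\<^bsub>OM\<^esub> (p \<otimes>\<^bsub>OM\<^esub> u))"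
      by (simp add: O.m_assoc poly_F2_closed)
    with X show ?case
      by (simp add: hX h' O.m_assoc poly_F2_closed)
  qed (use h h' in \<open>simp_all add: O.l_distr poly_F2_closed\<close>)
qed

lemma poly_F2_linear_right:
  assumes h: "h \<in> carrier OM \<rightarrow> carrier OM"
    "\<And>u v. u \<in> carrier OM \<Longrightarrow> v \<in> carrier OM \<Longrightarrow> h (u \<oplus>\<^bsub>OM\<^esub> v) = h u \<oplus>\<^bsub>OM\<^esub> h v"
    and hX: "\<And>u. u \<in> carrier OM \<Longrightarrow> h (u \<otimes>\<^bsub>OM\<^esub> X) = h u \<otimes>\<^bsub>OM\<^esub> X"
    and "c \<in> poly_F2" "u \<in> carrier OM"
  shows "h (u \<otimes>\<^bsub>OM\<^esub> c) = h u \<otimes>\<^bsub>OM\<^esub> c"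
proof -
  have h': "h v \<in> carrier OM" if "v \<in> carrier OM" for v
    using h that by auto
  show ?thesis
    using assms(4,5)
  proof (induction arbitrary: u rule: poly_F2_induct)
    case zero
    then show ?case
      using h(2)[of "\<zero>\<^bsub>OM\<^esub>" "\<zero>\<^bsub>OM\<^esub>"] h' by (simp add: O.add.l_cancel_one)
  next
    case (X p)
    then have "h (u \<otimes>\<^bsub>OM\<^esub> (X \<otimes>\<^bsub>OM\<^esub> p)) = h ((u \<otimes>\<^bsub>OM\<^esub> X) \<otimes>\<^bsub>OM\<^esub> p)"
      by (simp add: O.m_assoc poly_F2_closed)
    also have "\<dots> = (h u \<otimes>\<^bsub>OM\<^esub> X) \<otimes>\<^bsub>OM\<^esub> p"
      using X by (simp add: hX)
    also have "\<dots> = h u \<otimes>\<^bsub>OM\<^esub> (X \<otimes>\<^bsub>OM\<^esub> p)"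
      using X by (simp add: h' O.m_assoc poly_F2_closed)
    finally show ?case .
  qed (use h h' in \<open>simp_all add: O.r_distr poly_F2_closed\<close>)
qed

section \<open>Coordinates\<close>

text \<open>The value is the scalar matrix 0 or 1, because F_2 sits inside A. Pairing with
  \<open>y\<close> under the trace form reads off coordinates once \<open>y\<close> runs through a
  self-dual basis.\<close>

definition entry_trace :: "nat \<Rightarrow> nat \<Rightarrow> f8 \<Rightarrow> f8 mat \<Rightarrow> f8 mat" where
  "entry_trace i j y Y = f8_trace (Y $$ (i, j) * y) \<cdot>\<^sub>m 1\<^sub>m 2"

definition trace_coord :: "nat \<Rightarrow> nat \<Rightarrow> f8 \<Rightarrow> (nat \<Rightarrow> f8 mat) \<Rightarrow> nat \<Rightarrow> f8 mat" where
  "trace_coord i j y u = (\<lambda>n. entry_trace i j y (u n))"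

lemma smult_bits [simp]: "(0 :: f8) \<cdot>\<^sub>m 1\<^sub>m 2 = 0\<^sub>m 2 2" "(1 :: f8) \<cdot>\<^sub>m 1\<^sub>m 2 = 1\<^sub>m 2"
  by (auto intro!: eq_matI)

lemma entry_trace_bits: "entry_trace i j y Y \<in> bits"
  using f8_trace_bit[of "Y $$ (i, j) * y"] by (auto simp: entry_trace_def)

lemma entry_trace_carrier [simp]: "entry_trace i j y Y \<in> carrier_mat 2 2"
  using entry_trace_bits bits_carrier by blast

lemma entry_trace_add:
  assumes "i < 2" "j < 2" "Y \<in> carrier_mat 2 2" "Z \<in> carrier_mat 2 2"
  shows "entry_trace i j y (Y + Z) = entry_trace i j y Y + entry_trace i j y Z"
  using assms by (intro eq_matI) (auto simp: entry_trace_def distrib_right f8_trace_add)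

lemma entry_trace_zero: "i < 2 \<Longrightarrow> j < 2 \<Longrightarrow> entry_trace i j y (0\<^sub>m 2 2) = 0\<^sub>m 2 2"
  by (simp add: entry_trace_def)

lemma trace_coord_closed:
  assumes "i < 2" "j < 2" "u \<in> carrier OM"
  shows "trace_coord i j y u \<in> poly_F2"
  using A.map_up[of u "entry_trace i j y"] entry_trace_bits assms
  by (auto simp: trace_coord_def poly_F2_iff carrier_OM entry_trace_zero image_subset_iff simp del: insert_iff)

lemma trace_coord_closed' [simp]: "i < 2 \<Longrightarrow> j < 2 \<Longrightarrow> u \<in> carrier OM \<Longrightarrow> trace_coord i j y u \<in> carrier OM"
  by (rule poly_F2_closed[OF trace_coord_closed])

lemma trace_coord_add:
  "\<lbrakk>i < 2; j < 2; u \<in> carrier OM; v \<in> carrier OM\<rbrakk> \<Longrightarrow>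
    trace_coord i j y (u \<oplus>\<^bsub>OM\<^esub> v) = trace_coord i j y u \<oplus>\<^bsub>OM\<^esub> trace_coord i j y v"
  by (simp add: trace_coord_def A.ore_simps(4) entry_trace_add OM_carrier_index)

lemma trace_coord_shift: "i < 2 \<Longrightarrow> j < 2 \<Longrightarrow> trace_coord i j y (sh u) = sh (trace_coord i j y u)"
  by (auto simp: trace_coord_def ore_shift_def entry_trace_zero split: nat.splits)

lemma trace_coord_const: "i < 2 \<Longrightarrow> j < 2 \<Longrightarrow> trace_coord i j y (cs Y) = cs (entry_trace i j y Y)"
  by (auto simp: trace_coord_def ore_const_def entry_trace_zero)

text \<open>Right multiplication by x only shifts the left coefficients, so a coefficientwise
  additive map commutes with it; \<sigma> and \<delta> are felt only on the left.\<close>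

lemma trace_coord_right_linear:
  assumes "i < 2" "j < 2" "u \<in> carrier OM" "c \<in> poly_F2"
  shows "trace_coord i j y (u \<otimes>\<^bsub>OM\<^esub> c) = trace_coord i j y u \<otimes>\<^bsub>OM\<^esub> c"
proof (rule poly_F2_linear_right)
  show "trace_coord i j y (u \<otimes>\<^bsub>OM\<^esub> X) = trace_coord i j y u \<otimes>\<^bsub>OM\<^esub> X" if "u \<in> carrier OM" for u
    using that assms by (simp add: OM_mult_index_simps trace_coord_shift mult_X_poly_F2 trace_coord_closed)
qed (use assms in \<open>auto simp: trace_coord_add\<close>)

lemma split_OM: "split_extension poly_F2 OM"
  unfolding split_extension_def
proof (intro exI conjI ballI)
  have X: "trace_coord 0 0 1 (X \<otimes>\<^bsub>OM\<^esub> u) = X \<otimes>\<^bsub>OM\<^esub> trace_coord 0 0 1 u" if u: "u \<in> carrier OM" for u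
  proof -
    have "entry_trace 0 0 1 (frob_sigma Y) = entry_trace 0 0 1 Y" "entry_trace 0 0 1 (inner_delta Y) = 0\<^sub>m 2 2"
      if "Y \<in> carrier_mat 2 2" for Y
      using that by (simp_all add: entry_trace_def frob_sigma_index inner_delta_index delta_diag_def)
    then have "trace_coord 0 0 1 (ore_x_mult M2_F8 frob_sigma inner_delta u) = sh (trace_coord 0 0 1 u)"
      using u by (auto simp: trace_coord_def ore_x_mult_def ore_shift_def entry_trace_zero entry_trace_add OM_carrier_index
          split: nat.splits)
    then show ?thesis
      using u by (simp add: OM_mult_index_simps(2) X_mult_poly_F2 trace_coord_closed flip: OM_mult_index_simps(2))
  qed
  show "trace_coord 0 0 1 (c \<otimes>\<^bsub>OM\<^esub> u) = c \<otimes>\<^bsub>OM\<^esub> trace_coord 0 0 1 u" if "c \<in> poly_F2" "u \<in> carrier OM" for c u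
    by (rule poly_F2_linear_left[where h = "trace_coord 0 0 1"]) (use that in \<open>auto simp: trace_coord_add X\<close>)
  \<comment> \<open>The value is tr(1) = 1 because the degree 3 of F_8 over F_2 is odd.\<close>
  show "trace_coord 0 0 1 \<one>\<^bsub>OM\<^esub> = \<one>\<^bsub>OM\<^esub>"
    by (simp add: A.ore_simps(3) trace_coord_const) (simp add: entry_trace_def)
qed (auto simp: trace_coord_add trace_coord_right_linear trace_coord_closed)

section \<open>Bases on both sides\<close>

definition basis_index :: "(nat \<times> nat \<times> nat) set" where
  "basis_index = {..<2} \<times> {..<2} \<times> {..<3}"

definition basis_part :: "f8 mat \<Rightarrow> nat \<times> nat \<times> nat \<Rightarrow> f8 mat" where
  "basis_part Y = (\<lambda>(i, j, k). mat_unit i j (f8_trace (Y $$ (i, j) * normal_basis k) * normal_basis k))"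

definition basis_elt :: "nat \<times> nat \<times> nat \<Rightarrow> nat \<Rightarrow> f8 mat" where
  "basis_elt = (\<lambda>(i, j, k). cs (mat_unit i j (normal_basis k)))"

definition basis_coord :: "nat \<times> nat \<times> nat \<Rightarrow> (nat \<Rightarrow> f8 mat) \<Rightarrow> nat \<Rightarrow> f8 mat" where
  "basis_coord = (\<lambda>(i, j, k). trace_coord i j (normal_basis k))"

lemma finite_basis_index [simp]: "finite basis_index"
  by (simp add: basis_index_def)

lemma basis_index_cases:
  assumes "p \<in> basis_index"
  obtains i j k where "p = (i, j, k)" "i < 2" "j < 2" "k < 3"
  using assms by (auto simp: basis_index_def)

lemma basis_part_closed [simp]: "basis_part Y p \<in> carrier_mat 2 2"
  by (simp add: basis_part_def split_def)

lemma basis_elt_closed [simp]: "basis_elt p \<in> carrier OM"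
  by (auto simp: basis_elt_def split_def)

lemma basis_coord_closed: "p \<in> basis_index \<Longrightarrow> u \<in> carrier OM \<Longrightarrow> basis_coord p u \<in> poly_F2"
  by (elim basis_index_cases) (simp add: basis_coord_def trace_coord_closed)

lemma basis_coord_closed' [simp]: "p \<in> basis_index \<Longrightarrow> u \<in> carrier OM \<Longrightarrow> basis_coord p u \<in> carrier OM"
  by (rule poly_F2_closed[OF basis_coord_closed])

lemma basis_coord_add:
  "p \<in> basis_index \<Longrightarrow> u \<in> carrier OM \<Longrightarrow> v \<in> carrier OM \<Longrightarrow> basis_coord p (u \<oplus>\<^bsub>OM\<^esub> v) = basis_coord p u \<oplus>\<^bsub>OM\<^esub> basis_coord p v"
  by (elim basis_index_cases) (simp add: basis_coord_def trace_coord_add)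

lemma basis_coord_shift: "p \<in> basis_index \<Longrightarrow> basis_coord p (sh u) = sh (basis_coord p u)"
  by (elim basis_index_cases) (simp add: basis_coord_def trace_coord_shift)

lemma basis_coord_right_linear:
  "p \<in> basis_index \<Longrightarrow> u \<in> carrier OM \<Longrightarrow> c \<in> poly_F2 \<Longrightarrow> basis_coord p (u \<otimes>\<^bsub>OM\<^esub> c) = basis_coord p u \<otimes>\<^bsub>OM\<^esub> c"
  by (elim basis_index_cases) (simp add: basis_coord_def trace_coord_right_linear)

lemma M2_F8_finsum:
  assumes "finite I" "\<And>i. i \<in> I \<Longrightarrow> f i \<in> carrier_mat 2 2"
  shows "finsum M2_F8 f I = mat 2 2 (\<lambda>p. \<Sum>i\<in>I. f i $$ p)"
  using assms
proof (induction I)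
  case (insert i I)
  then have "finsum M2_F8 f (insert i I) = f i + finsum M2_F8 f I"
    by (subst A.finsum_insert) auto
  also have "\<dots> = mat 2 2 (\<lambda>p. \<Sum>i\<in>insert i I. f i $$ p)"
    using insert by (intro eq_matI) auto
  finally show ?case .
qed (auto intro!: eq_matI)

lemma entry_trace_expansion:
  assumes Y: "Y \<in> carrier_mat 2 2"
  shows "(\<Oplus>\<^bsub>M2_F8\<^esub>p\<in>basis_index. basis_part Y p) = Y"
proof -
  have "(\<Sum>p\<in>basis_index. basis_part Y p $$ (r, s)) = Y $$ (r, s)"
    if rs: "r < 2" "s < 2" for r s
  proof -
    have "(\<Sum>p\<in>basis_index. basis_part Y p $$ (r, s)) =
        (\<Sum>i<2. \<Sum>j<2. \<Sum>k<3. mat_unit i j (f8_trace (Y $$ (i, j) * normal_basis k) * normal_basis k) $$ (r, s))"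
      by (simp add: sum.cartesian_product split_def basis_index_def basis_part_def)
    also have "\<dots> = (\<Sum>i<2. if r = i then \<Sum>j<2. if s = j then Y $$ (i, j) else 0 else 0)"
    proof (intro sum.cong refl)
      fix i :: nat
      have "(\<Sum>k<3. mat_unit i j (f8_trace (Y $$ (i, j) * normal_basis k) * normal_basis k) $$ (r, s)) =
          (if r = i then if s = j then Y $$ (i, j) else 0 else 0)" for j
        using rs by (simp add: f8_nb_expansion)
      then show "(\<Sum>j<2. \<Sum>k<3. mat_unit i j (f8_trace (Y $$ (i, j) * normal_basis k) * normal_basis k) $$ (r, s)) =
          (if r = i then \<Sum>j<2. if s = j then Y $$ (i, j) else 0 else 0)"
        by simp
    qed
    also have "\<dots> = Y $$ (r, s)"
      using rs by simp
    finally show ?thesis .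
  qed
  then show ?thesis
    using Y by (subst M2_F8_finsum) (auto intro!: eq_matI)
qed

text \<open>The scalar matrices 0 and 1 are central in A, which lets the same basis and the same
  coordinates of constants serve on both sides.\<close>

lemma entry_trace_mult:
  assumes "i < 2" "j < 2"
  shows "mat_unit i j z * entry_trace i j y Y = mat_unit i j (f8_trace (Y $$ (i, j) * y) * z)"
    and "entry_trace i j y Y * mat_unit i j z = mat_unit i j (f8_trace (Y $$ (i, j) * y) * z)"
  using f8_trace_bit[of "Y $$ (i, j) * y"] by (auto simp: entry_trace_def)

lemma basis_elt_basis_coord_const:
  assumes "p \<in> basis_index"
  shows "basis_elt p \<otimes>\<^bsub>OM\<^esub> basis_coord p (cs Y) = cs (basis_part Y p)" "basis_coord p (cs Y) \<otimes>\<^bsub>OM\<^esub> basis_elt p = cs (basis_part Y p)"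
  using assms
  by (auto elim!: basis_index_cases simp: basis_elt_def basis_coord_def basis_part_def trace_coord_const A.const_mult_const entry_trace_mult)

lemma const_expansion:
  assumes Y: "Y \<in> carrier_mat 2 2"
  shows "(\<Oplus>\<^bsub>OM\<^esub>p\<in>basis_index. basis_elt p \<otimes>\<^bsub>OM\<^esub> basis_coord p (cs Y)) = cs Y"
    and "(\<Oplus>\<^bsub>OM\<^esub>p\<in>basis_index. basis_coord p (cs Y) \<otimes>\<^bsub>OM\<^esub> basis_elt p) = cs Y"
proof -
  have sum: "(\<Oplus>\<^bsub>OM\<^esub>p\<in>basis_index. cs (basis_part Y p)) = cs Y"
    using A.const_finsum[of basis_index "basis_part Y"] entry_trace_expansion[OF Y] by simp
  have "(\<Oplus>\<^bsub>OM\<^esub>p\<in>basis_index. basis_elt p \<otimes>\<^bsub>OM\<^esub> basis_coord p (cs Y)) = (\<Oplus>\<^bsub>OM\<^esub>p\<in>basis_index. cs (basis_part Y p))"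
    "(\<Oplus>\<^bsub>OM\<^esub>p\<in>basis_index. basis_coord p (cs Y) \<otimes>\<^bsub>OM\<^esub> basis_elt p) = (\<Oplus>\<^bsub>OM\<^esub>p\<in>basis_index. cs (basis_part Y p))"
    by (intro O.add.finprod_cong'; simp add: basis_elt_basis_coord_const)+
  with sum show "(\<Oplus>\<^bsub>OM\<^esub>p\<in>basis_index. basis_elt p \<otimes>\<^bsub>OM\<^esub> basis_coord p (cs Y)) = cs Y"
    and "(\<Oplus>\<^bsub>OM\<^esub>p\<in>basis_index. basis_coord p (cs Y) \<otimes>\<^bsub>OM\<^esub> basis_elt p) = cs Y"
    by simp_all
qed

lemma basis_coord_basis_elt:
  assumes "p \<in> basis_index" "q \<in> basis_index"
  shows "basis_coord p (basis_elt q) = (if p = q then \<one>\<^bsub>OM\<^esub> else \<zero>\<^bsub>OM\<^esub>)"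
proof -
  obtain i j k where p: "p = (i, j, k)" "i < 2" "j < 2" "k < 3"
    using assms(1) by (rule basis_index_cases)
  obtain i' j' k' where q: "q = (i', j', k')" "i' < 2" "j' < 2" "k' < 3"
    using assms(2) by (rule basis_index_cases)
  show ?thesis
    using p q f8_trace_nb[of k' k]
    by (auto simp: basis_coord_def basis_elt_def trace_coord_const entry_trace_def A.ore_simps(3) simp flip: A.const_zero)
qed

text \<open>Each coefficient a_n is a sum of e_p c with c in F_2, and in e_p c x^n the scalar part
  already stands on the right. Coordinates can therefore be taken coefficient by
  coefficient.\<close>

lemma right_expansion:
  assumes "u \<in> carrier OM"
  shows "(\<Oplus>\<^bsub>OM\<^esub>p\<in>basis_index. basis_elt p \<otimes>\<^bsub>OM\<^esub> basis_coord p u) = u"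
proof -
  have "u \<in> up M2_F8" "range u \<subseteq> UNIV"
    using assms by (simp_all add: carrier_OM)
  then show ?thesis
  proof (induction rule: A.horner_induct)
    case zero
    then show ?case
      using const_expansion(1)[of "0\<^sub>m 2 2"] A.const_zero by simp
  next
    case (step a q)
    then have q: "q \<in> carrier OM"
      by (simp add: carrier_OM)
    have "basis_coord p (cs a \<oplus>\<^bsub>OM\<^esub> sh q) = basis_coord p (cs a) \<oplus>\<^bsub>OM\<^esub> (basis_coord p q \<otimes>\<^bsub>OM\<^esub> X)" if "p \<in> basis_index" for p
      using that step q by (simp add: basis_coord_add basis_coord_shift mult_X_poly_F2 basis_coord_closed sh_closed)
    then have "(\<Oplus>\<^bsub>OM\<^esub>p\<in>basis_index. basis_elt p \<otimes>\<^bsub>OM\<^esub> basis_coord p (cs a \<oplus>\<^bsub>OM\<^esub> sh q)) =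
        (\<Oplus>\<^bsub>OM\<^esub>p\<in>basis_index. (basis_elt p \<otimes>\<^bsub>OM\<^esub> basis_coord p (cs a)) \<oplus>\<^bsub>OM\<^esub> ((basis_elt p \<otimes>\<^bsub>OM\<^esub> basis_coord p q) \<otimes>\<^bsub>OM\<^esub> X))"
      using step q by (intro O.add.finprod_cong') (auto simp: O.r_distr O.m_assoc)
    also have "\<dots> = (\<Oplus>\<^bsub>OM\<^esub>p\<in>basis_index. basis_elt p \<otimes>\<^bsub>OM\<^esub> basis_coord p (cs a)) \<oplus>\<^bsub>OM\<^esub> (\<Oplus>\<^bsub>OM\<^esub>p\<in>basis_index. basis_elt p \<otimes>\<^bsub>OM\<^esub> basis_coord p q) \<otimes>\<^bsub>OM\<^esub> X"
      using step q by (simp add: O.finsum_addf Pi_def flip: O.finsum_ldistr)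
    also have "\<dots> = cs a \<oplus>\<^bsub>OM\<^esub> sh q"
      using step q by (simp add: const_expansion OM_mult_index_simps)
    finally show ?case .
  qed
qed

section \<open>Coordinates for the left module structure\<close>

definition right_coeffs_F8 :: "(nat \<Rightarrow> f8 mat) \<Rightarrow> nat \<Rightarrow> f8 mat" where
  "right_coeffs_F8 = A.right_coeffs"

lemma right_coeffs_F8_closed [simp]: "u \<in> carrier OM \<Longrightarrow> right_coeffs_F8 u \<in> carrier OM"
  by (simp add: right_coeffs_F8_def carrier_OM A.right_coeffs_up)

text \<open>The mirror image of \<open>right_expansion\<close> for sums of x^n b_n. The three
  induction cases are the three rules for \<open>right_coeffs\<close>: constants, sums and left
  multiplication by x.\<close>

lemma left_expansion:
  assumes "u \<in> carrier OM"
  shows "(\<Oplus>\<^bsub>OM\<^esub>p\<in>basis_index. basis_coord p (right_coeffs_F8 u) \<otimes>\<^bsub>OM\<^esub> basis_elt p) = u"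
proof -
  have "u \<in> up M2_F8"
    using assms by (simp add: carrier_OM)
  from this frob_sigma_surj show ?thesis
  proof (induction rule: A.ore_induct_left)
    case (const a)
    then show ?case
      by (simp add: right_coeffs_F8_def A.right_coeffs_const const_expansion)
  next
    case (add u v)
    then have uv: "u \<in> carrier OM" "v \<in> carrier OM"
      by (simp_all add: carrier_OM)
    then have "right_coeffs_F8 (u \<oplus>\<^bsub>OM\<^esub> v) = right_coeffs_F8 u \<oplus>\<^bsub>OM\<^esub> right_coeffs_F8 v"
      by (simp add: right_coeffs_F8_def carrier_OM A.right_coeffs_add)
    then have "(\<Oplus>\<^bsub>OM\<^esub>p\<in>basis_index. basis_coord p (right_coeffs_F8 (u \<oplus>\<^bsub>OM\<^esub> v)) \<otimes>\<^bsub>OM\<^esub> basis_elt p) =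
        (\<Oplus>\<^bsub>OM\<^esub>p\<in>basis_index. (basis_coord p (right_coeffs_F8 u) \<otimes>\<^bsub>OM\<^esub> basis_elt p) \<oplus>\<^bsub>OM\<^esub> (basis_coord p (right_coeffs_F8 v) \<otimes>\<^bsub>OM\<^esub> basis_elt p))"
      using uv by (intro O.add.finprod_cong') (auto simp: basis_coord_add O.l_distr)
    also have "\<dots> = u \<oplus>\<^bsub>OM\<^esub> v"
      using add uv by (simp add: O.finsum_addf Pi_def)
    finally show ?case .
  next
    case (var u)
    then have u: "u \<in> carrier OM"
      by (simp add: carrier_OM)
    then have "right_coeffs_F8 (X \<otimes>\<^bsub>OM\<^esub> u) = sh (right_coeffs_F8 u)"
      by (simp add: right_coeffs_F8_def carrier_OM A.right_coeffs_var_mult)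
    then have "(\<Oplus>\<^bsub>OM\<^esub>p\<in>basis_index. basis_coord p (right_coeffs_F8 (X \<otimes>\<^bsub>OM\<^esub> u)) \<otimes>\<^bsub>OM\<^esub> basis_elt p) =
        (\<Oplus>\<^bsub>OM\<^esub>p\<in>basis_index. X \<otimes>\<^bsub>OM\<^esub> (basis_coord p (right_coeffs_F8 u) \<otimes>\<^bsub>OM\<^esub> basis_elt p))"
      using u by (intro O.add.finprod_cong')
        (auto simp: basis_coord_shift O.m_assoc[symmetric] X_mult_poly_F2 basis_coord_closed)
    also have "\<dots> = X \<otimes>\<^bsub>OM\<^esub> u"
      using var u by (simp add: Pi_def flip: O.finsum_rdistr)
    finally show ?case .
  qed
qed

lemma right_coeffs_F8_add:
  "u \<in> carrier OM \<Longrightarrow> v \<in> carrier OM \<Longrightarrow> right_coeffs_F8 (u \<oplus>\<^bsub>OM\<^esub> v) = right_coeffs_F8 u \<oplus>\<^bsub>OM\<^esub> right_coeffs_F8 v"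
  by (simp add: right_coeffs_F8_def carrier_OM A.right_coeffs_add)

lemma basis_coord_right_coeffs_linear:
  assumes "p \<in> basis_index" "c \<in> poly_F2" "u \<in> carrier OM"
  shows "basis_coord p (right_coeffs_F8 (c \<otimes>\<^bsub>OM\<^esub> u)) = c \<otimes>\<^bsub>OM\<^esub> basis_coord p (right_coeffs_F8 u)"
proof (rule poly_F2_linear_left[where h = "\<lambda>u. basis_coord p (right_coeffs_F8 u)"])
  show "basis_coord p (right_coeffs_F8 (X \<otimes>\<^bsub>OM\<^esub> v)) = X \<otimes>\<^bsub>OM\<^esub> basis_coord p (right_coeffs_F8 v)" if "v \<in> carrier OM" for v
  proof -
    have "right_coeffs_F8 (X \<otimes>\<^bsub>OM\<^esub> v) = sh (right_coeffs_F8 v)"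
      using that by (simp add: right_coeffs_F8_def carrier_OM A.right_coeffs_var_mult)
    then show ?thesis
      using that assms by (simp add: basis_coord_shift X_mult_poly_F2 basis_coord_closed)
  qed
qed (use assms in \<open>auto simp: right_coeffs_F8_add basis_coord_add\<close>)

lemma abelian_group_ext: "abelian_group (ext_left_module OM)" "abelian_group (ext_right_module OM)"
proof -
  have "\<exists>v\<in>carrier OM. v \<oplus>\<^bsub>OM\<^esub> u = \<zero>\<^bsub>OM\<^esub>" if "u \<in> carrier OM" for u
    using that O.l_neg by blast
  then show "abelian_group (ext_left_module OM)" "abelian_group (ext_right_module OM)"
    by (auto intro!: abelian_groupI simp: ext_left_module_def ext_right_module_def O.a_ac)
qed

lemma one_neq_zero_OM: "\<one>\<^bsub>OM\<^esub> \<noteq> \<zero>\<^bsub>OM\<^esub>"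
proof
  assume "\<one>\<^bsub>OM\<^esub> = \<zero>\<^bsub>OM\<^esub>"
  then have "1\<^sub>m 2 $$ (0, 0) = (0\<^sub>m 2 2 :: f8 mat) $$ (0, 0)"
    by (metis A.ore_simps(2,3) M2_F8_simps(4,5) ore_const_def)
  then show False
    by simp
qed

lemma finsum_cong_record:
  assumes "carrier M = carrier N" "add M = add N" "\<zero>\<^bsub>M\<^esub> = \<zero>\<^bsub>N\<^esub>"
  shows "finsum M f I = finsum N f I"
  using assms by (simp add: finsum_def finprod_def)

text \<open>Coordinates are extended by zero off \<open>basis_index\<close> because the basis
  criterion asks for closure and linearity at every index, while matrix positions make sense only
  below 2.\<close>

lemma fg_projective_left_OM: "fg_projective_left_ext poly_F2 OM"
  unfolding fg_projective_left_ext_def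
proof (rule finite_basis_imp_fg_projective[where J = basis_index and e = basis_elt and coord = "\<lambda>p u. if p \<in> basis_index then basis_coord p (right_coeffs_F8 u) else \<zero>\<^bsub>OM\<^esub>"])
  fix u
  assume "u \<in> carrier (ext_left_module OM)"
  then have u: "u \<in> carrier OM"
    by (simp add: ext_left_module_def)
  have "u = (\<Oplus>\<^bsub>OM\<^esub>p\<in>basis_index. (if p \<in> basis_index then basis_coord p (right_coeffs_F8 u) else \<zero>\<^bsub>OM\<^esub>) \<otimes>\<^bsub>OM\<^esub> basis_elt p)"
    using left_expansion[OF u] u
    by (subst (asm) O.add.finprod_cong'[where g = "\<lambda>p. (if p \<in> basis_index then basis_coord p (right_coeffs_F8 u) else \<zero>\<^bsub>OM\<^esub>) \<otimes>\<^bsub>OM\<^esub> basis_elt p"])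
      auto
  then show "u = (\<Oplus>\<^bsub>ext_left_module OM\<^esub>p\<in>basis_index.
      (if p \<in> basis_index then basis_coord p (right_coeffs_F8 u) else \<zero>\<^bsub>OM\<^esub>) \<odot>\<^bsub>ext_left_module OM\<^esub> basis_elt p)"
    by (subst finsum_cong_record[of _ OM]) (simp_all add: ext_left_module_def)
next
  show "(if p \<in> basis_index then basis_coord p (right_coeffs_F8 (basis_elt q)) else \<zero>\<^bsub>OM\<^esub>) =
      (if p = q then \<one>\<^bsub>OM\<lparr>carrier := poly_F2\<rparr>\<^esub> else \<zero>\<^bsub>OM\<lparr>carrier := poly_F2\<rparr>\<^esub>)"
    if "p \<in> basis_index" "q \<in> basis_index" for p q
  proof -
    have "right_coeffs_F8 (basis_elt q) = basis_elt q"
      by (cases q) (simp add: basis_elt_def right_coeffs_F8_def A.right_coeffs_const)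
    then show ?thesis
      using that basis_coord_basis_elt by simp
  qed
qed (use ring_poly_F2 abelian_group_ext one_neq_zero_OM basis_coord_closed poly_F2_zero poly_F2_closed
    in \<open>auto simp: ext_left_module_def right_coeffs_F8_add basis_coord_add basis_coord_right_coeffs_linear\<close>)

lemma fg_projective_right_OM: "fg_projective_right_ext poly_F2 OM"
  unfolding fg_projective_right_ext_def
proof (rule finite_basis_imp_fg_projective[where J = basis_index and e = basis_elt and coord = "\<lambda>p u. if p \<in> basis_index then basis_coord p u else \<zero>\<^bsub>OM\<^esub>"])
  fix u
  assume "u \<in> carrier (ext_right_module OM)"
  then have u: "u \<in> carrier OM"
    by (simp add: ext_right_module_def)
  have "u = (\<Oplus>\<^bsub>OM\<^esub>p\<in>basis_index. basis_elt p \<otimes>\<^bsub>OM\<^esub> (if p \<in> basis_index then basis_coord p u else \<zero>\<^bsub>OM\<^esub>))"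
    using right_expansion[OF u] u
    by (subst (asm) O.add.finprod_cong'[where g = "\<lambda>p. basis_elt p \<otimes>\<^bsub>OM\<^esub> (if p \<in> basis_index then basis_coord p u else \<zero>\<^bsub>OM\<^esub>)"])
      auto
  then show "u = (\<Oplus>\<^bsub>ext_right_module OM\<^esub>p\<in>basis_index.
      (if p \<in> basis_index then basis_coord p u else \<zero>\<^bsub>OM\<^esub>) \<odot>\<^bsub>ext_right_module OM\<^esub> basis_elt p)"
    by (subst finsum_cong_record[of _ OM]) (simp_all add: ext_right_module_def)
next
  show "ring (opposite_ring (OM\<lparr>carrier := poly_F2\<rparr>))"
    by (rule ring_opposite_ring[OF ring_poly_F2])
  show "(if p \<in> basis_index then basis_coord p (basis_elt q) else \<zero>\<^bsub>OM\<^esub>) =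
      (if p = q then \<one>\<^bsub>opposite_ring (OM\<lparr>carrier := poly_F2\<rparr>)\<^esub>
       else \<zero>\<^bsub>opposite_ring (OM\<lparr>carrier := poly_F2\<rparr>)\<^esub>)"
    if "p \<in> basis_index" "q \<in> basis_index" for p q
    using that basis_coord_basis_elt by (simp add: opposite_ring_def)
  show "(if p \<in> basis_index then basis_coord p (r \<odot>\<^bsub>ext_right_module OM\<^esub> u) else \<zero>\<^bsub>OM\<^esub>) =
      r \<otimes>\<^bsub>opposite_ring (OM\<lparr>carrier := poly_F2\<rparr>)\<^esub> (if p \<in> basis_index then basis_coord p u else \<zero>\<^bsub>OM\<^esub>)"
    if "r \<in> carrier (opposite_ring (OM\<lparr>carrier := poly_F2\<rparr>))" "u \<in> carrier (ext_right_module OM)" for p r u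
    using that poly_F2_closed by (auto simp: opposite_ring_def ext_right_module_def basis_coord_right_linear)
qed (use abelian_group_ext one_neq_zero_OM basis_coord_closed poly_F2_zero poly_F2_closed
    in \<open>auto simp: opposite_ring_def ext_right_module_def basis_coord_add\<close>)

section \<open>Separability\<close>

interpretation T: tensor_setting ore_M2_F8 poly_F2
  by unfold_locales (auto intro: poly_F2_closed)

notation T.teq (infix "\<doteq>" 50)

lemma X_poly_F2: "X \<in> poly_F2"
  using X_mult_poly_F2[OF poly_F2_one] poly_F2_shift[OF poly_F2_one] by simp

lemma const_gen_add_left:
  "\<lbrakk>v \<in> carrier OM; i < 2; j < 2\<rbrakk> \<Longrightarrow>
    tensor_gen (cs (mat_unit i j (y + z))) v \<doteq> tensor_gen (cs (mat_unit i j y)) v + tensor_gen (cs (mat_unit i j z)) v"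
  using T.tensor_gen_add_left[of "cs (mat_unit i j y)" "cs (mat_unit i j z)" v]
  by (simp add: A.const_add mat_unit_add)

lemma const_gen_add_right:
  "\<lbrakk>u \<in> carrier OM; i < 2; j < 2\<rbrakk> \<Longrightarrow>
    tensor_gen u (cs (mat_unit i j (y + z))) \<doteq> tensor_gen u (cs (mat_unit i j y)) + tensor_gen u (cs (mat_unit i j z))"
  using T.tensor_gen_add_right[of u "cs (mat_unit i j y)" "cs (mat_unit i j z)"]
  by (simp add: A.const_add mat_unit_add)

abbreviation unit_tensor :: "nat \<Rightarrow> nat \<Rightarrow> f8 \<Rightarrow> f8 \<Rightarrow> ((nat \<Rightarrow> f8 mat) \<times> (nat \<Rightarrow> f8 mat)) \<Rightarrow>\<^sub>0 int" where
  "unit_tensor r s y z \<equiv> tensor_gen (cs (mat_unit r 0 y)) (cs (mat_unit 0 s z))"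

lemma unit_tensor_add_left: "r < 2 \<Longrightarrow> s < 2 \<Longrightarrow> unit_tensor r s (y + y') z \<doteq> unit_tensor r s y z + unit_tensor r s y' z"
  and unit_tensor_add_right: "r < 2 \<Longrightarrow> s < 2 \<Longrightarrow> unit_tensor r s y (z + z') \<doteq> unit_tensor r s y z + unit_tensor r s y z'"
  by (simp_all add: const_gen_add_left const_gen_add_right)

text \<open>Both tables are symmetric, since in a self-dual basis the coefficient of \<beta>_l in c
  \<beta>_k is tr(c \<beta>_k \<beta>_l). With c = 1 they cover an F_2-basis of F_8.\<close>

lemma normal_basis_mult:
  "f8_gen * normal_basis 0 = normal_basis 1" "f8_gen * normal_basis 1 = normal_basis 0 + normal_basis 2" "f8_gen * normal_basis 2 = normal_basis 1 + normal_basis 2"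
  "f8_gen ^ 2 * normal_basis 0 = normal_basis 0 + normal_basis 2" "f8_gen ^ 2 * normal_basis 1 = normal_basis 2" "f8_gen ^ 2 * normal_basis 2 = normal_basis 0 + normal_basis 1"
  by (simp_all add: normal_basis_arith ac_simps)

text \<open>The multiplication matrices of \<open>\<F>\<^sub>8\<close> in a self-dual basis are symmetric, so scalars can be
  moved across the tensor sign.\<close>

lemma unit_tensor_move:
  assumes rs: "r < 2" "s < 2"
  shows "(\<Sum>k<3. unit_tensor r s (z * normal_basis k) (normal_basis k)) \<doteq> (\<Sum>k<3. unit_tensor r s (normal_basis k) (z * normal_basis k))"
proof (induction z rule: f8_induct)
  case one
  show ?case
    by simp
next
  case gen
  have "(\<Sum>k<3. unit_tensor r s (f8_gen * normal_basis k) (normal_basis k)) \<doteq>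
      unit_tensor r s (normal_basis 1) (normal_basis 0) + (unit_tensor r s (normal_basis 0) (normal_basis 1) + unit_tensor r s (normal_basis 2) (normal_basis 1)) + (unit_tensor r s (normal_basis 1) (normal_basis 2) + unit_tensor r s (normal_basis 2) (normal_basis 2))"
    unfolding sum_lessThan_3 normal_basis_mult by (intro T.teq_add unit_tensor_add_left rs T.teq_refl)
  also have "\<dots> =
      unit_tensor r s (normal_basis 0) (normal_basis 1) + (unit_tensor r s (normal_basis 1) (normal_basis 0) + unit_tensor r s (normal_basis 1) (normal_basis 2)) + (unit_tensor r s (normal_basis 2) (normal_basis 1) + unit_tensor r s (normal_basis 2) (normal_basis 2))"
    by (simp only: ac_simps)
  also have "\<dots> \<doteq> (\<Sum>k<3. unit_tensor r s (normal_basis k) (f8_gen * normal_basis k))"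
    unfolding sum_lessThan_3 normal_basis_mult
    by (rule T.teq_sym) (intro T.teq_add unit_tensor_add_right rs T.teq_refl)
  finally show ?case .
next
  case gen2
  have "(\<Sum>k<3. unit_tensor r s (f8_gen ^ 2 * normal_basis k) (normal_basis k)) \<doteq>
      (unit_tensor r s (normal_basis 0) (normal_basis 0) + unit_tensor r s (normal_basis 2) (normal_basis 0)) + unit_tensor r s (normal_basis 2) (normal_basis 1) + (unit_tensor r s (normal_basis 0) (normal_basis 2) + unit_tensor r s (normal_basis 1) (normal_basis 2))"
    unfolding sum_lessThan_3 normal_basis_mult by (intro T.teq_add unit_tensor_add_left rs T.teq_refl)
  also have "\<dots> =
      (unit_tensor r s (normal_basis 0) (normal_basis 0) + unit_tensor r s (normal_basis 0) (normal_basis 2)) + unit_tensor r s (normal_basis 1) (normal_basis 2) + (unit_tensor r s (normal_basis 2) (normal_basis 0) + unit_tensor r s (normal_basis 2) (normal_basis 1))"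
    by (simp only: ac_simps)
  also have "\<dots> \<doteq> (\<Sum>k<3. unit_tensor r s (normal_basis k) (f8_gen ^ 2 * normal_basis k))"
    unfolding sum_lessThan_3 normal_basis_mult
    by (rule T.teq_sym) (intro T.teq_add unit_tensor_add_right rs T.teq_refl)
  finally show ?case .
next
  case (add y z)
  have "(\<Sum>k<3. unit_tensor r s ((y + z) * normal_basis k) (normal_basis k)) \<doteq>
      (\<Sum>k<3. unit_tensor r s (y * normal_basis k) (normal_basis k) + unit_tensor r s (z * normal_basis k) (normal_basis k))"
    unfolding distrib_right by (intro T.teq_sum unit_tensor_add_left rs)
  also have "\<dots> \<doteq> (\<Sum>k<3. unit_tensor r s (normal_basis k) (y * normal_basis k)) + (\<Sum>k<3. unit_tensor r s (normal_basis k) (z * normal_basis k))"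
    unfolding sum.distrib by (intro T.teq_add add)
  also have "\<dots> \<doteq> (\<Sum>k<3. unit_tensor r s (normal_basis k) ((y + z) * normal_basis k))"
    unfolding distrib_right sum.distrib[symmetric]
    by (intro T.teq_sym[OF T.teq_sum] unit_tensor_add_right rs)
  finally show ?case .
qed

definition separability_elt :: "((nat \<Rightarrow> f8 mat) \<times> (nat \<Rightarrow> f8 mat)) \<Rightarrow>\<^sub>0 int" where
  "separability_elt = (\<Sum>i<2. \<Sum>k<3. unit_tensor i i (normal_basis k) (normal_basis k))"

lemma separability_elt_eq:
  "separability_elt = (\<Sum>p\<in>{..<2} \<times> {..<3}. tensor_gen (cs (mat_unit (fst p) 0 (normal_basis (snd p)))) (cs (mat_unit 0 (fst p) (normal_basis (snd p)))))"
  by (simp add: separability_elt_def sum.cartesian_product split_def)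

lemma keys_sep: "Poly_Mapping.keys separability_elt \<subseteq> T.S"
  unfolding separability_elt_eq by (rule T.keys_sum_tensor_gen) auto

lemma lact_sep:
  "T.lact b separability_elt = (\<Sum>i<2. \<Sum>k<3. tensor_gen (b \<otimes>\<^bsub>OM\<^esub> cs (mat_unit i 0 (normal_basis k))) (cs (mat_unit 0 i (normal_basis k))))"
  "T.ract b separability_elt = (\<Sum>i<2. \<Sum>k<3. tensor_gen (cs (mat_unit i 0 (normal_basis k))) (cs (mat_unit 0 i (normal_basis k)) \<otimes>\<^bsub>OM\<^esub> b))"
  unfolding separability_elt_eq
  by (subst T.lact_sum; simp add: sum.cartesian_product split_def)+

lemma sum_lessThan_2: "sum f {..<2::nat} = f 0 + (f 1 :: 'a :: comm_monoid_add)"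
  by (simp add: numeral_2_eq_2)

lemma zero_gen:
  "v \<in> carrier OM \<Longrightarrow> tensor_gen (cs (0\<^sub>m 2 2)) v \<doteq> 0"
  "u \<in> carrier OM \<Longrightarrow> tensor_gen u (cs (0\<^sub>m 2 2)) \<doteq> 0"
  using T.tensor_gen_zero_left[of v] T.tensor_gen_zero_right[of u] A.const_zero by simp_all

abbreviation central :: "(nat \<Rightarrow> f8 mat) \<Rightarrow> bool" where
  "central b \<equiv> T.lact b separability_elt \<doteq> T.ract b separability_elt"

lemma central_add: "\<lbrakk>b \<in> carrier OM; c \<in> carrier OM; central b; central c\<rbrakk> \<Longrightarrow> central (b \<oplus>\<^bsub>OM\<^esub> c)"
  unfolding T.teq_def by (rule T.commutes_add[OF keys_sep])

lemma central_mult: "\<lbrakk>b \<in> carrier OM; c \<in> carrier OM; central b; central c\<rbrakk> \<Longrightarrow> central (b \<otimes>\<^bsub>OM\<^esub> c)"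
  unfolding T.teq_def by (rule T.commutes_mult[OF keys_sep])

text \<open>Left multiplication by z E_rs keeps only the summands with i = s, right multiplication
  only those with i = r. Both leave tensors of E_r1 with E_1s that differ in which factor carries z,
  and \<open>unit_tensor_move\<close> settles this.\<close>

lemma central_mat_unit:
  assumes rs: "r < 2" "s < 2"
  shows "central (cs (mat_unit r s z))"
proof -
  have "T.lact (cs (mat_unit r s z)) separability_elt \<doteq>
      (\<Sum>i<2. if i = s then (\<Sum>k<3. unit_tensor r s (z * normal_basis k) (normal_basis k)) else 0)"
    unfolding lact_sep
  proof (intro T.teq_sum)
    fix i :: nat
    assume "i \<in> {..<2}"
    then have i: "i < 2"
      by simp
    show "(\<Sum>k<3. tensor_gen (cs (mat_unit r s z) \<otimes>\<^bsub>OM\<^esub> cs (mat_unit i 0 (normal_basis k))) (cs (mat_unit 0 i (normal_basis k)))) \<doteq>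
        (if i = s then (\<Sum>k<3. unit_tensor r s (z * normal_basis k) (normal_basis k)) else 0)"
    proof (cases "i = s")
      case True
      then show ?thesis
        using rs by (simp add: A.const_mult_const mat_unit_mult)
    next
      case False
      have "(\<Sum>k<3. tensor_gen (cs (mat_unit r s z) \<otimes>\<^bsub>OM\<^esub> cs (mat_unit i 0 (normal_basis k))) (cs (mat_unit 0 i (normal_basis k)))) \<doteq> (\<Sum>k<(3::nat). 0)"
        using False rs i by (intro T.teq_sum) (simp add: A.const_mult_const mat_unit_mult zero_gen)
      with False show ?thesis
        by simp
    qed
  qed
  also have "\<dots> = (\<Sum>k<3. unit_tensor r s (z * normal_basis k) (normal_basis k))"
    using rs by simp
  also have "\<dots> \<doteq> (\<Sum>k<3. unit_tensor r s (normal_basis k) (z * normal_basis k))"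
    by (rule unit_tensor_move[OF rs])
  also have "\<dots> = (\<Sum>i<2. if i = r then (\<Sum>k<3. unit_tensor r s (normal_basis k) (z * normal_basis k)) else 0)"
    using rs by simp
  also have "\<dots> \<doteq> T.ract (cs (mat_unit r s z)) separability_elt"
    unfolding lact_sep
  proof (intro T.teq_sum T.teq_sym[OF T.teq_sum])
    fix i :: nat
    assume "i \<in> {..<2}"
    then have i: "i < 2"
      by simp
    show "(if i = r then (\<Sum>k<3. unit_tensor r s (normal_basis k) (z * normal_basis k)) else 0) \<doteq>
      (\<Sum>k<3. tensor_gen (cs (mat_unit i 0 (normal_basis k))) (cs (mat_unit 0 i (normal_basis k)) \<otimes>\<^bsub>OM\<^esub> cs (mat_unit r s z)))"
    proof (cases "i = r")
      case True
      then show ?thesis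
        using rs by (simp add: A.const_mult_const mat_unit_mult mult.commute)
    next
      case False
      have "(\<Sum>k<3. tensor_gen (cs (mat_unit i 0 (normal_basis k))) (cs (mat_unit 0 i (normal_basis k)) \<otimes>\<^bsub>OM\<^esub> cs (mat_unit r s z))) \<doteq> (\<Sum>k<(3::nat). 0)"
        using False rs i by (intro T.teq_sum) (simp add: A.const_mult_const mat_unit_mult zero_gen)
      with False show ?thesis
        by (simp add: T.teq_sym)
    qed
  qed
  finally show ?thesis .
qed

lemma central_const:
  assumes Y: "Y \<in> carrier_mat 2 2"
  shows "central (cs Y)"
proof -
  have eq: "cs Y = (cs (mat_unit 0 0 (Y $$ (0, 0))) \<oplus>\<^bsub>OM\<^esub> cs (mat_unit 0 1 (Y $$ (0, 1)))) \<oplus>\<^bsub>OM\<^esub>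
      (cs (mat_unit 1 0 (Y $$ (1, 0))) \<oplus>\<^bsub>OM\<^esub> cs (mat_unit 1 1 (Y $$ (1, 1))))"
    using mat_unit_expansion[OF Y] by (simp add: A.const_add)
  have "central ((cs (mat_unit 0 0 (Y $$ (0, 0))) \<oplus>\<^bsub>OM\<^esub> cs (mat_unit 0 1 (Y $$ (0, 1)))) \<oplus>\<^bsub>OM\<^esub>
      (cs (mat_unit 1 0 (Y $$ (1, 0))) \<oplus>\<^bsub>OM\<^esub> cs (mat_unit 1 1 (Y $$ (1, 1)))))"
    by (intro central_add central_mat_unit) auto
  then show ?thesis
    by (simp only: eq[symmetric])
qed

text \<open>As \<open>\<sigma> \<otimes> \<sigma>\<close> permutes the summands of \<open>separability_elt\<close>, only the contribution of \<open>\<delta>\<close> matters in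
  \<open>x separability_elt - separability_elt x\<close>, and it is \<open>M separability_elt - separability_elt M\<close>.\<close>

lemma central_X: "central X"
proof -
  have X_term: "tensor_gen (X \<otimes>\<^bsub>OM\<^esub> cs (mat_unit i 0 y)) (cs (mat_unit 0 i y)) \<doteq>
      tensor_gen (cs (mat_unit i 0 (y ^ 2))) (cs (mat_unit 0 i (y ^ 2)) \<otimes>\<^bsub>OM\<^esub> X) + unit_tensor i i (y ^ 2) (delta_diag i * y ^ 2) + unit_tensor i i (delta_diag i * y) y"
    if i: "i < 2" for i y
  proof -
    \<comment> \<open>Of the two terms of \<delta>(y E_i1), the one with the first diagonal entry of
      M is zero.\<close>
    have "X \<otimes>\<^bsub>OM\<^esub> cs (mat_unit i 0 y) = cs (mat_unit i 0 (y ^ 2)) \<otimes>\<^bsub>OM\<^esub> X \<oplus>\<^bsub>OM\<^esub> cs (mat_unit i 0 (delta_diag i * y))"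
      using i by (simp add: A.var_const frob_sigma_mat_unit inner_delta_mat_unit) (simp add: delta_diag_def)
    then have "tensor_gen (X \<otimes>\<^bsub>OM\<^esub> cs (mat_unit i 0 y)) (cs (mat_unit 0 i y)) \<doteq>
        tensor_gen (cs (mat_unit i 0 (y ^ 2)) \<otimes>\<^bsub>OM\<^esub> X) (cs (mat_unit 0 i y)) + unit_tensor i i (delta_diag i * y) y"
      using T.tensor_gen_add_left by simp
    \<comment> \<open>As x belongs to F_2[x], it crosses the tensor sign; the commutation rule then
      carries it to the far right.\<close>
    also have "\<dots> \<doteq> tensor_gen (cs (mat_unit i 0 (y ^ 2))) (X \<otimes>\<^bsub>OM\<^esub> cs (mat_unit 0 i y)) + unit_tensor i i (delta_diag i * y) y"
      by (intro T.teq_add T.teq_refl T.tensor_gen_balanced X_poly_F2) auto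
    also have "X \<otimes>\<^bsub>OM\<^esub> cs (mat_unit 0 i y) = cs (mat_unit 0 i (y ^ 2)) \<otimes>\<^bsub>OM\<^esub> X \<oplus>\<^bsub>OM\<^esub> cs (mat_unit 0 i (delta_diag i * y ^ 2))"
      using i by (simp add: A.var_const frob_sigma_mat_unit inner_delta_mat_unit mult.commute) (simp add: delta_diag_def)
    also have "tensor_gen (cs (mat_unit i 0 (y ^ 2))) (cs (mat_unit 0 i (y ^ 2)) \<otimes>\<^bsub>OM\<^esub> X \<oplus>\<^bsub>OM\<^esub> cs (mat_unit 0 i (delta_diag i * y ^ 2))) + unit_tensor i i (delta_diag i * y) y \<doteq>
       (tensor_gen (cs (mat_unit i 0 (y ^ 2))) (cs (mat_unit 0 i (y ^ 2)) \<otimes>\<^bsub>OM\<^esub> X) + unit_tensor i i (y ^ 2) (delta_diag i * y ^ 2)) + unit_tensor i i (delta_diag i * y) y"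
      by (intro T.teq_add T.teq_refl T.tensor_gen_add_right) auto
    finally show ?thesis .
  qed
  have cycle: "(\<Sum>k<3. f (normal_basis k ^ 2)) = (\<Sum>k<3. f (normal_basis k))" for f :: "f8 \<Rightarrow> (nat \<Rightarrow> f8 mat) \<times> (nat \<Rightarrow> f8 mat) \<Rightarrow>\<^sub>0 int"
    using normal_basis_square[of 0] normal_basis_square[of 1] normal_basis_square[of 2] numeral_2_eq_2[symmetric]
    by (simp add: sum_lessThan_3 ac_simps del: One_nat_def)
  have char2: "unit_tensor i i y z + unit_tensor i i y z \<doteq> 0" if "i < 2" for i y z
  proof -
    have "unit_tensor i i y z + unit_tensor i i y z \<doteq> unit_tensor i i (y + y) z"
      by (rule T.teq_sym[OF unit_tensor_add_left[OF that that]])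
    also have "\<dots> \<doteq> 0"
      by (simp add: f8_add_self zero_gen)
    finally show ?thesis .
  qed
  have "T.lact X separability_elt \<doteq> (\<Sum>i<2. \<Sum>k<3. tensor_gen (cs (mat_unit i 0 (normal_basis k))) (cs (mat_unit 0 i (normal_basis k)) \<otimes>\<^bsub>OM\<^esub> X))"
    unfolding lact_sep
  proof (rule T.teq_sum)
    fix i :: nat
    assume "i \<in> {..<2}"
    then have i: "i < 2"
      by simp
    let ?R = "\<Sum>k<3. tensor_gen (cs (mat_unit i 0 (normal_basis k))) (cs (mat_unit 0 i (normal_basis k)) \<otimes>\<^bsub>OM\<^esub> X)"
    have "(\<Sum>k<3. tensor_gen (X \<otimes>\<^bsub>OM\<^esub> cs (mat_unit i 0 (normal_basis k))) (cs (mat_unit 0 i (normal_basis k)))) \<doteq>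
        (\<Sum>k<3. tensor_gen (cs (mat_unit i 0 (normal_basis k ^ 2))) (cs (mat_unit 0 i (normal_basis k ^ 2)) \<otimes>\<^bsub>OM\<^esub> X) +
          unit_tensor i i (normal_basis k ^ 2) (delta_diag i * normal_basis k ^ 2) + unit_tensor i i (delta_diag i * normal_basis k) (normal_basis k))"
      using i by (intro T.teq_sum X_term)
    also have "\<dots> = ?R + (\<Sum>k<3. unit_tensor i i (normal_basis k) (delta_diag i * normal_basis k)) + (\<Sum>k<3. unit_tensor i i (delta_diag i * normal_basis k) (normal_basis k))"
      using cycle[of "\<lambda>y. tensor_gen (cs (mat_unit i 0 y)) (cs (mat_unit 0 i y) \<otimes>\<^bsub>OM\<^esub> X)"]
        cycle[of "\<lambda>y. unit_tensor i i y (delta_diag i * y)"] by (simp add: sum.distrib)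
    \<comment> \<open>Moving the diagonal entry of M across makes the two \<delta>-contributions
      equal, so they cancel in characteristic 2.\<close>
    also have "\<dots> \<doteq> ?R + (\<Sum>k<3. unit_tensor i i (normal_basis k) (delta_diag i * normal_basis k)) + (\<Sum>k<3. unit_tensor i i (normal_basis k) (delta_diag i * normal_basis k))"
      using i by (intro T.teq_add T.teq_refl unit_tensor_move)
    also have "\<dots> = ?R + (\<Sum>k<3. unit_tensor i i (normal_basis k) (delta_diag i * normal_basis k) + unit_tensor i i (normal_basis k) (delta_diag i * normal_basis k))"
      by (simp add: sum.distrib add.assoc)
    also have "\<dots> \<doteq> ?R + (\<Sum>k<(3::nat). 0)"
      using i by (intro T.teq_add T.teq_refl T.teq_sum char2)
    finally show "(\<Sum>k<3. tensor_gen (X \<otimes>\<^bsub>OM\<^esub> cs (mat_unit i 0 (normal_basis k))) (cs (mat_unit 0 i (normal_basis k)))) \<doteq> ?R"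
      by simp
  qed
  then show ?thesis
    by (simp add: lact_sep)
qed

lemma mu_sep: "T.mu separability_elt = \<one>\<^bsub>OM\<^esub>"
proof -
  let ?I = "{..<2::nat} \<times> {..<3::nat}"
  have "T.mu separability_elt = (\<Oplus>\<^bsub>OM\<^esub>p\<in>?I. cs (mat_unit (fst p) 0 (normal_basis (snd p))) \<otimes>\<^bsub>OM\<^esub> cs (mat_unit 0 (fst p) (normal_basis (snd p))))"
    unfolding separability_elt_eq by (rule T.mu_sum) auto
  also have "\<dots> = (\<Oplus>\<^bsub>OM\<^esub>p\<in>?I. cs (mat_unit (fst p) (fst p) (normal_basis (snd p) * normal_basis (snd p))))"
    by (intro O.add.finprod_cong') (auto simp: A.const_mult_const mat_unit_mult)
  also have "\<dots> = cs (\<Oplus>\<^bsub>M2_F8\<^esub>p\<in>?I. mat_unit (fst p) (fst p) (normal_basis (snd p) * normal_basis (snd p)))"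
    by (rule A.const_finsum) auto
  also have "(\<Oplus>\<^bsub>M2_F8\<^esub>p\<in>?I. mat_unit (fst p) (fst p) (normal_basis (snd p) * normal_basis (snd p))) = 1\<^sub>m 2"
  proof (subst M2_F8_finsum)
    have "(\<Sum>p\<in>?I. mat_unit (fst p) (fst p) (normal_basis (snd p) * normal_basis (snd p)) $$ (r, s)) = (if r = s then 1 else 0)"
      if "r < 2" "s < 2" for r s
    proof -
      have "(\<Sum>p\<in>?I. mat_unit (fst p) (fst p) (normal_basis (snd p) * normal_basis (snd p)) $$ (r, s)) =
          (\<Sum>i<2. \<Sum>k<3. mat_unit i i (normal_basis k * normal_basis k) $$ (r, s))"
        by (simp add: sum.cartesian_product split_def)
      also have "\<dots> = (\<Sum>i<2. if i = r \<and> i = s then 1 else 0)"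
        using that sum_nb_square by (intro sum.cong) (auto intro!: sum.neutral)
      also have "\<dots> = (if r = s then 1 else 0)"
        using that by (auto simp: sum_lessThan_2 less_2_cases_iff)
      finally show ?thesis .
    qed
    then show "mat 2 2 (\<lambda>q. \<Sum>p\<in>?I. mat_unit (fst p) (fst p) (normal_basis (snd p) * normal_basis (snd p)) $$ q) = 1\<^sub>m 2"
      by (intro eq_matI) auto
  qed auto
  finally show ?thesis
    by (simp add: A.ore_simps(3))
qed

lemma separable_OM: "separable_extension poly_F2 OM"
proof (rule T.separable_extensionI[OF keys_sep _ mu_sep])
  fix b
  assume "b \<in> carrier OM"
  then have "b \<in> up M2_F8"
    by (simp add: carrier_OM)
  from this frob_sigma_surj have "central b"
  proof (induction rule: A.ore_induct_left)
    case (const a)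
    then show ?case
      by (simp add: central_const)
  next
    case (add p q)
    then show ?case
      by (intro central_add) (simp_all add: carrier_OM)
  next
    case (var p)
    then show ?case
      by (intro central_mult central_X X_closed) (simp_all add: carrier_OM)
  qed
  then show "T.lact b separability_elt - T.ract b separability_elt \<in> T.T"
    by (simp add: T.teq_def)
qed

section \<open>Failure of the Frobenius property\<close>

text \<open>Evaluation of \<open>\<F>\<^sub>2[x]\<close> at \<open>a\<^sup>2\<close>, the root of \<open>x\<^sup>3 + x\<^sup>2 + 1\<close> at which every bimodule morphism
  into \<open>\<F>\<^sub>2[x]\<close> degenerates.\<close>

definition eval_root :: "(nat \<Rightarrow> f8 mat) \<Rightarrow> f8" where
  "eval_root c = (\<Sum>n\<in>{n. c n \<noteq> 0\<^sub>m 2 2}. c n $$ (0, 0) * (f8_gen ^ 2) ^ n)"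

lemma eval_root_bound:
  assumes "\<forall>n>N. c n = 0\<^sub>m 2 2"
  shows "eval_root c = (\<Sum>n\<le>N. c n $$ (0, 0) * (f8_gen ^ 2) ^ n)"
  unfolding eval_root_def
  by (rule sum.mono_neutral_left) (use assms in \<open>auto simp: not_le[symmetric]\<close>)

lemma OM_bound:
  assumes "c \<in> carrier OM"
  obtains N where "\<forall>n>N. c n = 0\<^sub>m 2 2"
proof -
  have "\<exists>N. bound (0\<^sub>m 2 2) N c"
    using A.bound_upD[of c] assms by (simp add: carrier_OM)
  then show ?thesis
    using that by (auto simp: bound_def)
qed

lemma eval_root_add:
  assumes "c \<in> carrier OM" "d \<in> carrier OM"
  shows "eval_root (c \<oplus>\<^bsub>OM\<^esub> d) = eval_root c + eval_root d"
proof -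
  obtain N where N: "\<forall>n>N. c n = 0\<^sub>m 2 2"
    using assms(1) by (rule OM_bound)
  obtain M where M: "\<forall>n>M. d n = 0\<^sub>m 2 2"
    using assms(2) by (rule OM_bound)
  have cd: "c n \<in> carrier_mat 2 2" "d n \<in> carrier_mat 2 2" for n
    using assms by (simp_all add: OM_carrier_index)
  have "eval_root c = (\<Sum>n\<le>max N M. c n $$ (0, 0) * (f8_gen ^ 2) ^ n)"
    "eval_root d = (\<Sum>n\<le>max N M. d n $$ (0, 0) * (f8_gen ^ 2) ^ n)"
    "eval_root (c \<oplus>\<^bsub>OM\<^esub> d) = (\<Sum>n\<le>max N M. (c n + d n) $$ (0, 0) * (f8_gen ^ 2) ^ n)"
    using N M by (subst eval_root_bound[of "max N M"]; simp add: A.ore_simps(4))+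
  moreover have "(c n + d n) $$ (0, 0) = c n $$ (0, 0) + d n $$ (0, 0)" for n
    using cd[of n] by simp
  ultimately show ?thesis
    by (simp only: distrib_right sum.distrib)
qed

text \<open>On F_2[x] the shift is multiplication by x from either side, so after evaluation both
  bimodule rules for x become multiplication by the scalar a^2.\<close>

lemma eval_root_shift:
  assumes "c \<in> carrier OM"
  shows "eval_root (sh c) = f8_gen ^ 2 * eval_root c"
proof -
  obtain N where N: "\<forall>n>N. c n = 0\<^sub>m 2 2"
    using assms(1) by (rule OM_bound)
  have "\<forall>n>Suc N. sh c n = 0\<^sub>m 2 2"
    using N by (auto simp: ore_shift_def split: nat.splits)
  then have "eval_root (sh c) = (\<Sum>n\<le>Suc N. sh c n $$ (0, 0) * (f8_gen ^ 2) ^ n)"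
    by (rule eval_root_bound)
  also have "\<dots> = (\<Sum>n\<le>N. f8_gen ^ 2 * (c n $$ (0, 0) * (f8_gen ^ 2) ^ n))"
    by (subst sum.atMost_Suc_shift) (simp add: ore_shift_def ac_simps)
  also have "\<dots> = f8_gen ^ 2 * eval_root c"
    unfolding eval_root_bound[OF N] by (rule sum_distrib_left[symmetric])
  finally show ?thesis .
qed

lemma eval_root_const: "eval_root (cs Y) = Y $$ (0, 0)"
  by (subst eval_root_bound[of 0]) (auto simp: ore_const_def)

section \<open>Additive maps on F_8 subject to the commutation rule at a^2\<close>

lemma f8_gen_power_mult_left:
  "f8_gen * (f8_gen * y) = f8_gen ^ 2 * y" "f8_gen * (f8_gen ^ 2 * y) = y + f8_gen ^ 2 * y"
  "f8_gen ^ 2 * (f8_gen * y) = y + f8_gen ^ 2 * y" "f8_gen ^ 2 * (f8_gen ^ 2 * y) = y + f8_gen * y + f8_gen ^ 2 * y"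
  by (simp_all only: mult.assoc[symmetric] f8_gen_power_mult distrib_right mult_1)

lemmas f8_linear = f8_gen_power_mult_left f8_gen_powers(1,2) distrib_left distrib_right f8_add_self ac_simps

lemma f8_gen_nonzero: "f8_gen \<noteq> 0"
  using f8_gen_powers(5) by auto

lemma one_add_gen2_nonzero: "1 + f8_gen ^ 2 \<noteq> 0"
  using f8_gen_nonzero f8_gen_powers(1) by (metis power_eq_0_iff)

lemma f8_eq_iff_add: "x = y \<longleftrightarrow> x + y = (0 :: f8)"
  by (metis f8_diff eq_iff_diff_eq_0)

text \<open>The solutions form a line over F_8. At z = 1 the relation is void, since a + a = 0; z =
  a and z = a^2 give two equations expressing f(a) and f(1) through f(a^2), and values on the basis
  1, a, a^2 suffice.\<close>

lemma f8_diagonal_relation: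
  fixes f :: "f8 \<Rightarrow> f8"
  assumes add: "\<And>y z. f (y + z) = f y + f z"
    and rel: "\<And>z. f8_gen ^ 2 * f z = f8_gen ^ 2 * f (z ^ 2) + f (f8_gen * z + z ^ 2 * f8_gen)"
  shows "f z = f 1 * z ^ 2"
proof -
  let ?a = f8_gen
  have "f (?a + ?a) = f ?a + f ?a"
    by (rule add)
  then have f0: "f 0 = 0"
    by (simp add: f8_add_self)
  have 1: "?a ^ 2 * f ?a = ?a ^ 2 * f (?a ^ 2) + f 1"
    using rel[of ?a] f0 by (simp add: f8_gen_power_mult add ac_simps flip: power2_eq_square)
  have 2: "?a ^ 2 * f (?a ^ 2) = ?a ^ 2 * (f 1 + f ?a + f (?a ^ 2)) + (f ?a + f (?a ^ 2))"
  proof -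
    have "(?a ^ 2) ^ 2 = 1 + ?a + ?a ^ 2"
      by (simp add: f8_gen_powers flip: power_mult)
    then show ?thesis
      using rel[of "?a ^ 2"] f0 by (simp add: f8_gen_power_mult add ac_simps distrib_left distrib_right)
  qed
  have f1: "f 1 = ?a ^ 2 * f ?a + ?a ^ 2 * f (?a ^ 2)"
    unfolding 1 by (simp add: f8_linear)
  \<comment> \<open>Substituting f(1) turns equation \<open>2\<close> into a times the desired
    relation; a is cancelled afterwards.\<close>
  have "?a * (f ?a + (f (?a ^ 2) + ?a * f (?a ^ 2))) =
      ?a ^ 2 * f (?a ^ 2) + (?a ^ 2 * (f 1 + f ?a + f (?a ^ 2)) + (f ?a + f (?a ^ 2)))"
    unfolding f1 by (simp add: f8_linear)
  also have "\<dots> = 0"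
    unfolding 2[symmetric] by (rule f8_add_self)
  finally have fa: "f ?a = f (?a ^ 2) + ?a * f (?a ^ 2)"
    using f8_gen_nonzero by (simp add: f8_eq_iff_add[of "f ?a"])
  have f1': "f 1 = f (?a ^ 2) + ?a ^ 2 * f (?a ^ 2)"
    unfolding f1 fa by (simp add: f8_linear)
  show ?thesis
  proof (rule f8_additive_eq[of f "\<lambda>z. f 1 * z ^ 2"])
    show "f ?a = f 1 * ?a ^ 2"
      unfolding f1' fa by (simp add: f8_linear)
    have "(?a ^ 2) ^ 2 = 1 + ?a + ?a ^ 2"
      by (simp add: f8_gen_powers flip: power_mult)
    then show "f (?a ^ 2) = f 1 * (?a ^ 2) ^ 2"
      unfolding f1' by (simp add: f8_linear)
  qed (simp_all add: add f8_square_add distrib_left)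
qed

text \<open>For g(z) = d0 z + d1 z^2 + d2 z^4 and t = a^2 the relation says t d2 = (t + a^2) d1 = 0,
  t d0 = (t + a^4) d2 and t d1 = (t + a) d0, so everything vanishes. The proof argues on 1, a, a^2
  instead, where z = 1 already gives g(a) = 0.\<close>

lemma f8_off_diagonal_relation:
  fixes g :: "f8 \<Rightarrow> f8"
  assumes add: "\<And>y z. g (y + z) = g y + g z"
    and rel: "\<And>z. f8_gen ^ 2 * g z = f8_gen ^ 2 * g (z ^ 2) + g (z ^ 2 * f8_gen)"
  shows "g z = 0"
proof -
  let ?a = f8_gen
  have ga: "g ?a = 0"
    using rel[of 1] by simp
  have 1: "g 1 + (1 + ?a ^ 2) * g (?a ^ 2) = 0"
    using rel[of ?a] ga by (simp add: f8_gen_power_mult add f8_linear)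
  have "?a ^ 2 * g (?a ^ 2) = ?a ^ 2 * (g 1 + g (?a ^ 2)) + g 1"
  proof -
    have "(?a ^ 2) ^ 2 = 1 + ?a + ?a ^ 2" "(1 + ?a + ?a ^ 2) * ?a = 1 + ?a"
      by (simp_all add: f8_gen_powers f8_gen_power_mult f8_linear flip: power_mult)
    then show ?thesis
      using rel[of "?a ^ 2"] ga by (simp add: add)
  qed
  then have "(1 + ?a ^ 2) * g 1 = 0"
    by (simp add: distrib_left distrib_right ac_simps)
  then have g1: "g 1 = 0"
    using one_add_gen2_nonzero by simp
  then have "g (?a ^ 2) = 0"
    using 1 one_add_gen2_nonzero by simp
  then show ?thesis
    using f8_additive_eq[of g "\<lambda>_. 0" z] add ga g1 by simp
qed

text \<open>For constant b, the product b z E22 consists of b_12 z E12, where \<chi> vanishes at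
  a^2, and b_22 z E22, where \<kappa> is only rescaled by b_22^2. A further left factor x rescales
  \<kappa> by a^2.\<close>

lemma bimodule_morphism_degenerate:
  assumes \<chi>: "\<chi> \<in> carrier OM \<rightarrow> poly_F2"
    and add: "\<And>u v. u \<in> carrier OM \<Longrightarrow> v \<in> carrier OM \<Longrightarrow> \<chi> (u \<oplus>\<^bsub>OM\<^esub> v) = \<chi> u \<oplus>\<^bsub>OM\<^esub> \<chi> v"
    and left: "\<And>u. u \<in> carrier OM \<Longrightarrow> \<chi> (X \<otimes>\<^bsub>OM\<^esub> u) = X \<otimes>\<^bsub>OM\<^esub> \<chi> u"
    and right: "\<And>u. u \<in> carrier OM \<Longrightarrow> \<chi> (u \<otimes>\<^bsub>OM\<^esub> X) = \<chi> u \<otimes>\<^bsub>OM\<^esub> X"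
    and b: "b \<in> carrier OM"
  shows "\<exists>\<kappa>. \<forall>z. eval_root (\<chi> (b \<otimes>\<^bsub>OM\<^esub> cs (mat_unit 1 1 z))) = \<kappa> * z ^ 2"
proof -
  define \<psi> where "\<psi> u = eval_root (\<chi> u)" for u
  have \<chi>': "\<chi> u \<in> poly_F2" "\<chi> u \<in> carrier OM" if "u \<in> carrier OM" for u
    using that \<chi> poly_F2_closed by blast+
  have \<psi>_add: "\<psi> (u \<oplus>\<^bsub>OM\<^esub> v) = \<psi> u + \<psi> v" if "u \<in> carrier OM" "v \<in> carrier OM" for u v
    using that by (simp add: \<psi>_def add eval_root_add \<chi>')
  have \<psi>_left: "\<psi> (X \<otimes>\<^bsub>OM\<^esub> u) = f8_gen ^ 2 * \<psi> u" if "u \<in> carrier OM" for u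
    using that by (simp add: \<psi>_def left X_mult_poly_F2 eval_root_shift \<chi>')
  have \<psi>_right: "\<psi> (u \<otimes>\<^bsub>OM\<^esub> X) = f8_gen ^ 2 * \<psi> u" if "u \<in> carrier OM" for u
    using that by (simp add: \<psi>_def right mult_X_poly_F2 eval_root_shift \<chi>')
  have \<psi>_E_add: "\<psi> (cs (mat_unit i 1 (y + z))) = \<psi> (cs (mat_unit i 1 y)) + \<psi> (cs (mat_unit i 1 z))" for i y z
    using \<psi>_add[of "cs (mat_unit i 1 y)" "cs (mat_unit i 1 z)"] by (simp add: A.const_add mat_unit_add)
  \<comment> \<open>This comes from x z E_i2 = z^2 E_i2 x + \<delta>(z E_i2), where both factors x
    turn into the scalar a^2.\<close>
  have rel: "f8_gen ^ 2 * \<psi> (cs (mat_unit i 1 z)) =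
      f8_gen ^ 2 * \<psi> (cs (mat_unit i 1 (z ^ 2))) + \<psi> (cs (mat_unit i 1 (delta_diag i * z + z ^ 2 * delta_diag 1)))"
    if "i < 2" for i z
  proof -
    have "f8_gen ^ 2 * \<psi> (cs (mat_unit i 1 z)) = \<psi> (X \<otimes>\<^bsub>OM\<^esub> cs (mat_unit i 1 z))"
      by (simp add: \<psi>_left)
    also have "X \<otimes>\<^bsub>OM\<^esub> cs (mat_unit i 1 z) =
        cs (mat_unit i 1 (z ^ 2)) \<otimes>\<^bsub>OM\<^esub> X \<oplus>\<^bsub>OM\<^esub> cs (mat_unit i 1 (delta_diag i * z + z ^ 2 * delta_diag 1))"
      using that by (simp add: A.var_const frob_sigma_mat_unit inner_delta_mat_unit)
    finally show ?thesis
      by (simp add: \<psi>_add \<psi>_right)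
  qed
  have f: "\<psi> (cs (mat_unit 1 1 z)) = \<psi> (cs (mat_unit 1 1 1)) * z ^ 2" for z
  proof (rule f8_diagonal_relation[where f = "\<lambda>z. \<psi> (cs (mat_unit 1 1 z))"])
    show "f8_gen ^ 2 * \<psi> (cs (mat_unit 1 1 z)) =
        f8_gen ^ 2 * \<psi> (cs (mat_unit 1 1 (z ^ 2))) + \<psi> (cs (mat_unit 1 1 (f8_gen * z + z ^ 2 * f8_gen)))" for z
      using rel[of 1 z] by (simp add: delta_diag_def)
  qed (rule \<psi>_E_add)
  have g: "\<psi> (cs (mat_unit 0 1 z)) = 0" for z
  proof (rule f8_off_diagonal_relation[where g = "\<lambda>z. \<psi> (cs (mat_unit 0 1 z))"])
    show "f8_gen ^ 2 * \<psi> (cs (mat_unit 0 1 z)) =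
        f8_gen ^ 2 * \<psi> (cs (mat_unit 0 1 (z ^ 2))) + \<psi> (cs (mat_unit 0 1 (z ^ 2 * f8_gen)))" for z
      using rel[of 0 z] by (simp add: delta_diag_def)
  qed (rule \<psi>_E_add)
  have "b \<in> up M2_F8"
    using b by (simp add: carrier_OM)
  from this frob_sigma_surj have "\<exists>\<kappa>. \<forall>z. \<psi> (b \<otimes>\<^bsub>OM\<^esub> cs (mat_unit 1 1 z)) = \<kappa> * z ^ 2"
  proof (induction rule: A.ore_induct_left)
    case (const Y)
    have "\<psi> (cs Y \<otimes>\<^bsub>OM\<^esub> cs (mat_unit 1 1 z)) = (\<psi> (cs (mat_unit 1 1 1)) * (Y $$ (1, 1)) ^ 2) * z ^ 2" for z
    proof -
      have "Y * mat_unit 1 1 z = mat_unit 0 1 (Y $$ (0, 1) * z) + mat_unit 1 1 (Y $$ (1, 1) * z)"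
        using const by (intro eq_matI) (auto simp: scalar_prod_def sum_upto_2 less_2_cases_iff)
      then have "\<psi> (cs Y \<otimes>\<^bsub>OM\<^esub> cs (mat_unit 1 1 z)) =
          \<psi> (cs (mat_unit 0 1 (Y $$ (0, 1) * z)) \<oplus>\<^bsub>OM\<^esub> cs (mat_unit 1 1 (Y $$ (1, 1) * z)))"
        using const by (simp add: A.const_mult_const A.const_add)
      also have "\<dots> = \<psi> (cs (mat_unit 1 1 (Y $$ (1, 1) * z)))"
        using g by (simp add: \<psi>_add)
      also have "\<dots> = (\<psi> (cs (mat_unit 1 1 1)) * (Y $$ (1, 1)) ^ 2) * z ^ 2"
        by (subst f) (simp add: power_mult_distrib)
      finally show ?thesis .
    qed
    then show ?case
      by blast
  next
    case (add p q)
    then obtain \<kappa> \<kappa>' where "\<forall>z. \<psi> (p \<otimes>\<^bsub>OM\<^esub> cs (mat_unit 1 1 z)) = \<kappa> * z ^ 2" "\<forall>z. \<psi> (q \<otimes>\<^bsub>OM\<^esub> cs (mat_unit 1 1 z)) = \<kappa>' * z ^ 2"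
      by blast
    moreover have "p \<in> carrier OM" "q \<in> carrier OM"
      using add by (simp_all add: carrier_OM)
    ultimately have "\<forall>z. \<psi> ((p \<oplus>\<^bsub>OM\<^esub> q) \<otimes>\<^bsub>OM\<^esub> cs (mat_unit 1 1 z)) = (\<kappa> + \<kappa>') * z ^ 2"
      by (simp add: O.l_distr \<psi>_add distrib_right)
    then show ?case
      by blast
  next
    case (var p)
    then obtain \<kappa> where "\<forall>z. \<psi> (p \<otimes>\<^bsub>OM\<^esub> cs (mat_unit 1 1 z)) = \<kappa> * z ^ 2"
      by blast
    moreover have "p \<in> carrier OM"
      using var by (simp add: carrier_OM)
    ultimately have "\<forall>z. \<psi> ((X \<otimes>\<^bsub>OM\<^esub> p) \<otimes>\<^bsub>OM\<^esub> cs (mat_unit 1 1 z)) = (f8_gen ^ 2 * \<kappa>) * z ^ 2"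
      by (simp add: O.m_assoc \<psi>_left)
    then show ?case
      by blast
  qed
  then show ?thesis
    by (simp add: \<psi>_def)
qed

lemma not_frobenius_OM: "\<not> frobenius_extension poly_F2 OM"
proof
  assume "frobenius_extension poly_F2 OM"
  then obtain \<Phi> where \<Phi>: "bij_betw \<Phi> (carrier OM) (right_dual poly_F2 OM)"
    and lin: "\<And>c u b. c \<in> poly_F2 \<Longrightarrow> u \<in> carrier OM \<Longrightarrow> b \<in> carrier OM \<Longrightarrow>
      \<Phi> (c \<otimes>\<^bsub>OM\<^esub> u \<otimes>\<^bsub>OM\<^esub> b) = dual_act OM c (\<Phi> u) b"
    unfolding frobenius_extension_def by blast
  \<comment> \<open>Right linearity gives \<Phi>(b) = \<Phi>(1) b, the functional sending u to
    \<chi>(b u); so \<Phi>(1) determines \<Phi>.\<close>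
  define \<chi> where "\<chi> = \<Phi> \<one>\<^bsub>OM\<^esub>"
  have "\<chi> \<in> right_dual poly_F2 OM"
    using \<Phi> by (auto simp: \<chi>_def dest: bij_betwE)
  then have \<chi>: "\<chi> \<in> carrier OM \<rightarrow> poly_F2"
    and add: "\<And>u v. u \<in> carrier OM \<Longrightarrow> v \<in> carrier OM \<Longrightarrow> \<chi> (u \<oplus>\<^bsub>OM\<^esub> v) = \<chi> u \<oplus>\<^bsub>OM\<^esub> \<chi> v"
    and right: "\<And>u c. u \<in> carrier OM \<Longrightarrow> c \<in> poly_F2 \<Longrightarrow> \<chi> (u \<otimes>\<^bsub>OM\<^esub> c) = \<chi> u \<otimes>\<^bsub>OM\<^esub> c"
    by (auto simp: right_dual_def PiE_def)
  have \<chi>': "\<chi> u \<in> carrier OM" if "u \<in> carrier OM" for u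
    using that \<chi> poly_F2_closed by blast
  have \<Phi>_eq: "\<Phi> b u = \<chi> (b \<otimes>\<^bsub>OM\<^esub> u)" if "b \<in> carrier OM" "u \<in> carrier OM" for b u
    using lin[OF poly_F2_one O.one_closed that(1)] that by (simp add: dual_act_def \<chi>' flip: \<chi>_def)
  \<comment> \<open>\<Phi>(x) is computed in two ways, as \<Phi>(1) x and as x \<Phi>(1).\<close>
  have left: "\<chi> (X \<otimes>\<^bsub>OM\<^esub> u) = X \<otimes>\<^bsub>OM\<^esub> \<chi> u" if "u \<in> carrier OM" for u
    using lin[OF X_poly_F2 O.one_closed O.one_closed] that \<Phi>_eq[OF X_closed that]
    by (simp add: dual_act_def flip: \<chi>_def)
  define \<eta> where "\<eta> = restrict (trace_coord 1 1 1) (carrier OM)"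
  have "\<eta> \<in> right_dual poly_F2 OM"
    using poly_F2_closed by (auto simp: right_dual_def \<eta>_def trace_coord_closed trace_coord_add trace_coord_right_linear)
  then obtain b where b: "b \<in> carrier OM" "\<eta> = \<Phi> b"
    using \<Phi> by (metis bij_betw_iff_bijections)
  obtain \<kappa> where \<kappa>: "\<And>z. eval_root (\<chi> (b \<otimes>\<^bsub>OM\<^esub> cs (mat_unit 1 1 z))) = \<kappa> * z ^ 2"
    using bimodule_morphism_degenerate[OF \<chi> add left right[OF _ X_poly_F2] b(1)] by blast
  have "f8_trace z = \<kappa> * z ^ 2" for z
  proof -
    have "\<eta> (cs (mat_unit 1 1 z)) = cs (entry_trace 1 1 1 (mat_unit 1 1 z))"
      by (simp add: \<eta>_def trace_coord_const)
    then have "eval_root (\<eta> (cs (mat_unit 1 1 z))) = f8_trace z"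
      by (simp add: eval_root_const) (simp add: entry_trace_def)
    then show ?thesis
      using \<kappa>[of z] b by (simp add: \<Phi>_eq)
  qed
  \<comment> \<open>z = 1 yields \<kappa> = tr(1) = 1, and then z = a yields a^2 = tr(a) =
    1.\<close>
  from this[of 1] this[of f8_gen] have "f8_gen ^ 2 = 1"
    by simp
  then show False
    using one_add_gen2_nonzero by (simp add: f8_add_self)
qed

theorem mainTheorem2:
  shows "(ring_extension poly_F2 ore_M2_F8 \<and>
          biseparable_extension poly_F2 ore_M2_F8 \<and>
          \<not> frobenius_extension poly_F2 ore_M2_F8) \<and>
         (\<exists>(B :: (nat \<Rightarrow> f8 mat) ring) C.
            ring_extension C B \<and> biseparable_extension C B \<and> \<not> frobenius_extension C B)"
proof -
  have "ring_extension poly_F2 ore_M2_F8"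
    using O.ring_axioms subring_poly_F2 by (simp add: ring_extension_def)
  moreover have "biseparable_extension poly_F2 ore_M2_F8"
    unfolding biseparable_extension_def
    using split_OM separable_OM fg_projective_left_OM fg_projective_right_OM by blast
  ultimately show ?thesis
    using not_frobenius_OM by blast
qed

end
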